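(* Let $q\ge2$. Suppose that the abstract decomposition framework described in the context holds (Assumptions (I), (II), (III)), with $\mathcal{A}_\ell$ being $k_\ell$-monotone for $k_\ell\colon\mathcal{V}_\ell\to[0,\infty)$, $\ell=1,\ldots,q$. Let $u\in\mathcal{W}$ be the solution of $\mathcal{F}u=0$ in $\mathcal{V}^*$ and assume that $u\in\bigcap_{\ell=1}^qD(\mathcal{F}_\ell)$. Assume moreover that there is a constant $c>0$ such that, for every $\ell=1,\ldots,q$, $$k_\ell(\mathcal{R}_\ell v)\ge c\|v\|_{\mathcal{H}}^2\quad\text{for all }v\in\mathcal{H}\text{ with }\mathcal{R}_\ell v\in\mathcal{V}_\ell.$$ Let $C>0$ be a constant and $u^0\in\mathcal{H}$. For each $N\in\mathbb{N}$, $N\geq 1$, set $s=C\sqrt{N}$ and let $u^1,\ldots,u^N\in\mathcal{H}$ be the additive splitting approximation defined by $$(sI+\mathcal{F}_\ell)u_\ell^{n+1}=su^n\quad\text{for }\ell=1,\ldots,q,\qquad u^{n+1}=\frac1q\sum_{\ell=1}^qu_\ell^{n+1},\qquad n=0,\ldots,N-1,$$ with $u_\ell^{n+1}\in D(\mathcal{F}_\ell)$. Then $$\lim_{N\to\infty}\|u^N-u\|_{\mathcal{H}}=0,$$ where, for each $N$, $u^N$ is the $N$-th iterate computed with $s=C\sqrt N$.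
   Context: **Operator notions.** Let $V$ be a real Banach space with dual $V^*$ and dual pairing $\langle\cdot,\cdot\rangle_{V^*\times V}$, and $G\colon V\to V^*$ possibly nonlinear. $G$ is bounded if it maps bounded sets to bounded sets; for a function $k\colon V\to[0,\infty)$, $G$ is $k$-monotone if $\langle Gu-Gv,u-v\rangle_{V^*\times V}\ge k(u-v)$ for all $u,v\in V$ (monotone if this holds with $k\equiv0$); $G$ is hemicontinuous if $\varepsilon\mapsto\langle G(u+\varepsilon v),w\rangle_{V^*\times V}$ is continuous on $[0,1]$ for all $u,v,w\in V$; $G$ is coercive if $\langle Gu,u\rangle_{V^*\times V}\to\infty$ as $\|u\|_V\to\infty$; $G$ is symmetric if $\langle Gu,v\rangle=\langle Gv,u\rangle$ for all $u,v$. For $M\colon H\to H$ on a Hilbert space the same terms are used with the inner product of $H$. **Spaces.** Fix $T>0$ and $p\in[2,\infty)$. If $V$ is a separable, reflexive Banach space densely (and continuously) embedded in a Hilbert space $H$, put $\mathcal{H}=L^2(0,T;H)$, $\mathcal{V}=L^p(0,T;V)$, $\mathcal{V}^*\cong L^{p/(p-1)}(0,T;V^* )$, with Gelfand triples $V\hookrightarrow H\hookrightarrow V^*$ and $\mathcal{V}\hookrightarrow\mathcal{H}\hookrightarrow\mathcal{V}^*$. A bounded linear $M\colon H\to H$ induces $(\mathcal{M}u)(t)=Mu(t)$ on $\mathcal{H}$, and a family $A(t)\colon V\to V^*$ induces $\mathcal{A}\colon\mathcal{V}\to\mathcal{V}^*$, $(\mathcal{A}u)(t)=A(t)u(t)$,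 for a.e. $t\in(0,T)$. The operator $\mathrm{d}/\mathrm{d}t$ on $\mathcal{V}^*$ has domain $D(\mathrm{d}/\mathrm{d}t)=\{u\in W^{1,p/(p-1)}(0,T;V^* ):u(0)=0\}$; equivalently $\mathrm{d}/\mathrm{d}t\,u=\lim_{\tau\to0^+}\frac1\tau(I-S(\tau))u$ in $\mathcal{V}^*$, where $S(\tau)u(t)=0$ for $0\le t\le\tau$ and $S(\tau)u(t)=u(t-\tau)$ for $\tau<t\le T$. Put $\mathcal{W}=\{u\in\mathcal{V}:\mathcal{M}u\in D(\mathrm{d}/\mathrm{d}t)\}$. **Proper.** $(V,H,M,\mathcal{A})$ is proper if $V$ is a separable, reflexive Banach space densely embedded in the Hilbert space $H$; $M\colon H\to H$ is linear, bounded, monotone and symmetric; and $\mathcal{A}\colon\mathcal{V}\to\mathcal{V}^*$ is bounded, $k$-monotone (for some $k\colon\mathcal{V}\to[0,\infty)$), hemicontinuous and coercive. **Decomposition.** We are given $(V,H,M,\mathcal{A})$ and $(V_\ell,H_\ell,M_\ell,\mathcal{A}_\ell)$, $\ell=1,\ldots,q$ (all with the same $p$ and $T$; the induced objects are $\mathcal{H}_\ell=L^2(0,T;H_\ell)$, $\mathcal{V}_\ell=L^p(0,T;V_\ell)$ with $\mathcal{V}_\ell^*\cong L^{p/(p-1)}(0,T;V_\ell^* )$, $(\mathcal{M}_\ell u)(t)=M_\ell u(t)$ for $u\in\mathcal{H}_\ell$ and a.e. $t\in(0,T)$, the operator $\mathrm{d}/\mathrm{d}t$ on $\mathcal{V}_\ell^*$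 with domain $\{u\in W^{1,p/(p-1)}(0,T;V_\ell^* ):u(0)=0\}$, and $\mathcal{W}_\ell=\{u\in\mathcal{V}_\ell:\mathcal{M}_\ell u\in W^{1,p/(p-1)}(0,T;V_\ell^* ),\ (\mathcal{M}_\ell u)(0)=0\}$), linear bounded operators $E_\ell\colon H_\ell\to H$, $R_\ell\colon H\to H_\ell$, with induced operators $(\mathcal{E}_\ell u)(t)=E_\ell u(t)$, $(\mathcal{R}_\ell u)(t)=R_\ell u(t)$, and functionals $f\in\mathcal{V}^*$, $f_\ell\in\mathcal{V}_\ell^*$. Define $\mathcal{F}u=\mathrm{d}/\mathrm{d}t\,\mathcal{M}u+\mathcal{A}u+f\in\mathcal{V}^*$ for $u\in\mathcal{W}$, and $$D(\mathcal{F}_\ell)=\{u\in\mathcal{H}:\mathcal{R}_\ell u\in\mathcal{W}_\ell,\ (\mathrm{d}/\mathrm{d}t\,\mathcal{M}_\ell+\mathcal{A}_\ell)\mathcal{R}_\ell u+f_\ell\in\mathcal{H}_\ell\},$$ $$\mathcal{F}_\ell u=\mathcal{E}_\ell\bigl((\mathrm{d}/\mathrm{d}t\,\mathcal{M}_\ell+\mathcal{A}_\ell)\mathcal{R}_\ell u+f_\ell\bigr)\in\mathcal{H},\quad u\in D(\mathcal{F}_\ell).$$ **Assumption (I).** All the problem sets are proper; $R_\ell E_\ell=I$ on $H_\ell$ and $(E_\ell u,v)_H=(u,R_\ell v)_{H_\ell}$ for all $u\in H_\ell$, $v\in H$; $Mu=\sum_{\ell=1}^qE_\ell M_\ell R_\ell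 u$ for all $u\in H$. **Assumption (II).** Each $R_\ell$ is bounded from $V$ to $V_\ell$; and if $u\in H$ satisfies $R_\ell u\in V_\ell$ for all $\ell$, then $u\in V$ and $\|u\|_V^p\le C'\sum_{\ell=1}^q\|R_\ell u\|_{V_\ell}^p$ with a constant $C'>0$ independent of $u$. **Assumption (III).** For every $u\in\bigcap_{\ell=1}^qD(\mathcal{F}_\ell)$ (such $u$ lie in $\mathcal{W}$ by (I) and (II)) one has $\mathcal{F}u=\sum_{\ell=1}^q\mathcal{F}_\ell u$ in $\mathcal{H}$. Under Assumption (I), for every $s>0$ the operator $sI+\mathcal{F}_\ell\colon D(\mathcal{F}_\ell)\to\mathcal{H}$ is bijective, so the scheme is well defined. *)

theory Defs
  imports "HOL-Analysis.Analysis"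
begin

text \<open>
  Finitely many, mutually unrelated Banach and Hilbert spaces have to be quantified over by an
  index \<open>l = 1, ..., q\<close>, so a space is a carrier set together with a norm rather than a type.
  A Hilbert space is a closed subspace of a complete inner product space; this is no restriction,
  since the spaces of a finite family are closed subspaces of their orthogonal sum. A space \<open>V\<close>
  embedded in a Hilbert space \<open>H\<close> is a linear subspace of \<open>H\<close> with a norm \<open>n\<close> of its own.
\<close>

definition normed_on :: "'a::real_vector set \<Rightarrow> ('a \<Rightarrow> real) \<Rightarrow> bool" where
  "normed_on X n \<longleftrightarrow> subspace X \<and>
     (\<forall>x\<in>X. 0 \<le> n x \<and> (n x = 0 \<longleftrightarrow> x = 0)) \<and>
     (\<forall>x\<in>X. \<forall>a. n (a *\<^sub>R x) = \<bar>a\<bar> * n x) \<and>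
     (\<forall>x\<in>X. \<forall>y\<in>X. n (x + y) \<le> n x + n y)"

definition banach_on :: "'a::real_vector set \<Rightarrow> ('a \<Rightarrow> real) \<Rightarrow> bool" where
  "banach_on X n \<longleftrightarrow> normed_on X n \<and>
     (\<forall>s :: nat \<Rightarrow> 'a. (\<forall>i. s i \<in> X) \<and>
        (\<forall>e>0. \<exists>m. \<forall>i\<ge>m. \<forall>j\<ge>m. n (s i - s j) < e) \<longrightarrow>
        (\<exists>x\<in>X. (\<lambda>i. n (s i - x)) \<longlonglongrightarrow> 0))"

definition separable_on :: "'a::real_vector set \<Rightarrow> ('a \<Rightarrow> real) \<Rightarrow> bool" where
  "separable_on X n \<longleftrightarrow>
     (\<exists>D. countable D \<and> D \<subseteq> X \<and> (\<forall>x\<in>X. \<forall>e>0. \<exists>d\<in>D. n (x - d) < e))"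

definition bounded_linear_on ::
    "'a::real_vector set \<Rightarrow> ('a \<Rightarrow> real) \<Rightarrow> 'b::real_vector set \<Rightarrow> ('b \<Rightarrow> real) \<Rightarrow> ('a \<Rightarrow> 'b) \<Rightarrow> bool" where
  "bounded_linear_on X n Y m L \<longleftrightarrow>
     (\<forall>x\<in>X. L x \<in> Y) \<and>
     (\<forall>x\<in>X. \<forall>y\<in>X. L (x + y) = L x + L y) \<and>
     (\<forall>x\<in>X. \<forall>a. L (a *\<^sub>R x) = a *\<^sub>R L x) \<and>
     (\<exists>K. \<forall>x\<in>X. m (L x) \<le> K * n x)"

text \<open>
  Functionals on \<open>X\<close> are set to \<open>0\<close> off \<open>X\<close>, so that equality in the dual is equality of functions
  and the dual is closed under pointwise operations.
\<close>

definition dual_on :: "'a::real_vector set \<Rightarrow> ('a \<Rightarrow> real) \<Rightarrow> ('a \<Rightarrow> real) set" where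
  "dual_on X n = {g. bounded_linear_on X n UNIV abs g \<and> (\<forall>x. x \<notin> X \<longrightarrow> g x = 0)}"

definition dual_norm :: "'a::real_vector set \<Rightarrow> ('a \<Rightarrow> real) \<Rightarrow> ('a \<Rightarrow> real) \<Rightarrow> real" where
  "dual_norm X n g = Sup {\<bar>g x\<bar> | x. x \<in> X \<and> n x \<le> 1}"

definition reflexive_on :: "'a::real_vector set \<Rightarrow> ('a \<Rightarrow> real) \<Rightarrow> bool" where
  "reflexive_on X n \<longleftrightarrow>
     (\<forall>\<Phi> :: ('a \<Rightarrow> real) \<Rightarrow> real.
        (\<forall>g\<in>dual_on X n. \<forall>h\<in>dual_on X n. \<Phi> (\<lambda>x. g x + h x) = \<Phi> g + \<Phi> h) \<and>
        (\<forall>g\<in>dual_on X n. \<forall>a. \<Phi> (\<lambda>x. a * g x) = a * \<Phi> g) \<and>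
        (\<exists>K. \<forall>g\<in>dual_on X n. \<bar>\<Phi> g\<bar> \<le> K * dual_norm X n g) \<longrightarrow>
        (\<exists>x\<in>X. \<forall>g\<in>dual_on X n. \<Phi> g = g x))"

definition densely_embedded :: "'a::real_normed_vector set \<Rightarrow> ('a \<Rightarrow> real) \<Rightarrow> 'a set \<Rightarrow> bool" where
  "densely_embedded V n H \<longleftrightarrow>
     V \<subseteq> H \<and> H \<subseteq> closure V \<and> (\<exists>K. \<forall>v\<in>V. norm v \<le> K * n v)"

text \<open>The embedding of \<open>H\<close> into the dual of \<open>V\<close> in the Gelfand triple.\<close>

definition embed :: "'a::real_inner set \<Rightarrow> 'a \<Rightarrow> 'a \<Rightarrow> real" where
  "embed V h = (\<lambda>v. if v \<in> V then h \<bullet> v else 0)"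

text \<open>
  Elements of the Bochner spaces are represented by functions \<open>real \<Rightarrow> 'a\<close>, of which only the
  restriction to \<open>(0,T)\<close> matters; equality in the spaces is \<open>eq_ae\<close>.
\<close>

abbreviation time :: "real \<Rightarrow> real measure" where
  "time T \<equiv> lebesgue_on {0<..<T}"

definition eq_ae :: "real \<Rightarrow> (real \<Rightarrow> 'a) \<Rightarrow> (real \<Rightarrow> 'a) \<Rightarrow> bool" where
  "eq_ae T u v \<longleftrightarrow> (AE t in time T. u t = v t)"

definition strongly_measurable ::
    "real \<Rightarrow> 'a::minus set \<Rightarrow> ('a \<Rightarrow> real) \<Rightarrow> (real \<Rightarrow> 'a) \<Rightarrow> bool" where
  "strongly_measurable T X n u \<longleftrightarrow>
     (AE t in time T. u t \<in> X) \<and>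
     (\<exists>s :: nat \<Rightarrow> real \<Rightarrow> 'a.
        (\<forall>i. simple_function (time T) (s i) \<and> (\<forall>t. s i t \<in> X)) \<and>
        (AE t in time T. (\<lambda>i. n (s i t - u t)) \<longlonglongrightarrow> 0))"

definition Lspace :: "real \<Rightarrow> real \<Rightarrow> 'a::minus set \<Rightarrow> ('a \<Rightarrow> real) \<Rightarrow> (real \<Rightarrow> 'a) set" where
  "Lspace r T X n =
     {u. strongly_measurable T X n u \<and> integrable (time T) (\<lambda>t. n (u t) powr r)}"

definition Lnorm :: "real \<Rightarrow> real \<Rightarrow> ('a \<Rightarrow> real) \<Rightarrow> (real \<Rightarrow> 'a) \<Rightarrow> real" where
  "Lnorm r T n u = (LINT t|time T. n (u t) powr r) powr (1 / r)"

definition conj_exp :: "real \<Rightarrow> real" where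
  "conj_exp p = p / (p - 1)"

definition pairing :: "real \<Rightarrow> (real \<Rightarrow> 'a \<Rightarrow> real) \<Rightarrow> (real \<Rightarrow> 'a) \<Rightarrow> real" where
  "pairing T g u = (LINT t|time T. g t (u t))"

text \<open>
  Testing with \<open>C\<^sup>1\<close> functions of compact support gives the same weak derivatives as testing with
  smooth ones.
\<close>

definition test_function :: "real \<Rightarrow> (real \<Rightarrow> real) \<Rightarrow> bool" where
  "test_function T \<phi> \<longleftrightarrow> \<phi> C1_differentiable_on UNIV \<and>
     compact (closure {t. \<phi> t \<noteq> 0}) \<and> closure {t. \<phi> t \<noteq> 0} \<subseteq> {0<..<T}"

text \<open>
  The identity \<open>\<integral> \<phi>' u = - \<integral> \<phi> g\<close> of Bochner integrals in the dual of \<open>V\<close>, evaluated at each \<open>v\<close>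
  in \<open>V\<close>; evaluation commutes with the Bochner integral and separates the dual.
\<close>

definition weak_derivative ::
    "real \<Rightarrow> 'a set \<Rightarrow> (real \<Rightarrow> 'a \<Rightarrow> real) \<Rightarrow> (real \<Rightarrow> 'a \<Rightarrow> real) \<Rightarrow> bool" where
  "weak_derivative T V u g \<longleftrightarrow>
     (\<forall>\<phi>. test_function T \<phi> \<longrightarrow> (\<forall>v\<in>V.
        (LINT t|time T. deriv \<phi> t * u t v) = - (LINT t|time T. \<phi> t * g t v)))"

definition W1_dual ::
    "real \<Rightarrow> real \<Rightarrow> 'a::real_vector set \<Rightarrow> ('a \<Rightarrow> real) \<Rightarrow> (real \<Rightarrow> 'a \<Rightarrow> real) set" where
  "W1_dual r T V n =
     {u \<in> Lspace r T (dual_on V n) (dual_norm V n).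
        \<exists>g \<in> Lspace r T (dual_on V n) (dual_norm V n). weak_derivative T V u g}"

text \<open>\<open>u(0) = 0\<close> refers to the representative of \<open>u\<close> that is continuous on \<open>[0,T]\<close>.\<close>

definition zero_initial ::
    "real \<Rightarrow> 'a::real_vector set \<Rightarrow> ('a \<Rightarrow> real) \<Rightarrow> (real \<Rightarrow> 'a \<Rightarrow> real) \<Rightarrow> bool" where
  "zero_initial T V n u \<longleftrightarrow>
     (\<exists>w. eq_ae T u w \<and>
        (\<forall>t\<in>{0..T}. w t \<in> dual_on V n) \<and>
        (\<forall>t\<in>{0..T}. ((\<lambda>s. dual_norm V n (w s - w t)) \<longlongrightarrow> 0) (at t within {0..T})) \<and>
        w 0 = (\<lambda>v. 0))"

definition dom_ddt ::
    "real \<Rightarrow> real \<Rightarrow> 'a::real_vector set \<Rightarrow> ('a \<Rightarrow> real) \<Rightarrow> (real \<Rightarrow> 'a \<Rightarrow> real) set" where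
  "dom_ddt p T V n = {u \<in> W1_dual (conj_exp p) T V n. zero_initial T V n u}"

text \<open>The weak derivative is unique up to \<open>eq_ae\<close>, so any representative serves.\<close>

definition ddt ::
    "real \<Rightarrow> real \<Rightarrow> 'a::real_vector set \<Rightarrow> ('a \<Rightarrow> real) \<Rightarrow> (real \<Rightarrow> 'a \<Rightarrow> real) \<Rightarrow> (real \<Rightarrow> 'a \<Rightarrow> real)" where
  "ddt p T V n u = (SOME g. g \<in> Lspace (conj_exp p) T (dual_on V n) (dual_norm V n) \<and>
                            weak_derivative T V u g)"

text \<open>
  \<open>MM\<close> acts on \<open>HH\<close>, whereas \<open>AA\<close> is the operator between the Bochner spaces, which need not be
  induced by a family of operators on \<open>VV\<close>. The inhomogeneity \<open>ff\<close> is kept with the problem.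
\<close>

record 'a problem =
  HH :: "'a set"
  VV :: "'a set"
  nV :: "'a \<Rightarrow> real"
  MM :: "'a \<Rightarrow> 'a"
  AA :: "(real \<Rightarrow> 'a) \<Rightarrow> (real \<Rightarrow> 'a \<Rightarrow> real)"
  ff :: "real \<Rightarrow> 'a \<Rightarrow> real"

definition calH :: "real \<Rightarrow> ('a::real_inner) problem \<Rightarrow> (real \<Rightarrow> 'a) set" where
  "calH T P = Lspace 2 T (HH P) norm"

definition calV :: "real \<Rightarrow> real \<Rightarrow> ('a::real_inner) problem \<Rightarrow> (real \<Rightarrow> 'a) set" where
  "calV p T P = Lspace p T (VV P) (nV P)"

text \<open>The dual of \<open>calV\<close>, identified with the dual-valued functions through \<open>pairing\<close>.\<close>

definition calV_dual :: "real \<Rightarrow> real \<Rightarrow> ('a::real_inner) problem \<Rightarrow> (real \<Rightarrow> 'a \<Rightarrow> real) set" where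
  "calV_dual p T P = Lspace (conj_exp p) T (dual_on (VV P) (nV P)) (dual_norm (VV P) (nV P))"

definition normH :: "real \<Rightarrow> (real \<Rightarrow> 'a::real_inner) \<Rightarrow> real" where
  "normH T u = Lnorm 2 T norm u"

definition normV :: "real \<Rightarrow> real \<Rightarrow> ('a::real_inner) problem \<Rightarrow> (real \<Rightarrow> 'a) \<Rightarrow> real" where
  "normV p T P u = Lnorm p T (nV P) u"

definition normV_dual :: "real \<Rightarrow> real \<Rightarrow> ('a::real_inner) problem \<Rightarrow> (real \<Rightarrow> 'a \<Rightarrow> real) \<Rightarrow> real" where
  "normV_dual p T P g = Lnorm (conj_exp p) T (dual_norm (VV P) (nV P)) g"

text \<open>
  Operators and functions on spaces of classes of functions are given on representatives and
  have to respect \<open>eq_ae\<close>.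
\<close>

definition maps_V_dual :: "real \<Rightarrow> real \<Rightarrow> ('a::real_inner) problem \<Rightarrow> bool" where
  "maps_V_dual p T P \<longleftrightarrow>
     (\<forall>u\<in>calV p T P. AA P u \<in> calV_dual p T P) \<and>
     (\<forall>u\<in>calV p T P. \<forall>v\<in>calV p T P. eq_ae T u v \<longrightarrow> eq_ae T (AA P u) (AA P v))"

definition bounded_op :: "real \<Rightarrow> real \<Rightarrow> ('a::real_inner) problem \<Rightarrow> bool" where
  "bounded_op p T P \<longleftrightarrow>
     (\<forall>K. \<exists>K'. \<forall>u\<in>calV p T P. normV p T P u \<le> K \<longrightarrow> normV_dual p T P (AA P u) \<le> K')"

definition k_monotone :: "real \<Rightarrow> real \<Rightarrow> ('a::real_inner) problem \<Rightarrow> ((real \<Rightarrow> 'a) \<Rightarrow> real) \<Rightarrow> bool" where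
  "k_monotone p T P k \<longleftrightarrow>
     (\<forall>u\<in>calV p T P. 0 \<le> k u) \<and>
     (\<forall>u\<in>calV p T P. \<forall>v\<in>calV p T P. eq_ae T u v \<longrightarrow> k u = k v) \<and>
     (\<forall>u\<in>calV p T P. \<forall>v\<in>calV p T P.
        pairing T (AA P u - AA P v) (\<lambda>t. u t - v t) \<ge> k (\<lambda>t. u t - v t))"

definition hemicontinuous :: "real \<Rightarrow> real \<Rightarrow> ('a::real_inner) problem \<Rightarrow> bool" where
  "hemicontinuous p T P \<longleftrightarrow>
     (\<forall>u\<in>calV p T P. \<forall>v\<in>calV p T P. \<forall>w\<in>calV p T P.
        continuous_on {0..1} (\<lambda>\<epsilon>::real. pairing T (AA P (\<lambda>t. u t + \<epsilon> *\<^sub>R v t)) w))"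

definition coercive :: "real \<Rightarrow> real \<Rightarrow> ('a::real_inner) problem \<Rightarrow> bool" where
  "coercive p T P \<longleftrightarrow>
     (\<forall>K. \<exists>r. \<forall>u\<in>calV p T P. normV p T P u \<ge> r \<longrightarrow> pairing T (AA P u) u \<ge> K)"

definition proper :: "real \<Rightarrow> real \<Rightarrow> ('a::{real_inner,banach}) problem \<Rightarrow> bool" where
  "proper p T P \<longleftrightarrow>
     subspace (HH P) \<and> closed (HH P) \<and>
     banach_on (VV P) (nV P) \<and> separable_on (VV P) (nV P) \<and> reflexive_on (VV P) (nV P) \<and>
     densely_embedded (VV P) (nV P) (HH P) \<and>
     bounded_linear_on (HH P) norm (HH P) norm (MM P) \<and>
     (\<forall>u\<in>HH P. \<forall>v\<in>HH P. (MM P u - MM P v) \<bullet> (u - v) \<ge> 0) \<and>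
     (\<forall>u\<in>HH P. \<forall>v\<in>HH P. MM P u \<bullet> v = MM P v \<bullet> u) \<and>
     maps_V_dual p T P \<and> bounded_op p T P \<and> (\<exists>k. k_monotone p T P k) \<and>
     hemicontinuous p T P \<and> coercive p T P"

text \<open>\<open>t \<mapsto> M u(t)\<close>, regarded as an element of the dual of \<open>calV\<close>.\<close>

definition calM :: "('a::real_inner) problem \<Rightarrow> (real \<Rightarrow> 'a) \<Rightarrow> (real \<Rightarrow> 'a \<Rightarrow> real)" where
  "calM P u = (\<lambda>t. embed (VV P) (MM P (u t)))"

definition calW :: "real \<Rightarrow> real \<Rightarrow> ('a::real_inner) problem \<Rightarrow> (real \<Rightarrow> 'a) set" where
  "calW p T P = {u \<in> calV p T P. calM P u \<in> dom_ddt p T (VV P) (nV P)}"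

definition calF :: "real \<Rightarrow> real \<Rightarrow> ('a::real_inner) problem \<Rightarrow> (real \<Rightarrow> 'a) \<Rightarrow> (real \<Rightarrow> 'a \<Rightarrow> real)" where
  "calF p T P u =
     (\<lambda>t v. ddt p T (VV P) (nV P) (calM P u) t v + AA P u t v + ff P t v)"

text \<open>\<open>g\<close>, an element of the dual of \<open>calV\<close>, is given by the element \<open>h\<close> of \<open>calH\<close>.\<close>

definition represents :: "real \<Rightarrow> ('a::real_inner) problem \<Rightarrow> (real \<Rightarrow> 'a \<Rightarrow> real) \<Rightarrow> (real \<Rightarrow> 'a) \<Rightarrow> bool" where
  "represents T P g h \<longleftrightarrow> h \<in> calH T P \<and> eq_ae T g (\<lambda>t. embed (VV P) (h t))"

text \<open>
  \<open>P\<close> is the given problem, \<open>Q\<close> one of the problems \<open>1, ..., q\<close> of the decomposition, and \<open>E\<close> and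
  \<open>R\<close> are the operators that belong to \<open>Q\<close>.
\<close>

definition dom_Fl ::
    "real \<Rightarrow> real \<Rightarrow> ('a::real_inner) problem \<Rightarrow> ('b::real_inner) problem \<Rightarrow> ('a \<Rightarrow> 'b) \<Rightarrow> (real \<Rightarrow> 'a) set" where
  "dom_Fl p T P Q R =
     {u \<in> calH T P. (\<lambda>t. R (u t)) \<in> calW p T Q \<and>
        (\<exists>h. represents T Q (calF p T Q (\<lambda>t. R (u t))) h)}"

definition calFl ::
    "real \<Rightarrow> real \<Rightarrow> ('b::real_inner) problem \<Rightarrow> ('b \<Rightarrow> 'a) \<Rightarrow> ('a \<Rightarrow> 'b) \<Rightarrow> (real \<Rightarrow> 'a) \<Rightarrow> (real \<Rightarrow> 'a)" where
  "calFl p T Q E R u =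
     (\<lambda>t. E ((SOME h. represents T Q (calF p T Q (\<lambda>t. R (u t))) h) t))"

definition decomposition_data ::
    "real \<Rightarrow> real \<Rightarrow> nat \<Rightarrow> ('a::{real_inner,banach}) problem \<Rightarrow> (nat \<Rightarrow> ('b::{real_inner,banach}) problem) \<Rightarrow>
     (nat \<Rightarrow> 'b \<Rightarrow> 'a) \<Rightarrow> (nat \<Rightarrow> 'a \<Rightarrow> 'b) \<Rightarrow> bool" where
  "decomposition_data p T q P Q E R \<longleftrightarrow>
     0 < T \<and> 2 \<le> p \<and> ff P \<in> calV_dual p T P \<and>
     (\<forall>l\<in>{1..q}. ff (Q l) \<in> calV_dual p T (Q l) \<and>
        bounded_linear_on (HH (Q l)) norm (HH P) norm (E l) \<and>
        bounded_linear_on (HH P) norm (HH (Q l)) norm (R l))"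

definition assumption_I ::
    "real \<Rightarrow> real \<Rightarrow> nat \<Rightarrow> ('a::{real_inner,banach}) problem \<Rightarrow> (nat \<Rightarrow> ('b::{real_inner,banach}) problem) \<Rightarrow>
     (nat \<Rightarrow> 'b \<Rightarrow> 'a) \<Rightarrow> (nat \<Rightarrow> 'a \<Rightarrow> 'b) \<Rightarrow> bool" where
  "assumption_I p T q P Q E R \<longleftrightarrow>
     proper p T P \<and> (\<forall>l\<in>{1..q}. proper p T (Q l)) \<and>
     (\<forall>l\<in>{1..q}. \<forall>u\<in>HH (Q l). R l (E l u) = u) \<and>
     (\<forall>l\<in>{1..q}. \<forall>u\<in>HH (Q l). \<forall>v\<in>HH P. E l u \<bullet> v = u \<bullet> R l v) \<and>
     (\<forall>u\<in>HH P. MM P u = (\<Sum>l=1..q. E l (MM (Q l) (R l u))))"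

definition assumption_II ::
    "real \<Rightarrow> nat \<Rightarrow> ('a::{real_inner,banach}) problem \<Rightarrow> (nat \<Rightarrow> ('b::{real_inner,banach}) problem) \<Rightarrow>
     (nat \<Rightarrow> 'a \<Rightarrow> 'b) \<Rightarrow> bool" where
  "assumption_II p q P Q R \<longleftrightarrow>
     (\<forall>l\<in>{1..q}. bounded_linear_on (VV P) (nV P) (VV (Q l)) (nV (Q l)) (R l)) \<and>
     (\<exists>C'>0. \<forall>u\<in>HH P. (\<forall>l\<in>{1..q}. R l u \<in> VV (Q l)) \<longrightarrow>
        u \<in> VV P \<and> nV P u powr p \<le> C' * (\<Sum>l=1..q. nV (Q l) (R l u) powr p))"

definition assumption_III ::
    "real \<Rightarrow> real \<Rightarrow> nat \<Rightarrow> ('a::{real_inner,banach}) problem \<Rightarrow> (nat \<Rightarrow> ('b::{real_inner,banach}) problem) \<Rightarrow>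
     (nat \<Rightarrow> 'b \<Rightarrow> 'a) \<Rightarrow> (nat \<Rightarrow> 'a \<Rightarrow> 'b) \<Rightarrow> bool" where
  "assumption_III p T q P Q E R \<longleftrightarrow>
     (\<forall>u. (\<forall>l\<in>{1..q}. u \<in> dom_Fl p T P (Q l) (R l)) \<longrightarrow>
        represents T P (calF p T P u) (\<lambda>t. \<Sum>l=1..q. calFl p T (Q l) (E l) (R l) u t))"

text \<open>
  \<open>U n\<close>, \<open>n = 0, ..., N\<close>, are the iterates started at \<open>u0\<close>, and \<open>UL n l\<close>, \<open>n = 1, ..., N\<close>, the
  intermediate approximations.
\<close>

definition additive_splitting ::
    "real \<Rightarrow> real \<Rightarrow> nat \<Rightarrow> ('a::{real_inner,banach}) problem \<Rightarrow> (nat \<Rightarrow> ('b::{real_inner,banach}) problem) \<Rightarrow>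
     (nat \<Rightarrow> 'b \<Rightarrow> 'a) \<Rightarrow> (nat \<Rightarrow> 'a \<Rightarrow> 'b) \<Rightarrow> real \<Rightarrow> nat \<Rightarrow> (real \<Rightarrow> 'a) \<Rightarrow>
     (nat \<Rightarrow> real \<Rightarrow> 'a) \<Rightarrow> (nat \<Rightarrow> nat \<Rightarrow> real \<Rightarrow> 'a) \<Rightarrow> bool" where
  "additive_splitting p T q P Q E R s N u0 U UL \<longleftrightarrow>
     eq_ae T (U 0) u0 \<and> (\<forall>n\<le>N. U n \<in> calH T P) \<and>
     (\<forall>n<N.
        (\<forall>l\<in>{1..q}. UL (Suc n) l \<in> dom_Fl p T P (Q l) (R l) \<and>
           eq_ae T (\<lambda>t. s *\<^sub>R UL (Suc n) l t + calFl p T (Q l) (E l) (R l) (UL (Suc n) l) t)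
                   (\<lambda>t. s *\<^sub>R U n t)) \<and>
        eq_ae T (U (Suc n)) (\<lambda>t. (1 / real q) *\<^sub>R (\<Sum>l=1..q. UL (Suc n) l t)))"

end

theory Submission
  imports Defs
begin

text \<open>
  Testing the \<open>l\<close>-th step with the error \<open>u\<^sub>l - u\<close> and summing over \<open>l\<close> gives an energy inequality
  in which \<open>F\<^sub>l u\<close> enters only at order \<open>1/s\<^sup>2\<close>, because \<open>\<Sum>\<^sub>l F\<^sub>l u = 0\<close>. The squared error therefore
  contracts by the factor \<open>1 / (1 + 2c/s)\<close> per step up to \<open>O(1/s\<^sup>2)\<close>, which for \<open>s = C\<surd>N\<close> leaves
  \<open>O(1/\<surd>N)\<close> after \<open>N\<close> steps.

  The strong monotonicity of \<open>F\<^sub>l\<close> rests on \<open>\<integral> \<langle>(Mw)', w\<rangle> \<ge> 0\<close> for \<open>Mw\<close> with zero initial value. Since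
  \<open>Mw\<close> is the primitive of its weak derivative \<open>g\<close>, the backward difference quotients of \<open>Mw\<close> are
  averages of \<open>g\<close>. Their pairing with \<open>w\<close> is nonnegative by the Cauchy-Schwarz inequality for \<open>M\<close>, and
  it converges to the pairing of \<open>g\<close> with \<open>w\<close>: this holds for simple \<open>w\<close> by the scalar theory, and
  Young's inequality bounds the error of approximating \<open>w\<close> by simple functions uniformly in the step.
\<close>

subsection \<open>Primitives and averages of integrable functions\<close>

text \<open>The spaces are carrier sets with norms of their own, so a dual-valued function
  \<open>g\<close> is handled through the real functions \<open>g t v\<close> of \<open>t\<close>.
  Backward quotients fit because they look only at the past, where extension by 0 agrees with the
  zero initial value. The weight \<open>d\<close> in Young's inequality settles the order of
  choices: \<open>d\<close> is fixed first, so that the term with the density is small for every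
  step \<open>\<tau>\<close>; then a simple function is taken so close to \<open>w\<close> that the
  factor \<open>d powr - p\<close> does no harm. The scaling of \<open>s\<close> balances two
  demands: \<open>s\<close> must grow for the accumulated consistency error of order
  \<open>1/s\<close> to vanish, and \<open>N/s\<close> must grow for \<open>N\<close> contractions
  by \<open>1 + 2c/s\<close> to erase the initial error.\<close>

lemma young_scaled:
  fixes p r d a b :: real
  assumes "p > 1" "r > 1" "1 / p + 1 / r = 1" "d > 0" "a \<ge> 0" "b \<ge> 0"
  shows "a * b \<le> a powr p / d powr p + d powr r * b powr r"
proof -
  have "(a / d) * (d * b) \<le> (a / d) powr p / p + (d * b) powr r / r"
    by (rule Youngs_inequality) (use assms in auto)
  also have "\<dots> \<le> (a / d) powr p + (d * b) powr r"
    using assms by (intro add_mono) (auto simp: divide_le_eq mult_le_cancel_left1)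
  finally show ?thesis
    using assms by (simp add: powr_divide powr_mult)
qed

text \<open>The integral starts at minus infinity so that \<open>prim f (t - \<tau>)\<close> makes
  sense for every shift. If \<open>f\<close> vanishes outside \<open>(0,T)\<close>, the primitive is
  0 at nonpositive arguments, which encodes the zero initial value.\<close>

definition prim :: "(real \<Rightarrow> real) \<Rightarrow> real \<Rightarrow> real" where
  "prim f t = (LINT s|lebesgue. indicator {..t} s * f s)"

lemma integrable_indicator_times:
  fixes f :: "real \<Rightarrow> real"
  assumes "integrable lebesgue f" "A \<in> sets lebesgue"
  shows "integrable lebesgue (\<lambda>s. indicator A s * f s)"
  using integrable_mult_indicator[OF assms(2,1)] by simp

lemma prim_diff:
  assumes f: "integrable lebesgue f" and "a \<le> b"
  shows "prim f b - prim f a = (LINT s|lebesgue. indicator {a<..b} s * f s)"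
proof -
  have "prim f b - prim f a = (LINT s|lebesgue. indicator {..b} s * f s - indicator {..a} s * f s)"
    unfolding prim_def by (subst Bochner_Integration.integral_diff) (auto intro!: integrable_indicator_times f)
  also have "\<dots> = (LINT s|lebesgue. indicator {a<..b} s * f s)"
    using \<open>a \<le> b\<close> by (intro Bochner_Integration.integral_cong) (auto split: split_indicator)
  finally show ?thesis .
qed

lemma prim_diff_abs:
  assumes "integrable lebesgue f" "integrable lebesgue g" "\<And>s. \<bar>f s\<bar> \<le> g s" "a \<le> b"
  shows "\<bar>prim f b - prim f a\<bar> \<le> prim g b - prim g a"
  unfolding prim_diff[OF assms(1,4)] prim_diff[OF assms(2,4)]
proof (rule order_trans[OF integral_abs_bound], intro integral_mono)
  show "integrable lebesgue (\<lambda>s. \<bar>indicator {a<..b} s * f s\<bar>)"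
    by (intro integrable_abs integrable_indicator_times assms) auto
  show "\<bar>indicator {a<..b} s * f s\<bar> \<le> indicator {a<..b} s * g s" for s
    using assms(3)[of s] by (auto split: split_indicator)
qed (auto intro!: integrable_indicator_times assms)

lemma prim_bounds:
  assumes "integrable lebesgue f" "\<And>s. 0 \<le> f s"
  shows "0 \<le> prim f t" "prim f t \<le> integral\<^sup>L lebesgue f"
  unfolding prim_def
   apply (intro Bochner_Integration.integral_nonneg, use assms in simp)
  by (intro integral_mono integrable_indicator_times)
     (use assms in \<open>auto split: split_indicator\<close>)

lemma prim_add:
  assumes "integrable lebesgue f" "integrable lebesgue g"
  shows "prim (\<lambda>s. f s + g s) t = prim f t + prim g t"
  unfolding prim_def using assms
  by (subst Bochner_Integration.integral_add[symmetric])
     (auto intro!: integrable_indicator_times simp: distrib_left right_diff_distrib)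

lemma prim_minus:
  assumes "integrable lebesgue f" "integrable lebesgue g"
  shows "prim (\<lambda>s. f s - g s) t = prim f t - prim g t"
  unfolding prim_def using assms
  by (subst Bochner_Integration.integral_diff[symmetric])
     (auto intro!: integrable_indicator_times simp: distrib_left right_diff_distrib)

lemma prim_continuous:
  assumes f: "integrable lebesgue f"
  shows "continuous_on UNIV (prim f)"
proof (intro continuous_at_imp_continuous_on ballI)
  fix t :: real
  show "isCont (prim f) t"
    unfolding continuous_at_sequentially comp_def
  proof (intro allI impI)
    fix x :: "nat \<Rightarrow> real" assume x: "x \<longlonglongrightarrow> t"
    show "(\<lambda>k. prim f (x k)) \<longlonglongrightarrow> prim f t"
      unfolding prim_def
    proof (rule Bochner_Integration.integral_dominated_convergence[where w = "\<lambda>s. \<bar>f s\<bar>"])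
      show "AE s in lebesgue. (\<lambda>k. indicator {..x k} s * f s) \<longlonglongrightarrow> indicator {..t} s * f s"
      proof (rule AE_I'[of "{t}"])
        have "(\<lambda>k. indicator {..x k} s * f s) \<longlonglongrightarrow> indicator {..t} s * f s" if "s \<noteq> t" for s
        proof (rule tendsto_eventually)
          have "\<forall>\<^sub>F k in sequentially. (s < t \<longrightarrow> s < x k) \<and> (t < s \<longrightarrow> x k < s)"
            using order_tendstoD[OF x] by (cases "s < t") auto
          then show "\<forall>\<^sub>F k in sequentially. indicator {..x k} s * f s = indicator {..t} s * f s"
            by eventually_elim (use that in \<open>auto split: split_indicator\<close>)
        qed
        then show "{s \<in> space lebesgue. \<not> (\<lambda>k. indicator {..x k} s * f s) \<longlonglongrightarrow> indicator {..t} s * f s} \<subseteq> {t}"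
          by auto
      qed (auto simp: null_sets_def)
    qed (use f in \<open>auto intro!: borel_measurable_integrable integrable_indicator_times split: split_indicator\<close>)
  qed
qed

lemma prim_borel [measurable]:
  assumes "integrable lebesgue f"
  shows "prim f \<in> borel_measurable borel"
  using prim_continuous[OF assms] by (rule borel_measurable_continuous_onI)

lemma borel_measurable_time [measurable (raw)]:
  "f \<in> borel_measurable borel \<Longrightarrow> f \<in> borel_measurable (time T)"
  by (intro measurable_restrict_space1 measurable_completion) simp

lemma finite_measure_time: "finite_measure (time T)"
  by (rule finite_measure_lebesgue_on) auto

lemma integrable_time_bounded:
  fixes f :: "real \<Rightarrow> real"
  assumes "f \<in> borel_measurable (time T)" "\<And>t. \<bar>f t\<bar> \<le> B"
  shows "integrable (time T) f"
  using assms by (intro finite_measure.integrable_const_bound[OF finite_measure_time, where B = B]) auto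

lemma prim_shift_integrable:
  assumes f: "integrable lebesgue f"
  shows "integrable (time T) (\<lambda>t. prim f (t - \<tau>))"
proof (rule integrable_time_bounded)
  show "(\<lambda>t. prim f (t - \<tau>)) \<in> borel_measurable (time T)"
    using prim_borel[OF f] by measurable
  show "\<bar>prim f (t - \<tau>)\<bar> \<le> (LINT s|lebesgue. \<bar>f s\<bar>)" for t
    unfolding prim_def
  proof (rule order_trans[OF integral_abs_bound], intro integral_mono)
    show "integrable lebesgue (\<lambda>s. \<bar>indicator {..t - \<tau>} s * f s\<bar>)"
      by (intro integrable_abs integrable_indicator_times f) auto
  qed (use f in \<open>auto split: split_indicator\<close>)
qed

lemma integral_time_shift:
  fixes f :: "real \<Rightarrow> real"
  shows "(LINT t|time T. f (t - \<tau>)) = (LINT t|lebesgue. indicator {-\<tau><..<T-\<tau>} t * f t)"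
proof -
  have "(LINT t|lebesgue. indicator {-\<tau><..<T-\<tau>} t * f t)
      = (LINT t|lebesgue. indicator {0<..<T} t * f (t - \<tau>))"
    by (subst lebesgue_integral_real_affine[where c = 1 and t = "-\<tau>"])
       (auto intro!: Bochner_Integration.integral_cong split: split_indicator)
  also have "\<dots> = (LINT t|time T. f (t - \<tau>))"
    by (subst integral_restrict_space) auto
  finally show ?thesis ..
qed

text \<open>Averaging over \<open>(t - \<tau>, t]\<close> does not increase the integral; working with primitives makes
  this a statement about the shift of a bounded monotone function.\<close>

lemma prim_shift_bound:
  assumes f: "integrable lebesgue f" and nn: "\<And>s. 0 \<le> f s" and \<tau>: "0 < \<tau>" "0 < T"
  shows "(LINT t|time T. prim f t - prim f (t - \<tau>)) \<le> \<tau> * integral\<^sup>L lebesgue f"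
proof -
  let ?I = "integral\<^sup>L lebesgue f"
  let ?i = "\<lambda>A t. indicator A t * prim f t"
  have int: "integrable lebesgue (?i A)" if "A \<in> sets borel" "emeasure lborel A < \<infinity>" for A
  proof (rule Bochner_Integration.integrable_bound[where f = "\<lambda>t. indicator A t * ?I"])
    show "integrable lebesgue (\<lambda>t. indicator A t * ?I)"
      using that by (auto simp: integrable_mult_left)
    have "?i A \<in> borel_measurable borel" using prim_borel[OF f] that by measurable
    then show "?i A \<in> borel_measurable lebesgue" by (intro measurable_completion) simp
    show "AE t in lebesgue. norm (?i A t) \<le> norm (indicator A t * ?I)"
    proof (intro AE_I2)
      show "norm (?i A t) \<le> norm (indicator A t * ?I)" for t
        using prim_bounds[OF f nn, of t] by (auto split: split_indicator)
    qed
  qed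
  have "(LINT t|time T. prim f t - prim f (t - \<tau>))
      = (LINT t|time T. prim f (t - 0)) - (LINT t|time T. prim f (t - \<tau>))"
    using prim_shift_integrable[OF f, of T 0] prim_shift_integrable[OF f, of T \<tau>] by simp
  also have "\<dots> = (LINT t|lebesgue. ?i {0<..<T} t) - (LINT t|lebesgue. ?i {-\<tau><..<T-\<tau>} t)"
    unfolding integral_time_shift by simp
  also have "\<dots> = (LINT t|lebesgue. ?i {0<..<T} t - ?i {-\<tau><..<T-\<tau>} t)"
    by (subst Bochner_Integration.integral_diff) (use \<tau> in \<open>auto intro!: int\<close>)
  \<comment> \<open>A point of \<open>(0,T)\<close> outside the shifted interval lies in
    \<open>[T-\<tau>,T]\<close>, and there \<open>prim f\<close> is at most the total mass. A point
    of the shifted interval outside \<open>(0,T)\<close> counts negatively and is dropped since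
    \<open>prim f \<ge> 0\<close>.\<close>
  also have "\<dots> \<le> (LINT t|lebesgue. indicator {T-\<tau>..T} t * ?I)"
  proof (intro integral_mono)
    show "?i {0<..<T} t - ?i {-\<tau><..<T-\<tau>} t \<le> indicator {T-\<tau>..T} t * ?I" for t
      using prim_bounds[OF f nn, of t] \<tau> by (auto split: split_indicator)
  qed (use \<tau> in \<open>auto intro!: Bochner_Integration.integrable_diff int integrable_mult_left\<close>)
  also have "\<dots> = \<tau> * ?I" using \<tau> by simp
  finally show ?thesis .
qed

section \<open>Approximation by continuous functions and convergence of averages in the mean\<close>

lemma integrable_continuous_indicator:
  fixes g :: "real \<Rightarrow> real"
  assumes "continuous_on UNIV g"
  shows "integrable lebesgue (\<lambda>t. indicator {a..b} t * g t)"
proof -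
  have "integrable lborel (\<lambda>t. indicator {a..b} t * g t)"
    using borel_integrable_atLeastAtMost'[of a b g] continuous_on_subset[OF assms]
    by (simp add: set_integrable_def)
  then show ?thesis
    using borel_measurable_integrable integrable_completion by blast
qed

text \<open>The predicate \<open>measurable_on\<close> supplies continuous functions converging to
  \<open>f\<close> off a negligible set. Clipping them to \<open>[-B,B]\<close> keeps continuity,
  does not disturb the limit because \<open>\<bar>f\<bar> \<le> B\<close>, and gives a dominating
  function on the set \<open>S\<close> of finite measure.\<close>

lemma integral_approx_bounded:
  fixes f :: "real \<Rightarrow> real"
  assumes f: "f \<in> borel_measurable lebesgue" "\<And>t. \<bar>f t\<bar> \<le> B"
    and S: "S \<in> lmeasurable" and "e > 0"
  shows "\<exists>g. continuous_on UNIV g \<and> (LINT t|lebesgue. indicator S t * \<bar>f t - g t\<bar>) < e"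
proof -
  have "f measurable_on UNIV"
    using f by (simp add: lebesgue_measurable_imp_measurable_on)
  then obtain N g where N: "negligible N" and g: "\<And>n. continuous_on UNIV (g n)"
    and lim: "\<And>t. t \<notin> N \<Longrightarrow> (\<lambda>n::nat. g n t) \<longlonglongrightarrow> f t"
    unfolding measurable_on_def by auto
  have "B \<ge> 0" using f(2)[of 0] by linarith
  define g' where "g' n t = max (-B) (min B (g n t))" for n t
  have cont: "continuous_on UNIV (g' n)" for n
    unfolding g'_def by (intro continuous_intros g)
  have g'B: "\<bar>g' n t\<bar> \<le> B" for n t using \<open>B \<ge> 0\<close> by (auto simp: g'_def)
  have [measurable]: "g' n \<in> borel_measurable lebesgue" for n
    by (intro measurable_completion) (use cont in \<open>simp add: borel_measurable_continuous_onI\<close>)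
  note [measurable] = f(1)
  have [measurable]: "S \<in> sets lebesgue" using S by (rule fmeasurableD)
  have "(\<lambda>n. LINT t|lebesgue. indicator S t * \<bar>f t - g' n t\<bar>) \<longlonglongrightarrow> (LINT (t::real)|lebesgue. (0::real))"
  proof (rule Bochner_Integration.integral_dominated_convergence[where w = "\<lambda>t. indicator S t * (2 * B)"])
    show "integrable lebesgue (\<lambda>t. indicator S t * (2 * B))"
      using S by (intro integrable_mult_left) (auto simp: fmeasurable_def)
    show "AE t in lebesgue. (\<lambda>n. indicator S t * \<bar>f t - g' n t\<bar>) \<longlonglongrightarrow> 0"
    proof (rule AE_I'[of N])
      show "N \<in> null_sets lebesgue" using N by (simp add: negligible_iff_null_sets)
      have lim': "(\<lambda>n. g' n t) \<longlonglongrightarrow> max (-B) (min B (f t))" if "t \<notin> N" for t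
        unfolding g'_def by (intro tendsto_max tendsto_min tendsto_const lim[OF that])
      moreover have "max (-B) (min B (f t)) = f t" for t
        using f(2)[of t] by linarith
      ultimately have lim2: "(\<lambda>n. g' n t) \<longlonglongrightarrow> f t" if "t \<notin> N" for t
        using lim'[OF that] by simp
      have lim3: "(\<lambda>n. indicator S t * \<bar>f t - g' n t\<bar>) \<longlonglongrightarrow> indicator S t * \<bar>f t - f t\<bar>" if "t \<notin> N" for t
        by (intro tendsto_mult tendsto_const tendsto_rabs tendsto_diff lim2[OF that])
      show "{t \<in> space lebesgue. \<not> (\<lambda>n. indicator S t * \<bar>f t - g' n t\<bar>) \<longlonglongrightarrow> 0} \<subseteq> N"
        using lim3 by auto
    qed
    show "AE t in lebesgue. norm (indicator S t * \<bar>f t - g' n t\<bar>) \<le> indicator S t * (2 * B)" for n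
    proof (rule AE_I2)
      show "norm (indicator S t * \<bar>f t - g' n t\<bar>) \<le> indicator S t * (2 * B)" for t
        using f(2)[of t] g'B[of n t] by (auto split: split_indicator)
    qed
  qed auto
  then have "\<forall>\<^sub>F n in sequentially. (LINT t|lebesgue. indicator S t * \<bar>f t - g' n t\<bar>) < e"
    using \<open>e > 0\<close> by (intro order_tendstoD(2)) auto
  then obtain n where "(LINT t|lebesgue. indicator S t * \<bar>f t - g' n t\<bar>) < e"
    by (auto simp: eventually_sequentially)
  with cont show ?thesis by blast
qed

text \<open>Truncation at height \<open>n\<close> converges in the mean and leaves the bounded case.
  The error is measured on a compact interval only, because the continuous approximant is defined on
  the whole line without any decay.\<close>

lemma integral_approx_continuous:
  fixes f :: "real \<Rightarrow> real"
  assumes f: "integrable lebesgue f" and "e > 0"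
  shows "\<exists>g. continuous_on UNIV g \<and> (LINT t|lebesgue. indicator {a..b} t * \<bar>f t - g t\<bar>) < e"
proof -
  note [measurable] = borel_measurable_integrable[OF f]
  define tr where "tr n t = max (- real n) (min (real n) (f t))" for n t
  have [measurable]: "tr n \<in> borel_measurable lebesgue" for n
    unfolding tr_def by measurable
  have tr_le: "\<bar>tr n t\<bar> \<le> \<bar>f t\<bar>" "\<bar>tr n t\<bar> \<le> real n" for n t by (auto simp: tr_def)
  have tr_int: "integrable lebesgue (tr n)" for n
    using tr_le(1) by (intro Bochner_Integration.integrable_bound[OF f]) auto
  have "(\<lambda>n. LINT t|lebesgue. \<bar>f t - tr n t\<bar>) \<longlonglongrightarrow> (LINT (t::real)|lebesgue. (0::real))"
  proof (rule Bochner_Integration.integral_dominated_convergence[where w = "\<lambda>t. 2 * \<bar>f t\<bar>"])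
    show "AE t in lebesgue. (\<lambda>n. \<bar>f t - tr n t\<bar>) \<longlonglongrightarrow> 0"
    proof (rule AE_I2)
      fix t
      obtain m :: nat where "\<bar>f t\<bar> \<le> m" using real_arch_simple by blast
      then have "\<forall>\<^sub>F n in sequentially. \<bar>f t - tr n t\<bar> = 0"
        unfolding eventually_sequentially by (intro exI[of _ m]) (auto simp: tr_def)
      then show "(\<lambda>n. \<bar>f t - tr n t\<bar>) \<longlonglongrightarrow> 0"
        by (rule tendsto_eventually)
    qed
    show "AE t in lebesgue. norm \<bar>f t - tr n t\<bar> \<le> 2 * \<bar>f t\<bar>" for n
      using tr_le(1)[of n] by (intro AE_I2) (smt (verit) real_norm_def)
  qed (use f in auto)
  then have "\<forall>\<^sub>F n in sequentially. (LINT t|lebesgue. \<bar>f t - tr n t\<bar>) < e / 2"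
    using \<open>e > 0\<close> by (intro order_tendstoD(2)) auto
  then obtain n where n: "(LINT t|lebesgue. \<bar>f t - tr n t\<bar>) < e / 2"
    by (auto simp: eventually_sequentially)
  obtain g where g: "continuous_on UNIV g"
    "(LINT t|lebesgue. indicator {a..b} t * \<bar>tr n t - g t\<bar>) < e / 2"
    using integral_approx_bounded[of "tr n" "real n" "{a..b}" "e / 2"] tr_le(2)[of n] \<open>e > 0\<close>
    by auto
  have gi: "integrable lebesgue (\<lambda>t. indicator {a..b} t * g t)"
    by (rule integrable_continuous_indicator[OF g(1)])
  have ti: "integrable lebesgue (\<lambda>t. indicator {a..b} t * \<bar>tr n t - g t\<bar>)"
  proof -
    have "integrable lebesgue (\<lambda>t. \<bar>indicator {a..b} t * tr n t - indicator {a..b} t * g t\<bar>)"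
      by (intro integrable_abs Bochner_Integration.integrable_diff gi integrable_indicator_times tr_int) auto
    then show ?thesis
      by (rule Bochner_Integration.integrable_cong[THEN iffD1, rotated -1]) (auto split: split_indicator)
  qed
  have "(LINT t|lebesgue. indicator {a..b} t * \<bar>f t - g t\<bar>)
     \<le> (LINT t|lebesgue. \<bar>f t - tr n t\<bar> + indicator {a..b} t * \<bar>tr n t - g t\<bar>)"
    using f tr_int ti
    by (intro integral_mono_AE' AE_I2) (auto split: split_indicator)
  also have "\<dots> < e"
    using n g(2) f tr_int ti by (subst Bochner_Integration.integral_add) auto
  finally show ?thesis using g(1) by blast
qed

lemma time_restrict_indicator:
  fixes f :: "real \<Rightarrow> real"
  shows "(LINT t|time T. f t) = (LINT t|lebesgue. indicator {0<..<T} t * f t)"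
  by (subst integral_restrict_space) auto

lemma integrable_time_lebesgue:
  fixes f :: "real \<Rightarrow> real"
  assumes "integrable lebesgue f"
  shows "integrable (time T) f"
  using integrable_indicator_times[OF assms, of "{0<..<T}"]
  by (subst integrable_restrict_space) auto

lemma integral_time_le:
  fixes f :: "real \<Rightarrow> real"
  assumes "integrable lebesgue f" "\<And>t. 0 \<le> f t"
  shows "integral\<^sup>L (time T) f \<le> integral\<^sup>L lebesgue f"
  unfolding time_restrict_indicator
  by (intro integral_mono integrable_indicator_times) (use assms in \<open>auto split: split_indicator\<close>)

text \<open>A density argument: split \<open>f\<close> into a continuous part \<open>G\<close> and a
  part \<open>D\<close> that is small in the mean. Averages of \<open>G\<close> converge uniformly,
  and averaging does not enlarge the integral of \<open>\<bar>D\<bar>\<close> by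
  \<open>prim_shift_bound\<close>.\<close>

lemma steklov_L1:
  assumes f: "integrable lebesgue f" and T: "0 < T"
  shows "((\<lambda>\<tau>. LINT t|time T. \<bar>(prim f t - prim f (t - \<tau>)) / \<tau> - f t\<bar>) \<longlongrightarrow> 0) (at_right 0)"
proof (rule tendstoI)
  fix e :: real assume "e > 0"
  \<comment> \<open>The total error is \<open>e'\<close> from the averages of \<open>D\<close>,
    \<open>T * e'\<close> from the uniform error on an interval of length \<open>T\<close>, and
    \<open>e'\<close> from \<open>D\<close> itself; \<open>T + 3\<close> in place of
    \<open>T + 2\<close> makes the inequality strict.\<close>
  define e' where "e' = e / (T + 3)"
  have "e' > 0" using \<open>e > 0\<close> T by (simp add: e'_def)
  obtain g where g: "continuous_on UNIV g"
    and ge: "(LINT t|lebesgue. indicator {-1..T} t * \<bar>f t - g t\<bar>) < e'"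
    using integral_approx_continuous[OF f \<open>e' > 0\<close>] by blast
  \<comment> \<open>The window \<open>(t-\<tau>,t]\<close> of a time \<open>t\<close> in
    \<open>(0,T)\<close> may reach to the left of 0, but not beyond -1 as long as
    \<open>\<tau> < 1\<close>.\<close>
  let ?S = "{-1..T}"
  define G where "G t = indicator ?S t * g t" for t
  define D where "D t = indicator ?S t * (f t - g t)" for t
  have Gi: "integrable lebesgue G"
    unfolding G_def by (rule integrable_continuous_indicator[OF g])
  have "integrable lebesgue (\<lambda>t. indicator ?S t * f t - G t)"
    by (intro Bochner_Integration.integrable_diff Gi integrable_indicator_times f) auto
  then have Di: "integrable lebesgue D"
    by (simp add: D_def[abs_def] G_def right_diff_distrib)
  have De: "(LINT t|lebesgue. \<bar>D t\<bar>) < e'"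
    using ge by (simp add: D_def abs_mult)
  have "uniformly_continuous_on ?S g"
    using continuous_on_subset[OF g(1)] by (intro compact_uniformly_continuous) auto
  then obtain d where "d > 0" and d: "\<And>x y. x \<in> ?S \<Longrightarrow> y \<in> ?S \<Longrightarrow> dist y x < d \<Longrightarrow> dist (g y) (g x) < e'"
    unfolding uniformly_continuous_on_def using \<open>e' > 0\<close> by metis
  have "(LINT t|time T. \<bar>(prim f t - prim f (t - \<tau>)) / \<tau> - f t\<bar>) < e"
    if \<tau>: "0 < \<tau>" "\<tau> < min 1 d" for \<tau>
  proof -
    let ?av = "\<lambda>f t. (prim f t - prim f (t - \<tau>)) / \<tau>"
    have avi: "integrable (time T) (?av h)" if "integrable lebesgue h" for h
      using prim_shift_integrable[OF that, of T 0] prim_shift_integrable[OF that, of T \<tau>] by auto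
    have pt: "\<bar>?av f t - f t\<bar> \<le> ?av (\<lambda>s. \<bar>D s\<bar>) t + e' + \<bar>D t\<bar>" if t: "t \<in> {0<..<T}" for t
    proof -
      have le: "t - \<tau> \<le> t" using \<tau> by simp
      \<comment> \<open>\<open>f\<close> and \<open>D + G\<close> agree only on
        \<open>[-1,T]\<close>, so their primitives may differ; the increments over the window do
        not.\<close>
      have "prim f t - prim f (t - \<tau>) = prim (\<lambda>s. D s + G s) t - prim (\<lambda>s. D s + G s) (t - \<tau>)"
        unfolding prim_diff[OF f le] prim_diff[OF Bochner_Integration.integrable_add[OF Di Gi] le]
        using \<tau> t by (intro Bochner_Integration.integral_cong) (auto simp: D_def G_def split: split_indicator)
      then have 1: "?av f t = ?av D t + ?av G t"
        by (simp add: prim_add[OF Di Gi] diff_divide_distrib add_divide_distrib)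
      have 2: "\<bar>?av D t\<bar> \<le> ?av (\<lambda>s. \<bar>D s\<bar>) t"
        using prim_diff_abs[OF Di integrable_abs[OF Di], of "t - \<tau>" t] \<tau> by (simp add: divide_right_mono)
      let ?i = "\<lambda>s. indicator {t-\<tau><..t} s :: real"
      have c: "(LINT s|lebesgue. ?i s * k) = \<tau> * k" for k
        using \<tau> by simp
      have ci: "integrable lebesgue (\<lambda>s. ?i s * k)" for k
        by (intro integrable_mult_left) (use \<tau> in auto)
      have Gt: "prim G t - prim G (t - \<tau>) = (LINT s|lebesgue. ?i s * G s)"
        using \<tau> by (intro prim_diff Gi) auto
      have *: "g t - e' \<le> G s" "G s \<le> g t + e'" if "s \<in> {t-\<tau><..t}" for s
        using d[of t s] that t \<tau> by (auto simp: G_def dist_real_def)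
      have "\<tau> * (g t - e') \<le> prim G t - prim G (t - \<tau>)"
        unfolding Gt c[symmetric] using *
        by (intro integral_mono ci integrable_indicator_times Gi) (auto split: split_indicator)
      moreover have "prim G t - prim G (t - \<tau>) \<le> \<tau> * (g t + e')"
        unfolding Gt c[symmetric] using *
        by (intro integral_mono ci integrable_indicator_times Gi) (auto split: split_indicator)
      ultimately have "\<bar>?av G t - g t\<bar> \<le> e'"
        using \<tau> by (auto simp: abs_le_iff field_simps)
      moreover have "f t = D t + g t" using t by (simp add: D_def)
      ultimately show ?thesis using 1 2 by linarith
    qed
    have "(LINT t|time T. \<bar>?av f t - f t\<bar>) \<le> (LINT t|time T. ?av (\<lambda>s. \<bar>D s\<bar>) t + e' + \<bar>D t\<bar>)"
      using pt by (intro integral_mono integrable_abs Bochner_Integration.integrable_add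
          Bochner_Integration.integrable_diff avi integrable_time_lebesgue f Di
          finite_measure.integrable_const[OF finite_measure_time]) auto
    also have "\<dots> = (LINT t|time T. prim (\<lambda>s. \<bar>D s\<bar>) t - prim (\<lambda>s. \<bar>D s\<bar>) (t - \<tau>)) / \<tau> + T * e'
        + (LINT t|time T. \<bar>D t\<bar>)"
      using avi[of "\<lambda>s. \<bar>D s\<bar>"] Di integrable_time_lebesgue[OF integrable_abs[OF Di], of T] T
        finite_measure.integrable_const[OF finite_measure_time, of T e']
      by (simp add: measure_restrict_space)
    also have "\<dots> \<le> e' + T * e' + e'"
    proof (intro add_mono order_refl)
      have "(LINT t|time T. prim (\<lambda>s. \<bar>D s\<bar>) t - prim (\<lambda>s. \<bar>D s\<bar>) (t - \<tau>)) \<le> \<tau> * (LINT t|lebesgue. \<bar>D t\<bar>)"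
        using prim_shift_bound[OF integrable_abs[OF Di], of \<tau> T] \<tau> T by simp
      also have "\<dots> \<le> \<tau> * e'" using De \<tau> by simp
      finally show "(LINT t|time T. prim (\<lambda>s. \<bar>D s\<bar>) t - prim (\<lambda>s. \<bar>D s\<bar>) (t - \<tau>)) / \<tau> \<le> e'"
        using \<tau> by (simp add: field_simps)
      show "(LINT t|time T. \<bar>D t\<bar>) \<le> e'"
        using integral_time_le[OF integrable_abs[OF Di], of T] De by simp
    qed
    also have "\<dots> < (T + 3) * e'" using \<open>e' > 0\<close> by (simp add: algebra_simps)
    also have "\<dots> = e" using T by (simp add: e'_def)
    finally show ?thesis .
  qed
  then show "\<forall>\<^sub>F \<tau> in at_right 0. dist (LINT t|time T. \<bar>(prim f t - prim f (t - \<tau>)) / \<tau> - f t\<bar>) 0 < e"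
    unfolding eventually_at_right_field using \<open>d > 0\<close>
    by (intro exI[of _ "min 1 d"]) (auto simp: dist_real_def Bochner_Integration.integral_nonneg)
qed

subsection \<open>Bochner spaces over carrier sets\<close>

lemma normed_onD:
  assumes "normed_on X n"
  shows normed_on_0: "0 \<in> X"
    and normed_on_diff: "x \<in> X \<Longrightarrow> y \<in> X \<Longrightarrow> x - y \<in> X"
    and normed_on_scale: "x \<in> X \<Longrightarrow> a *\<^sub>R x \<in> X"
    and normed_on_nonneg: "x \<in> X \<Longrightarrow> 0 \<le> n x"
    and normed_on_eq_0: "x \<in> X \<Longrightarrow> n x = 0 \<longleftrightarrow> x = 0"
    and normed_on_abs: "x \<in> X \<Longrightarrow> n (a *\<^sub>R x) = \<bar>a\<bar> * n x"
    and normed_on_triangle: "x \<in> X \<Longrightarrow> y \<in> X \<Longrightarrow> n (x + y) \<le> n x + n y"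
  using assms by (auto simp: normed_on_def subspace_0 subspace_add subspace_diff subspace_scale)

lemma normed_on_minus_commute:
  assumes "normed_on X n" "x \<in> X" "y \<in> X"
  shows "n (x - y) = n (y - x)"
  using normed_on_abs[OF assms(1) normed_on_diff[OF assms], of "-1"] by simp

lemma normed_on_diff_triangle:
  assumes "normed_on X n" "x \<in> X" "y \<in> X"
  shows "n (x - y) \<le> n x + n y"
  using normed_on_triangle[OF assms(1,2) normed_on_scale[OF assms(1,3), of "-1"]]
    normed_on_abs[OF assms(1,3), of "-1"] by simp

lemma normed_on_abs_diff:
  assumes "normed_on X n" "x \<in> X" "y \<in> X"
  shows "\<bar>n x - n y\<bar> \<le> n (x - y)"
  using normed_on_triangle[OF assms(1) normed_on_diff[OF assms] assms(3)]
    normed_on_triangle[OF assms(1) normed_on_diff[OF assms(1,3,2)] assms(2)]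
    normed_on_minus_commute[OF assms] by simp

lemma normed_on_norm: "subspace X \<Longrightarrow> normed_on X norm"
  by (auto simp: normed_on_def norm_triangle_ineq)

text \<open>Lebesgue measure is complete, so measurability passes to any function equal almost
  everywhere. This lets the representatives of a class be exchanged freely.\<close>

lemma borel_measurable_time_AE_cong:
  fixes f g :: "real \<Rightarrow> real"
  assumes f: "f \<in> borel_measurable (time T)" and ae: "AE t in time T. f t = g t"
  shows "g \<in> borel_measurable (time T)"
proof -
  have "(\<lambda>t. if t \<in> {0<..<T} then f t else 0) \<in> borel_measurable lebesgue"
    using f by (subst borel_measurable_if) auto
  moreover have "AE t in lebesgue. (if t \<in> {0<..<T} then f t else 0) = (if t \<in> {0<..<T} then g t else 0)"
    using ae by (subst (asm) AE_restrict_space_iff) auto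
  ultimately have "(\<lambda>t. if t \<in> {0<..<T} then g t else 0) \<in> borel_measurable lebesgue"
    by (rule borel_measurable_AE)
  then show ?thesis by (subst (asm) borel_measurable_if) auto
qed

lemma borel_measurable_time_AE_lim:
  fixes f :: "nat \<Rightarrow> real \<Rightarrow> real"
  assumes f: "\<And>i. f i \<in> borel_measurable (time T)"
    and lim: "AE t in time T. (\<lambda>i. f i t) \<longlonglongrightarrow> g t"
  shows "g \<in> borel_measurable (time T)"
proof (rule borel_measurable_time_AE_cong)
  show "(\<lambda>t. lim (\<lambda>i. f i t)) \<in> borel_measurable (time T)"
    using f by (rule borel_measurable_lim_metric)
  show "AE t in time T. lim (\<lambda>i. f i t) = g t"
    using lim by eventually_elim (rule limI)
qed

section \<open>Measurability of evaluations along strongly measurable functions\<close>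

lemma simple_function_eval_measurable:
  fixes h :: "'b \<Rightarrow> 'a \<Rightarrow> real"
  assumes s: "simple_function M s" and V: "\<And>t. s t \<in> V"
    and h: "\<And>v. v \<in> V \<Longrightarrow> (\<lambda>t. h t v) \<in> borel_measurable M"
  shows "(\<lambda>t. h t (s t)) \<in> borel_measurable M"
proof -
  have fin: "finite (s ` space M)" using s by (auto simp: simple_function_def)
  have [measurable]: "s -` {v} \<inter> space M \<in> sets M" for v
    using s by (rule simple_functionD)
  have "(\<lambda>t. \<Sum>v\<in>s ` space M. indicator (s -` {v} \<inter> space M) t * h t v) \<in> borel_measurable M"
    using V by (intro borel_measurable_sum borel_measurable_times h) auto
  also have "?this \<longleftrightarrow> ?thesis"
  proof (rule measurable_cong)
    fix t assume t: "t \<in> space M"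
    have "(\<Sum>v\<in>s ` space M. indicator (s -` {v} \<inter> space M) t * h t v)
        = (\<Sum>v\<in>s ` space M. if v = s t then h t v else 0)"
      using t by (intro sum.cong) (auto split: split_indicator)
    then show "(\<Sum>v\<in>s ` space M. indicator (s -` {v} \<inter> space M) t * h t v) = h t (s t)"
      using fin t by simp
  qed
  finally show ?thesis .
qed

text \<open>A Caratheodory-type argument: along simple functions the evaluation is measurable, and
  for almost every \<open>t\<close> Lipschitz continuity in the vector carries this to the limit.
  The constant may depend on \<open>t\<close>, since only pointwise limits are taken. The same
  statement covers norms, densities and their primitives.\<close>

lemma strongly_measurable_eval:
  fixes h :: "real \<Rightarrow> 'a::real_vector \<Rightarrow> real"
  assumes w: "strongly_measurable T V n w"
    and h: "\<And>v. v \<in> V \<Longrightarrow> (\<lambda>t. h t v) \<in> borel_measurable (time T)"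
    and lip: "AE t in time T. \<exists>K. \<forall>x\<in>V. \<forall>y\<in>V. \<bar>h t x - h t y\<bar> \<le> K * n (x - y)"
  shows "(\<lambda>t. h t (w t)) \<in> borel_measurable (time T)"
proof -
  from w obtain s where wV: "AE t in time T. w t \<in> V"
    and s: "\<And>i. simple_function (time T) (s i)" "\<And>i t. s i t \<in> V"
    and lim: "AE t in time T. (\<lambda>i. n (s i t - w t)) \<longlonglongrightarrow> 0"
    unfolding strongly_measurable_def by auto
  show ?thesis
  proof (rule borel_measurable_time_AE_lim)
    show "(\<lambda>t. h t (s i t)) \<in> borel_measurable (time T)" for i
      by (rule simple_function_eval_measurable[OF s(1) s(2) h])
    show "AE t in time T. (\<lambda>i. h t (s i t)) \<longlonglongrightarrow> h t (w t)"
      using wV lim lip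
    proof eventually_elim
      case (elim t)
      then obtain K where K: "\<forall>x\<in>V. \<forall>y\<in>V. \<bar>h t x - h t y\<bar> \<le> K * n (x - y)" by blast
      have "(\<lambda>i. K * n (s i t - w t)) \<longlonglongrightarrow> 0"
        using tendsto_mult_left[OF elim(2), of K] by simp
      then have "(\<lambda>i. h t (s i t) - h t (w t)) \<longlonglongrightarrow> 0"
        by (rule Lim_null_comparison[rotated]) (use K s(2) elim(1) in auto)
      then show ?case by (simp add: LIM_zero_iff)
    qed
  qed
qed

lemma strongly_measurable_norm:
  assumes "normed_on V n" "strongly_measurable T V n w"
  shows "(\<lambda>t. n (w t)) \<in> borel_measurable (time T)"
  using assms(2)
  by (rule strongly_measurable_eval[where h = "\<lambda>t. n"])
     (use normed_on_abs_diff[OF assms(1)] in \<open>auto intro!: AE_I2 exI[of _ 1]\<close>)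

lemma strongly_measurable_diff:
  assumes V: "normed_on V n" and u: "strongly_measurable T V n u" and w: "strongly_measurable T V n w"
  shows "strongly_measurable T V n (\<lambda>t. u t - w t)"
proof -
  from u obtain s where uV: "AE t in time T. u t \<in> V"
    and s: "\<And>i. simple_function (time T) (s i)" "\<And>i t. s i t \<in> V"
    and lims: "AE t in time T. (\<lambda>i. n (s i t - u t)) \<longlonglongrightarrow> 0"
    unfolding strongly_measurable_def by auto
  from w obtain r where wV: "AE t in time T. w t \<in> V"
    and r: "\<And>i. simple_function (time T) (r i)" "\<And>i t. r i t \<in> V"
    and limr: "AE t in time T. (\<lambda>i. n (r i t - w t)) \<longlonglongrightarrow> 0"
    unfolding strongly_measurable_def by auto
  have "AE t in time T. (\<lambda>i. n (s i t - r i t - (u t - w t))) \<longlonglongrightarrow> 0"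
    using uV wV lims limr
  proof eventually_elim
    case (elim t)
    have "(\<lambda>i. n (s i t - u t) + n (r i t - w t)) \<longlonglongrightarrow> 0 + 0"
      using elim by (intro tendsto_add) auto
    moreover have "norm (n (s i t - r i t - (u t - w t))) \<le> n (s i t - u t) + n (r i t - w t)" for i
    proof -
      have *: "s i t - u t \<in> V" "r i t - w t \<in> V"
        using elim s(2) r(2) by (auto intro: normed_on_diff[OF V])
      have eq: "s i t - r i t - (u t - w t) = (s i t - u t) - (r i t - w t)" by simp
      have "n (s i t - r i t - (u t - w t)) \<le> n (s i t - u t) + n (r i t - w t)"
        by (subst eq) (rule normed_on_diff_triangle[OF V *])
      moreover have "0 \<le> n (s i t - r i t - (u t - w t))"
        by (subst eq) (rule normed_on_nonneg[OF V normed_on_diff[OF V *]])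
      ultimately show ?thesis by simp
    qed
    ultimately show ?case by - (rule Lim_null_comparison[OF always_eventually], simp_all)
  qed
  moreover have "AE t in time T. u t - w t \<in> V"
    using uV wV by eventually_elim (rule normed_on_diff[OF V])
  moreover have "simple_function (time T) (\<lambda>t. s i t - r i t)" "s i t - r i t \<in> V" for i t
    using simple_function_compose2[where h = "(-)", OF s(1) r(1)] normed_on_diff[OF V s(2) r(2)]
    by auto
  ultimately show ?thesis
    unfolding strongly_measurable_def by (intro conjI exI[of _ "\<lambda>i t. s i t - r i t"] allI)
qed

section \<open>Differences, linear images and simple approximation in \<open>Lspace\<close>\<close>

lemma powr_add_le:
  fixes a b r :: real
  assumes "a \<ge> 0" "b \<ge> 0" "r \<ge> 0"
  shows "(a + b) powr r \<le> 2 powr r * (a powr r + b powr r)"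
proof -
  have "(a + b) powr r \<le> (2 * max a b) powr r"
    using assms by (intro powr_mono2) auto
  also have "\<dots> = 2 powr r * (max a b) powr r" using assms by (simp add: powr_mult)
  also have "\<dots> \<le> 2 powr r * (a powr r + b powr r)"
    by (intro mult_left_mono) (auto simp: max_def)
  finally show ?thesis .
qed

lemma Lspace_diff:
  assumes V: "normed_on V n" and r: "r \<ge> 0" and u: "u \<in> Lspace r T V n" and w: "w \<in> Lspace r T V n"
  shows "(\<lambda>t. u t - w t) \<in> Lspace r T V n"
proof -
  have s: "strongly_measurable T V n (\<lambda>t. u t - w t)"
    using u w by (auto simp: Lspace_def intro: strongly_measurable_diff[OF V])
  have [measurable]: "(\<lambda>t. n (u t - w t)) \<in> borel_measurable (time T)"
    by (rule strongly_measurable_norm[OF V s])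
  have uV: "AE t in time T. u t \<in> V" and wV: "AE t in time T. w t \<in> V"
    using u w by (auto simp: Lspace_def strongly_measurable_def)
  have "integrable (time T) (\<lambda>t. n (u t - w t) powr r)"
  proof (rule Bochner_Integration.integrable_bound)
    show "integrable (time T) (\<lambda>t. 2 powr r * (n (u t) powr r + n (w t) powr r))"
      using u w by (auto simp: Lspace_def)
    show "AE t in time T. norm (n (u t - w t) powr r) \<le> norm (2 powr r * (n (u t) powr r + n (w t) powr r))"
      using uV wV
    proof eventually_elim
      case (elim t)
      have "n (u t - w t) powr r \<le> (n (u t) + n (w t)) powr r"
        using normed_on_diff_triangle[OF V elim] normed_on_nonneg[OF V normed_on_diff[OF V elim]] r
        by (intro powr_mono2) auto
      also have "\<dots> \<le> 2 powr r * (n (u t) powr r + n (w t) powr r)"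
        using normed_on_nonneg[OF V] elim r by (intro powr_add_le) auto
      finally show ?case by simp
    qed
  qed measurable
  with s show ?thesis by (simp add: Lspace_def)
qed

lemma Lspace_AE_cong:
  assumes u: "u \<in> Lspace r T V n" and ae: "AE t in time T. u t = w t"
    and m: "(\<lambda>t. n (u t)) \<in> borel_measurable (time T)"
  shows "w \<in> Lspace r T V n"
proof -
  have sm: "strongly_measurable T V n u" and i: "integrable (time T) (\<lambda>t. n (u t) powr r)"
    using u by (auto simp: Lspace_def)
  have "strongly_measurable T V n w"
  proof -
    from sm obtain s where uV: "AE t in time T. u t \<in> V"
      and s: "\<And>i. simple_function (time T) (s i)" "\<And>i t. s i t \<in> V"
      and lim: "AE t in time T. (\<lambda>i. n (s i t - u t)) \<longlonglongrightarrow> 0"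
      unfolding strongly_measurable_def by auto
    have "AE t in time T. w t \<in> V" using uV ae by eventually_elim simp
    moreover have "AE t in time T. (\<lambda>i. n (s i t - w t)) \<longlonglongrightarrow> 0"
      using lim ae by eventually_elim simp
    ultimately show ?thesis unfolding strongly_measurable_def using s by auto
  qed
  moreover have ae': "AE t in time T. n (u t) powr r = n (w t) powr r"
    using ae by eventually_elim simp
  then have "integrable (time T) (\<lambda>t. n (w t) powr r)"
    using integrable_cong_AE_imp[OF i borel_measurable_time_AE_cong[OF borel_measurable_integrable[OF i]]]
    by auto
  ultimately show ?thesis by (simp add: Lspace_def)
qed

lemma Lspace_image:
  assumes L: "bounded_linear_on X n Y m L" and X: "normed_on X n" and Y: "normed_on Y m"
    and r: "r \<ge> 0" and u: "u \<in> Lspace r T X n"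
  shows "(\<lambda>t. L (u t)) \<in> Lspace r T Y m"
proof -
  from L have LY: "\<And>x. x \<in> X \<Longrightarrow> L x \<in> Y" and "\<exists>K. \<forall>x\<in>X. m (L x) \<le> K * n x"
    unfolding bounded_linear_on_def by simp_all
  then obtain K where K: "\<And>x. x \<in> X \<Longrightarrow> m (L x) \<le> K * n x" by metis
  have diff: "L (x - y) = L x - L y" if "x \<in> X" "y \<in> X" for x y
  proof -
    from L have "\<forall>x\<in>X. \<forall>y\<in>X. L (x + y) = L x + L y" unfolding bounded_linear_on_def by simp
    then have "L (x - y + y) = L (x - y) + L y"
      using normed_on_diff[OF X that] that(2) by blast
    then show ?thesis by simp
  qed
  from u obtain s where uX: "AE t in time T. u t \<in> X"
    and s: "\<And>i. simple_function (time T) (s i)" "\<And>i t. s i t \<in> X"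
    and lim: "AE t in time T. (\<lambda>i. n (s i t - u t)) \<longlonglongrightarrow> 0"
    unfolding strongly_measurable_def Lspace_def by auto
  have "AE t in time T. (\<lambda>i. m (L (s i t) - L (u t))) \<longlonglongrightarrow> 0"
    using uX lim
  proof eventually_elim
    case (elim t)
    have "(\<lambda>i. K * n (s i t - u t)) \<longlonglongrightarrow> 0"
      using tendsto_mult_left[OF elim(2), of K] by simp
    moreover have "norm (m (L (s i t) - L (u t))) \<le> K * n (s i t - u t)" for i
      using K[OF normed_on_diff[OF X s(2) elim(1)]] diff[OF s(2) elim(1)]
        normed_on_nonneg[OF Y normed_on_diff[OF Y LY[OF s(2)] LY[OF elim(1)]]] by simp
    ultimately show ?case by - (rule Lim_null_comparison[OF always_eventually], simp_all)
  qed
  moreover have "AE t in time T. L (u t) \<in> Y"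
    using uX by eventually_elim (rule LY)
  moreover have "simple_function (time T) (\<lambda>t. L (s i t))" "L (s i t) \<in> Y" for i t
    using simple_function_compose1[where g = L, OF s(1)] LY[OF s(2)] by auto
  ultimately have sm: "strongly_measurable T Y m (\<lambda>t. L (u t))"
    unfolding strongly_measurable_def by (intro conjI exI[of _ "\<lambda>i t. L (s i t)"] allI)
  have [measurable]: "(\<lambda>t. m (L (u t))) \<in> borel_measurable (time T)"
    by (rule strongly_measurable_norm[OF Y sm])
  have "integrable (time T) (\<lambda>t. m (L (u t)) powr r)"
  proof (rule Bochner_Integration.integrable_bound)
    show "integrable (time T) (\<lambda>t. \<bar>K\<bar> powr r * n (u t) powr r)"
      using u by (auto simp: Lspace_def)
    show "AE t in time T. norm (m (L (u t)) powr r) \<le> norm (\<bar>K\<bar> powr r * n (u t) powr r)"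
      using uX
    proof eventually_elim
      case (elim t)
      have "m (L (u t)) \<le> \<bar>K\<bar> * n (u t)"
        using K[OF elim] normed_on_nonneg[OF X elim] by (smt (verit) mult_right_mono)
      then have "m (L (u t)) powr r \<le> (\<bar>K\<bar> * n (u t)) powr r"
        using normed_on_nonneg[OF Y LY[OF elim]] r by (intro powr_mono2) auto
      then show ?case
        using normed_on_nonneg[OF X elim] by (simp add: powr_mult)
    qed
  qed measurable
  with sm show ?thesis by (simp add: Lspace_def)
qed

lemma Lspace_simple_approx:
  fixes V :: "'a::real_vector set"
  assumes V: "normed_on V n" and p: "p \<ge> 1" and w: "w \<in> Lspace p T V n"
  shows "\<exists>y :: nat \<Rightarrow> real \<Rightarrow> 'a. (\<forall>i. simple_function (time T) (y i) \<and> (\<forall>t. y i t \<in> V) \<and>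
      integrable (time T) (\<lambda>t. n (w t - y i t) powr p)) \<and>
    (\<lambda>i. LINT t|time T. n (w t - y i t) powr p) \<longlonglongrightarrow> 0"
proof -
  from w obtain s where sm: "strongly_measurable T V n w" and wV: "AE t in time T. w t \<in> V"
    and s: "\<And>i. simple_function (time T) (s i)" "\<And>i t. s i t \<in> V"
    and lim: "AE t in time T. (\<lambda>i. n (s i t - w t)) \<longlonglongrightarrow> 0"
    and int: "integrable (time T) (\<lambda>t. n (w t) powr p)"
    unfolding strongly_measurable_def Lspace_def by auto
  have [measurable]: "(\<lambda>t. n (w t)) \<in> borel_measurable (time T)"
    by (rule strongly_measurable_norm[OF V sm])
  have [measurable]: "(\<lambda>t. n (s i t)) \<in> borel_measurable (time T)" for i
    by (rule borel_measurable_simple_function, rule simple_function_compose1[where g = n, OF s(1)])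
  \<comment> \<open>Strong measurability gives pointwise convergence without domination. Discarding
    values of norm above \<open>2 * n (w t)\<close> forces
    \<open>n (w t - y i t) \<le> 3 * n (w t)\<close>. Convergence survives: if
    \<open>w t \<noteq> 0\<close>, the test is passed from some index on, and if
    \<open>w t = 0\<close>, it is passed only by the value 0.\<close>
  define y where "y i t = (if n (s i t) \<le> 2 * n (w t) then s i t else 0)" for i t
  have ys: "simple_function (time T) (y i)" for i
    unfolding y_def by (intro simple_function_If s simple_function_const) measurable
  have yV: "y i t \<in> V" for i t using s(2) normed_on_0[OF V] by (simp add: y_def)
  have n0: "n 0 = 0" using normed_on_eq_0[OF V normed_on_0[OF V]] by simp
  have ysm: "strongly_measurable T V n (y i)" for i
    unfolding strongly_measurable_def using ys yV n0 by (auto intro!: exI[of _ "\<lambda>_. y i"])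
  have [measurable]: "(\<lambda>t. n (w t - y i t)) \<in> borel_measurable (time T)" for i
    by (rule strongly_measurable_norm[OF V strongly_measurable_diff[OF V sm ysm]])
  have bd: "AE t in time T. norm (n (w t - y i t) powr p) \<le> 3 powr p * n (w t) powr p" for i
    using wV
  proof eventually_elim
    case (elim t)
    have "n (y i t) \<le> 2 * n (w t)"
      using normed_on_nonneg[OF V elim] n0 by (simp add: y_def)
    then have "n (w t - y i t) \<le> 3 * n (w t)"
      using normed_on_diff_triangle[OF V elim yV, of i t] by simp
    then have "n (w t - y i t) powr p \<le> (3 * n (w t)) powr p"
      using normed_on_nonneg[OF V normed_on_diff[OF V elim yV]] p by (intro powr_mono2) auto
    then show ?case using normed_on_nonneg[OF V elim] by (simp add: powr_mult)
  qed
  have conv: "AE t in time T. (\<lambda>i. n (w t - y i t) powr p) \<longlonglongrightarrow> 0"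
    using wV lim
  proof eventually_elim
    case (elim t)
    have "(\<lambda>i. n (w t - y i t)) \<longlonglongrightarrow> 0"
    proof (cases "w t = 0")
      case True
      have "n (w t - y i t) = 0" for i
        using True n0 normed_on_nonneg[OF V s(2)[of i t]] normed_on_eq_0[OF V s(2)[of i t]]
        by (auto simp: y_def)
      then show ?thesis by simp
    next
      case False
      then have "n (w t) > 0"
        using normed_on_nonneg[OF V elim(1)] normed_on_eq_0[OF V elim(1)] by simp
      then have "\<forall>\<^sub>F i in sequentially. n (s i t - w t) < n (w t)"
        using elim(2) by (rule order_tendstoD(2)[rotated])
      then have "\<forall>\<^sub>F i in sequentially. n (s i t - w t) = n (w t - y i t)"
      proof eventually_elim
        case (elim i)
        then have "n (s i t) \<le> 2 * n (w t)"
          using normed_on_abs_diff[OF V s(2) \<open>w t \<in> V\<close>, of i t] by linarith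
        then show ?case
          using normed_on_minus_commute[OF V s(2) \<open>w t \<in> V\<close>, of i t] by (simp add: y_def)
      qed
      then show ?thesis using elim(2) by (rule Lim_transform_eventually[rotated])
    qed
    then have "(\<lambda>i. n (w t - y i t) powr p) \<longlonglongrightarrow> 0 powr p"
      using p by (intro tendsto_powr' tendsto_const)
        (auto simp: normed_on_nonneg[OF V normed_on_diff[OF V elim(1) yV]] intro!: always_eventually)
    then show ?case using p by simp
  qed
  have i3: "integrable (time T) (\<lambda>t. 3 powr p * n (w t) powr p)" using int by simp
  have "(\<lambda>i. LINT t|time T. n (w t - y i t) powr p) \<longlonglongrightarrow> (LINT t|time T. 0)"
    by (rule Bochner_Integration.integral_dominated_convergence[OF _ _ i3 conv bd]) measurable
  moreover have "integrable (time T) (\<lambda>t. n (w t - y i t) powr p)" for i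
    by (rule Bochner_Integration.integrable_bound[OF i3 _ ]) (use bd[of i] in \<open>auto elim: eventually_mono\<close>)
  ultimately show ?thesis using ys yV by (intro exI[of _ y]) simp
qed

subsection \<open>The lemma of du Bois-Reymond\<close>

text \<open>Test functions are only required to be of class C^1, so piecewise quadratic functions
  built from this one can serve as cut-offs in place of smooth bumps.\<close>

definition sqpos :: "real \<Rightarrow> real" where "sqpos x = (max 0 x)\<^sup>2"

lemma sqpos_deriv: "(sqpos has_real_derivative 2 * max 0 x) (at x)"
proof (cases x "0 :: real" rule: linorder_cases)
  case less
  have "((\<lambda>x. 0) has_real_derivative 0) (at x)" by simp
  then have "(sqpos has_real_derivative 0) (at x)"
    by (rule has_field_derivative_transform_within_open[of _ _ _ "{..<0}"]) (use less in \<open>auto simp: sqpos_def\<close>)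
  then show ?thesis using less by simp
next
  case greater
  have "((\<lambda>x. x\<^sup>2) has_real_derivative 2 * x) (at x)" by (auto intro!: derivative_eq_intros)
  then have "(sqpos has_real_derivative 2 * x) (at x)"
    by (rule has_field_derivative_transform_within_open[of _ _ _ "{0<..}"]) (use greater in \<open>auto simp: sqpos_def\<close>)
  then show ?thesis using greater by simp
next
  case equal
  have "((\<lambda>h. sqpos h / h) \<longlongrightarrow> 0) (at 0)"
  proof (rule Lim_null_comparison)
    show "\<forall>\<^sub>F h in at 0. norm (sqpos h / h) \<le> \<bar>h\<bar>"
      by (auto simp: sqpos_def max_def power2_eq_square)
    show "((\<lambda>h::real. \<bar>h\<bar>) \<longlongrightarrow> 0) (at 0)"
      by (rule tendsto_rabs_zero) (rule tendsto_ident_at)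
  qed
  then show ?thesis
    using equal by (simp add: DERIV_def sqpos_def)
qed

text \<open>Half the second difference of \<open>sqpos\<close>, hence a C^1 transition from 0 to 1
  across \<open>[0,2]\<close>. Its derivative \<open>tent\<close> is the linear B-spline, a
  probability density.\<close>

definition smoothstep :: "real \<Rightarrow> real" where
  "smoothstep x = 1 / 2 * sqpos x - sqpos (x - 1) + 1 / 2 * sqpos (x - 2)"

definition tent :: "real \<Rightarrow> real" where
  "tent x = max 0 x - 2 * max 0 (x - 1) + max 0 (x - 2)"

lemma smoothstep_deriv: "(smoothstep has_real_derivative tent x) (at x)"
proof -
  have s: "((\<lambda>x. sqpos (x - c)) has_real_derivative 2 * max 0 (x - c)) (at x)" for c
  proof -
    have "((\<lambda>x. x - c) has_real_derivative 1) (at x)" by (auto intro!: derivative_eq_intros)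
    from DERIV_chain2[OF sqpos_deriv this] show ?thesis by simp
  qed
  show ?thesis
    using DERIV_add[OF DERIV_diff[OF DERIV_cmult[OF sqpos_deriv[of x], of "1/2"] s[of 1]]
        DERIV_cmult[OF s[of 2], of "1/2"]]
    by (simp add: smoothstep_def[abs_def] tent_def)
qed

lemma tent_continuous: "continuous_on UNIV tent"
  unfolding tent_def by (intro continuous_intros)

lemma tent_nonneg: "0 \<le> tent x" and tent_outside: "x \<le> 0 \<or> 2 \<le> x \<Longrightarrow> tent x = 0"
  and tent_le: "tent x \<le> 1"
  by (auto simp: tent_def max_def)

lemma smoothstep_0: "x \<le> 0 \<Longrightarrow> smoothstep x = 0"
  by (auto simp: smoothstep_def sqpos_def)

lemma smoothstep_1: "2 \<le> x \<Longrightarrow> smoothstep x = 1"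
  by (auto simp: smoothstep_def sqpos_def power2_eq_square algebra_simps max_def)

lemma smoothstep_mono: "x \<le> y \<Longrightarrow> smoothstep x \<le> smoothstep y"
  by (rule DERIV_nonneg_imp_nondecreasing) (use smoothstep_deriv tent_nonneg in blast)+

lemma smoothstep_bounds: "0 \<le> smoothstep x" "smoothstep x \<le> 1"
  using smoothstep_mono[of "min x 0" x] smoothstep_0[of "min x 0"]
    smoothstep_mono[of x "max x 2"] smoothstep_1[of "max x 2"] by auto

lemma tent_integral: "integrable lebesgue tent" "(LINT x|lebesgue. tent x) = 1"
proof -
  have "has_bochner_integral lborel (\<lambda>x. tent x * indicator {0..2} x) (smoothstep 2 - smoothstep 0)"
    by (rule has_bochner_integral_FTC_Icc_real)
       (use smoothstep_deriv continuous_on_interior[OF tent_continuous] in auto)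
  moreover have "(\<lambda>x. tent x * indicator {0..2} x) = tent"
    using tent_outside by (intro ext) (auto split: split_indicator)
  ultimately have "has_bochner_integral lborel tent 1"
    by (simp add: smoothstep_0 smoothstep_1)
  then have "integrable lborel tent" "integral\<^sup>L lborel tent = 1"
    by (auto simp: has_bochner_integral_iff)
  then show "integrable lebesgue tent" "(LINT x|lebesgue. tent x) = 1"
    using borel_measurable_integrable by (auto simp: integrable_completion integral_completion)
qed

text \<open>Mollification from the right: the kernel lives on \<open>[a, a + 2 * e k]\<close>,
  inside \<open>(0,T)\<close>. The substitution \<open>t = a + e k * x\<close> turns it into the
  fixed weight \<open>tent\<close> against values of \<phi> that tend to its value at
  \<open>a\<close>.\<close>

lemma tent_mollifier:
  assumes phi: "continuous_on {0..T} \<phi>" and a: "0 < a" "a < T"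
    and e: "\<And>k. 0 < e k" "e \<longlonglongrightarrow> 0" "\<And>k. a + 2 * e k < T"
  shows "(\<lambda>k. LINT t|time T. tent ((t - a) / e k) / e k * \<phi> t) \<longlonglongrightarrow> \<phi> a"
    and "integrable (time T) (\<lambda>t. tent ((t - a) / e k) / e k * \<phi> t)"
proof -
  \<comment> \<open>Clipping the argument extends \<phi> to a bounded continuous function on the
    line, as the substitution and dominated convergence require.\<close>
  define f where "f t = \<phi> (max 0 (min T t))" for t
  have f: "continuous_on UNIV f"
    unfolding f_def using a
    by (intro continuous_on_compose2[OF phi] continuous_intros) auto
  have f_eq: "f t = \<phi> t" if "t \<in> {0..T}" for t using that by (auto simp: f_def)
  have "bounded (\<phi> ` {0..T})"
    using compact_continuous_image[OF phi] compact_imp_bounded by blast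
  then obtain B where B: "\<And>t. t \<in> {0..T} \<Longrightarrow> \<bar>\<phi> t\<bar> \<le> B"
    unfolding bounded_iff by (metis imageI real_norm_def)
  have fB: "\<bar>f t\<bar> \<le> B" for t unfolding f_def using a by (intro B) auto
  have tf: "continuous_on UNIV (\<lambda>x. tent x * f (a + e k * x))" for k
    by (intro continuous_on_mult tent_continuous continuous_on_compose2[OF f] continuous_intros) auto
  have meas: "(\<lambda>x. tent x * f (a + e k * x)) \<in> borel_measurable lebesgue" for k
    by (intro measurable_completion) (simp add: borel_measurable_continuous_onI tf)
  have eq: "(LINT t|time T. tent ((t - a) / e k) / e k * \<phi> t) = (LINT x|lebesgue. tent x * f (a + e k * x))" for k
  proof -
    have "(LINT t|time T. tent ((t - a) / e k) / e k * \<phi> t)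
        = (LINT t|lebesgue. tent ((t - a) / e k) / e k * f t)"
      unfolding time_restrict_indicator
    proof (intro Bochner_Integration.integral_cong refl)
      fix t
      have "tent ((t - a) / e k) = 0" if "t \<notin> {0<..<T}"
      proof (rule tent_outside)
        have "t - a \<le> 0 \<or> 2 * e k \<le> t - a" using that a e(3)[of k] by auto
        then show "(t - a) / e k \<le> 0 \<or> 2 \<le> (t - a) / e k"
          using e(1)[of k] by (auto simp: divide_le_0_iff le_divide_eq)
      qed
      then show "indicator {0<..<T} t * (tent ((t - a) / e k) / e k * \<phi> t) = tent ((t - a) / e k) / e k * f t"
        using f_eq[of t] by (auto split: split_indicator)
    qed
    also have "\<dots> = (LINT x|lebesgue. tent x * f (a + e k * x))"
      using e(1)[of k]
      by (subst lebesgue_integral_real_affine[where c = "e k" and t = a]) auto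
    finally show ?thesis .
  qed
  have "(\<lambda>k. LINT x|lebesgue. tent x * f (a + e k * x)) \<longlonglongrightarrow> (LINT x|lebesgue. tent x * f a)"
  proof (rule Bochner_Integration.integral_dominated_convergence[where w = "\<lambda>x. tent x * B"])
    show "AE x in lebesgue. (\<lambda>k. tent x * f (a + e k * x)) \<longlonglongrightarrow> tent x * f a"
    proof (rule AE_I2)
      fix x
      have "(\<lambda>k. a + e k * x) \<longlonglongrightarrow> a + 0 * x" by (intro tendsto_intros e)
      then have "(\<lambda>k. f (a + e k * x)) \<longlonglongrightarrow> f a"
        using f by (auto simp: continuous_on_eq_continuous_at intro: isCont_tendsto_compose)
      then show "(\<lambda>k. tent x * f (a + e k * x)) \<longlonglongrightarrow> tent x * f a"
        by (rule tendsto_mult_left)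
    qed
    show "AE x in lebesgue. norm (tent x * f (a + e k * x)) \<le> tent x * B" for k
      using fB tent_nonneg by (intro AE_I2) (simp add: abs_mult mult_left_mono)
  qed (use tent_integral(1) meas in \<open>auto intro: borel_measurable_integrable\<close>)
  then show "(\<lambda>k. LINT t|time T. tent ((t - a) / e k) / e k * \<phi> t) \<longlonglongrightarrow> \<phi> a"
    using eq f_eq[of a] a tent_integral by simp
  have "continuous_on UNIV (\<lambda>t. tent ((t - a) / e k) / e k * f t)"
    using e(1)[of k]
    by (intro continuous_intros continuous_on_compose2[OF tent_continuous] f) auto
  then have "(\<lambda>t. tent ((t - a) / e k) / e k * f t) \<in> borel_measurable (time T)"
    by (intro borel_measurable_time borel_measurable_continuous_onI)
  moreover have "\<bar>tent ((t - a) / e k) / e k * f t\<bar> \<le> 1 / e k * B" for t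
    unfolding abs_mult using fB[of t] e(1)[of k] tent_nonneg tent_le
    by (intro mult_mono) (auto intro: divide_right_mono)
  ultimately have "integrable (time T) (\<lambda>t. tent ((t - a) / e k) / e k * f t)"
    by (rule integrable_time_bounded)
  then show "integrable (time T) (\<lambda>t. tent ((t - a) / e k) / e k * \<phi> t)"
    by (rule Bochner_Integration.integrable_cong[THEN iffD1, rotated -1]) (use f_eq in auto)
qed

text \<open>The test functions are differences of two steps and tend to the indicator of
  \<open>(a,b]\<close>, while their derivatives are differences of two mollifiers concentrating at
  \<open>a\<close> and \<open>b\<close>. In the limit the weak identity becomes the fundamental
  theorem between \<open>a\<close> and \<open>b\<close>; continuity and the value at 0 fix the
  constant.\<close>

lemma du_bois_reymond:
  assumes T: "0 < T" and phi: "continuous_on {0..T} \<phi>" "\<phi> 0 = 0"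
    and h: "integrable lebesgue h" "\<And>t. t \<notin> {0<..<T} \<Longrightarrow> h t = 0"
    and weak: "\<And>\<psi>. test_function T \<psi> \<Longrightarrow>
        (LINT t|time T. deriv \<psi> t * \<phi> t) = - (LINT t|time T. \<psi> t * h t)"
    and t: "t \<in> {0..T}"
  shows "\<phi> t = prim h t"
proof -
  have inner: "\<phi> b - \<phi> a = prim h b - prim h a" if ab: "0 < a" "a < b" "b < T" for a b
  proof -
    \<comment> \<open>The divisor 3 leaves room for the right end of the support,
      \<open>b + 2 * e k\<close>, strictly below \<open>T\<close>.\<close>
    define e where "e k = (T - b) / 3 / real (Suc k)" for k
    have e0: "0 < e k" for k using ab by (simp add: e_def)
    have e_le: "e k \<le> (T - b) / 3" for k
      unfolding e_def using ab by (intro divide_left_mono[of 1, simplified]) auto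
    have eb: "b + 2 * e k < T" for k using e_le[of k] ab by (simp add: field_simps)
    have ea: "a + 2 * e k < T" for k using eb[of k] ab by simp
    have e_lim: "e \<longlonglongrightarrow> 0"
      unfolding e_def by (rule LIMSEQ_Suc[OF lim_const_over_n])
    define \<psi> where "\<psi> k t = smoothstep ((t - a) / e k) - smoothstep ((t - b) / e k)" for k t
    define \<psi>' where "\<psi>' k t = tent ((t - a) / e k) / e k - tent ((t - b) / e k) / e k" for k t
    have D1: "((\<lambda>t. smoothstep ((t - c) / e k)) has_real_derivative tent ((t - c) / e k) / e k) (at t)" for c k t
    proof -
      have "((\<lambda>t. (t - c) / e k) has_real_derivative 1 / e k) (at t)"
        using e0[of k] by (auto intro!: derivative_eq_intros)
      from DERIV_chain2[OF smoothstep_deriv this] show ?thesis by simp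
    qed
    have D: "(\<psi> k has_real_derivative \<psi>' k t) (at t)" for k t
      unfolding \<psi>_def \<psi>'_def by (rule DERIV_diff[OF D1 D1])
    have cont': "continuous_on UNIV (\<psi>' k)" for k
      unfolding \<psi>'_def using e0[of k]
      by (intro continuous_intros continuous_on_compose2[OF tent_continuous]) auto
    have supp: "{t. \<psi> k t \<noteq> 0} \<subseteq> {a..b + 2 * e k}" for k
    proof (rule subsetI, rule ccontr)
      fix t assume *: "t \<in> {t. \<psi> k t \<noteq> 0}" "t \<notin> {a..b + 2 * e k}"
      then consider "t < a" | "b + 2 * e k < t" by fastforce
      then show False
      proof cases
        case 1
        then have "(t - a) / e k \<le> 0" "(t - b) / e k \<le> 0"
          using ab e0[of k] by (auto simp: divide_le_0_iff)
        then show ?thesis using * by (simp add: \<psi>_def smoothstep_0)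
      next
        case 2
        then have "2 \<le> (t - a) / e k" "2 \<le> (t - b) / e k"
          using ab e0[of k] by (auto simp: le_divide_eq)
        then show ?thesis using * by (simp add: \<psi>_def smoothstep_1)
      qed
    qed
    have test: "test_function T (\<psi> k)" for k
      unfolding test_function_def
    proof (intro conjI)
      show "\<psi> k C1_differentiable_on UNIV"
        unfolding C1_differentiable_on_def
        using D cont' by (auto simp: has_real_derivative_iff_has_vector_derivative)
      have "closure {t. \<psi> k t \<noteq> 0} \<subseteq> {a..b + 2 * e k}"
        by (intro closure_minimal supp) auto
      then show "closure {t. \<psi> k t \<noteq> 0} \<subseteq> {0<..<T}" using ab eb[of k] by auto
      show "compact (closure {t. \<psi> k t \<noteq> 0})"
        using bounded_subset[OF bounded_closed_interval supp] by simp
    qed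
    have "(\<lambda>k. LINT t|time T. \<psi>' k t * \<phi> t) \<longlonglongrightarrow> \<phi> a - \<phi> b"
    proof -
      note mol = tent_mollifier[where e = e, OF phi(1) _ _ e0 e_lim]
      have "(LINT t|time T. \<psi>' k t * \<phi> t) = (LINT t|time T. tent ((t - a) / e k) / e k * \<phi> t)
          - (LINT t|time T. tent ((t - b) / e k) / e k * \<phi> t)" for k
        unfolding \<psi>'_def left_diff_distrib
        by (rule Bochner_Integration.integral_diff)
           (rule mol(2); use ab ea eb in simp)+
      moreover have "(\<lambda>k. (LINT t|time T. tent ((t - a) / e k) / e k * \<phi> t)
          - (LINT t|time T. tent ((t - b) / e k) / e k * \<phi> t)) \<longlonglongrightarrow> \<phi> a - \<phi> b"
        using ab ea eb by (intro tendsto_diff mol(1)) auto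
      ultimately show ?thesis by simp
    qed
    moreover have "(LINT t|time T. \<psi>' k t * \<phi> t) = - (LINT t|time T. \<psi> k t * h t)" for k
      using weak[OF test[of k]] DERIV_imp_deriv[OF D] by simp
    moreover have "(\<lambda>k. LINT t|time T. \<psi> k t * h t) \<longlonglongrightarrow> (LINT t|time T. indicator {a<..b} t * h t)"
    proof (rule Bochner_Integration.integral_dominated_convergence[where w = "\<lambda>t. \<bar>h t\<bar>"])
      have hT: "integrable (time T) h" by (rule integrable_time_lebesgue[OF h(1)])
      then show "integrable (time T) (\<lambda>t. \<bar>h t\<bar>)" by simp
      note [measurable] = borel_measurable_integrable[OF hT]
      show "(\<lambda>t. indicator {a<..b} t * h t) \<in> borel_measurable (time T)"
        by measurable
      have "continuous_on UNIV (\<psi> k)" for k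
        by (intro continuous_at_imp_continuous_on ballI DERIV_isCont[OF D])
      then show "(\<lambda>t. \<psi> k t * h t) \<in> borel_measurable (time T)" for k
        by (intro borel_measurable_times[OF _ borel_measurable_integrable[OF hT]] borel_measurable_time
            borel_measurable_continuous_onI)
      show "AE t in time T. norm (\<psi> k t * h t) \<le> \<bar>h t\<bar>" for k
      proof (rule AE_I2)
        fix t
        have "\<bar>\<psi> k t\<bar> \<le> 1"
          unfolding \<psi>_def using smoothstep_bounds[of "(t - a) / e k"] smoothstep_bounds[of "(t - b) / e k"] by linarith
        then show "norm (\<psi> k t * h t) \<le> \<bar>h t\<bar>" by (simp add: abs_mult mult_left_le_one_le)
      qed
      \<comment> \<open>At \<open>t = c\<close> the step has the value 0 for every \<open>k\<close>,
        so the limit is the indicator of the half-open interval, matching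
        \<open>prim_diff\<close>.\<close>
      have step: "(\<lambda>k. smoothstep ((t - c) / e k)) \<longlonglongrightarrow> (if c < t then 1 else 0)" for c t
      proof (cases "c < t")
        case True
        have "\<forall>\<^sub>F k in sequentially. e k < (t - c) / 2"
          using True by (intro order_tendstoD(2)[OF e_lim]) auto
        then have "\<forall>\<^sub>F k in sequentially. smoothstep ((t - c) / e k) = 1"
        proof eventually_elim
          case (elim k)
          then show ?case using e0[of k] by (intro smoothstep_1) (simp add: field_simps)
        qed
        then show ?thesis using True by (auto intro: tendsto_eventually)
      next
        case False
        then have "smoothstep ((t - c) / e k) = 0" for k
          using e0[of k] by (intro smoothstep_0) (simp add: divide_le_0_iff)
        then show ?thesis using False by simp
      qed
      show "AE t in time T. (\<lambda>k. \<psi> k t * h t) \<longlonglongrightarrow> indicator {a<..b} t * h t"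
      proof (rule AE_I2)
        fix t
        have "(\<lambda>k. \<psi> k t * h t) \<longlonglongrightarrow> ((if a < t then 1 else 0) - (if b < t then 1 else 0)) * h t"
          unfolding \<psi>_def by (intro tendsto_mult tendsto_diff step tendsto_const)
        also have "((if a < t then 1 else 0) - (if b < t then 1 else 0)) * h t = indicator {a<..b} t * h t"
          using ab by (auto split: split_indicator)
        finally show "(\<lambda>k. \<psi> k t * h t) \<longlonglongrightarrow> indicator {a<..b} t * h t" .
      qed
    qed
    ultimately have "\<phi> a - \<phi> b = - (LINT t|time T. indicator {a<..b} t * h t)"
      by (simp add: LIMSEQ_unique[OF _ tendsto_minus])
    also have "(LINT t|time T. indicator {a<..b} t * h t) = prim h b - prim h a"
      unfolding time_restrict_indicator prim_diff[OF h(1) less_imp_le[OF ab(2)]]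
      using ab by (intro Bochner_Integration.integral_cong) (auto split: split_indicator)
    finally show ?thesis by simp
  qed
  have "\<phi> x - prim h x = \<phi> (T / 2) - prim h (T / 2)" if "x \<in> {0<..<T}" for x
    using inner[of x "T / 2"] inner[of "T / 2" x] that T by (cases x "T / 2" rule: linorder_cases) auto
  moreover have "closure {0<..<T} = {0..T}" using T by simp
  moreover have "continuous_on {0..T} (\<lambda>x. \<phi> x - prim h x)"
    by (intro continuous_intros phi continuous_on_subset[OF prim_continuous[OF h(1)]]) auto
  ultimately have const: "\<phi> x - prim h x = \<phi> (T / 2) - prim h (T / 2)" if "x \<in> {0..T}" for x
    using continuous_constant_on_closure[of "{0<..<T}" "\<lambda>x. \<phi> x - prim h x"] that by metis
  \<comment> \<open>The density vanishes at all \<open>s \<le> 0\<close>, so both \<phi> and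
    \<open>prim h\<close> are 0 at time 0 and the constant difference is 0.\<close>
  have "(\<lambda>s. indicator {..0} s * h s) = (\<lambda>s. 0)"
    using h(2) by (intro ext) (auto split: split_indicator)
  then have "prim h 0 = 0" unfolding prim_def by (simp only: Bochner_Integration.integral_zero)
  then show ?thesis using const[of 0] const[OF t] phi(2) T by simp
qed

subsection \<open>Difference quotients of dual-valued densities\<close>

lemma simple_function_abs_le_sum:
  fixes k :: "'b \<Rightarrow> 'a \<Rightarrow> real"
  assumes "simple_function M y" "t \<in> space M"
  shows "\<bar>k t (y t)\<bar> \<le> (\<Sum>v\<in>y ` space M. \<bar>k t v\<bar>)"
  using assms by (intro member_le_sum[of "y t" _ "\<lambda>v. \<bar>k t v\<bar>"]) (auto simp: simple_function_def)

lemma simple_function_integrable: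
  fixes k :: "'b \<Rightarrow> 'a \<Rightarrow> real"
  assumes y: "simple_function M y" and yV: "\<And>t. y t \<in> V"
    and k: "\<And>v. v \<in> V \<Longrightarrow> integrable M (\<lambda>t. k t v)"
  shows "integrable M (\<lambda>t. k t (y t))"
proof (rule Bochner_Integration.integrable_bound)
  show "integrable M (\<lambda>t. \<Sum>v\<in>y ` space M. \<bar>k t v\<bar>)"
    using yV by (intro Bochner_Integration.integrable_sum integrable_abs k) auto
  show "(\<lambda>t. k t (y t)) \<in> borel_measurable M"
    by (rule simple_function_eval_measurable[OF y yV borel_measurable_integrable[OF k]])
  show "AE t in M. norm (k t (y t)) \<le> norm (\<Sum>v\<in>y ` space M. \<bar>k t v\<bar>)"
    using simple_function_abs_le_sum[OF y, of _ k] by (intro AE_I2) (simp add: sum_nonneg)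
qed

text \<open>Since \<open>y\<close> takes finitely many values, the error along \<open>y\<close> is
  at most the sum of the errors at these values, each of which tends to 0 in the mean.\<close>

lemma simple_function_integral_tendsto:
  fixes g :: "'c \<Rightarrow> 'b \<Rightarrow> 'a \<Rightarrow> real" and h :: "'b \<Rightarrow> 'a \<Rightarrow> real"
  assumes y: "simple_function M y" and yV: "\<And>t. y t \<in> V"
    and g: "\<And>v \<tau>. v \<in> V \<Longrightarrow> integrable M (\<lambda>t. g \<tau> t v)"
    and h: "\<And>v. v \<in> V \<Longrightarrow> integrable M (\<lambda>t. h t v)"
    and lim: "\<And>v. v \<in> V \<Longrightarrow> ((\<lambda>\<tau>. LINT t|M. \<bar>g \<tau> t v - h t v\<bar>) \<longlongrightarrow> 0) F"
  shows "((\<lambda>\<tau>. LINT t|M. g \<tau> t (y t)) \<longlongrightarrow> (LINT t|M. h t (y t))) F"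
proof -
  let ?Y = "y ` space M"
  have gy: "integrable M (\<lambda>t. g \<tau> t (y t))" for \<tau>
    by (rule simple_function_integrable[OF y yV g])
  have hy: "integrable M (\<lambda>t. h t (y t))"
    by (rule simple_function_integrable[OF y yV h])
  have "((\<lambda>\<tau>. (LINT t|M. g \<tau> t (y t)) - (LINT t|M. h t (y t))) \<longlongrightarrow> 0) F"
  proof (rule Lim_null_comparison[OF always_eventually], intro allI)
    fix \<tau>
    have "\<bar>(LINT t|M. g \<tau> t (y t)) - (LINT t|M. h t (y t))\<bar> = \<bar>LINT t|M. g \<tau> t (y t) - h t (y t)\<bar>"
      by (simp add: gy hy)
    also have "\<dots> \<le> (LINT t|M. \<bar>g \<tau> t (y t) - h t (y t)\<bar>)"
      by (rule integral_abs_bound)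
    also have "\<dots> \<le> (LINT t|M. (\<Sum>v\<in>?Y. \<bar>g \<tau> t v - h t v\<bar>))"
      using simple_function_abs_le_sum[OF y, of _ "\<lambda>t v. g \<tau> t v - h t v"] yV
      by (intro integral_mono integrable_abs Bochner_Integration.integrable_diff gy hy
          Bochner_Integration.integrable_sum g h) auto
    also have "\<dots> = (\<Sum>v\<in>?Y. (LINT t|M. \<bar>g \<tau> t v - h t v\<bar>))"
      using yV by (intro Bochner_Integration.integral_sum integrable_abs Bochner_Integration.integrable_diff g h) auto
    finally show "norm ((LINT t|M. g \<tau> t (y t)) - (LINT t|M. h t (y t))) \<le> (\<Sum>v\<in>?Y. (LINT t|M. \<bar>g \<tau> t v - h t v\<bar>))"
      by simp
  next
    show "((\<lambda>\<tau>. \<Sum>v\<in>?Y. (LINT t|M. \<bar>g \<tau> t v - h t v\<bar>)) \<longlongrightarrow> 0) F"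
      using yV by (intro tendsto_null_sum lim) auto
  qed
  then show ?thesis by (simp add: LIM_zero_iff)
qed

text \<open>A cleaned-up density: additivity and the bound hold at every real \<open>t\<close> and
  for all \<open>v\<close>, not merely almost everywhere in \<open>(0,T)\<close>. Primitives of the
  evaluations then depend additively on \<open>v\<close> at every time, and the windows may reach to
  the left of 0.\<close>

locale dual_density =
  fixes T p r :: real and V :: "'a::real_vector set" and n :: "'a \<Rightarrow> real"
    and h :: "real \<Rightarrow> 'a \<Rightarrow> real" and \<gamma> :: "real \<Rightarrow> real"
  assumes T: "0 < T" and p: "1 < p" and r: "1 < r" and pr: "1 / p + 1 / r = 1"
    and V: "normed_on V n"
    and h_diff: "x \<in> V \<Longrightarrow> y \<in> V \<Longrightarrow> h t (x - y) = h t x - h t y"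
    and h_le: "v \<in> V \<Longrightarrow> \<bar>h t v\<bar> \<le> \<gamma> t * n v"
    and h_meas: "v \<in> V \<Longrightarrow> (\<lambda>t. h t v) \<in> borel_measurable lebesgue"
    and \<gamma>_nonneg: "0 \<le> \<gamma> t"
    and \<gamma>_int: "integrable lebesgue \<gamma>" and \<gamma>_powr: "integrable lebesgue (\<lambda>t. \<gamma> t powr r)"
begin

definition quot :: "real \<Rightarrow> real \<Rightarrow> 'a \<Rightarrow> real" where
  "quot \<tau> t v = (prim (\<lambda>s. h s v) t - prim (\<lambda>s. h s v) (t - \<tau>)) / \<tau>"

text \<open>The average over \<open>(t-\<tau>,t]\<close> of the power of \<gamma>, not the power of
  the average: this is what Young's inequality under the integral leaves behind, and its time
  integral is bounded independently of \<tau>.\<close>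

definition \<gamma>_quot :: "real \<Rightarrow> real \<Rightarrow> real" where
  "\<gamma>_quot \<tau> t = (prim (\<lambda>s. \<gamma> s powr r) t - prim (\<lambda>s. \<gamma> s powr r) (t - \<tau>)) / \<tau>"

lemma h_int: "v \<in> V \<Longrightarrow> integrable lebesgue (\<lambda>s. h s v)"
  by (rule Bochner_Integration.integrable_bound[of _ "\<lambda>s. \<gamma> s * n v"])
     (use \<gamma>_int h_meas h_le in \<open>auto intro!: AE_I2 order_trans[OF h_le]\<close>)

lemma quot_integrable: "v \<in> V \<Longrightarrow> integrable (time T) (\<lambda>t. quot \<tau> t v)"
  unfolding quot_def
  using prim_shift_integrable[OF h_int, of v T 0] prim_shift_integrable[OF h_int, of v T \<tau>] by auto

lemma \<gamma>_quot_integrable: "integrable (time T) (\<gamma>_quot \<tau>)"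
  unfolding \<gamma>_quot_def
  using prim_shift_integrable[OF \<gamma>_powr, of T 0] prim_shift_integrable[OF \<gamma>_powr, of T \<tau>] by auto

lemma prim_h_diff:
  "x \<in> V \<Longrightarrow> y \<in> V \<Longrightarrow> prim (\<lambda>s. h s (x - y)) t = prim (\<lambda>s. h s x) t - prim (\<lambda>s. h s y) t"
  by (simp add: h_diff prim_minus h_int)

lemma quot_diff: "x \<in> V \<Longrightarrow> y \<in> V \<Longrightarrow> quot \<tau> t (x - y) = quot \<tau> t x - quot \<tau> t y"
  by (simp add: quot_def prim_h_diff diff_divide_distrib)

lemma prim_h_le:
  assumes "v \<in> V"
  shows "\<bar>prim (\<lambda>s. h s v) t\<bar> \<le> integral\<^sup>L lebesgue \<gamma> * n v"
proof -
  have "\<bar>prim (\<lambda>s. h s v) t\<bar> \<le> (LINT s|lebesgue. \<bar>indicator {..t} s * h s v\<bar>)"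
    unfolding prim_def by (rule integral_abs_bound)
  also have "\<dots> \<le> (LINT s|lebesgue. \<gamma> s * n v)"
  proof (intro integral_mono integrable_abs integrable_indicator_times h_int assms)
    show "\<bar>indicator {..t} s * h s v\<bar> \<le> \<gamma> s * n v" for s
      using h_le[OF assms, of s] by (auto split: split_indicator)
  qed (use \<gamma>_int in auto)
  finally show ?thesis by simp
qed

lemma h_young:
  assumes "v \<in> V" "0 < d"
  shows "\<bar>h t v\<bar> \<le> n v powr p / d powr p + d powr r * \<gamma> t powr r"
  using h_le[OF assms(1), of t] young_scaled[OF p r pr assms(2) normed_on_nonneg[OF V assms(1)] \<gamma>_nonneg, of t]
  by (simp add: mult.commute)

text \<open>Young's inequality is applied before averaging. On the window the vector
  \<open>v\<close> is fixed, so its term passes through the average unchanged and only the power of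
  \<gamma> is averaged.\<close>

lemma quot_young:
  assumes v: "v \<in> V" and d: "0 < d" and \<tau>: "0 < \<tau>"
  shows "\<bar>quot \<tau> t v\<bar> \<le> n v powr p / d powr p + d powr r * \<gamma>_quot \<tau> t"
proof -
  let ?c = "n v powr p / d powr p"
  let ?i = "\<lambda>s. indicator {t-\<tau><..t} s :: real"
  have le: "t - \<tau> \<le> t" using \<tau> by simp
  have ci: "integrable lebesgue (\<lambda>s. ?i s * ?c)"
    by (intro integrable_mult_left) (use \<tau> in auto)
  have gi: "integrable lebesgue (\<lambda>s. ?i s * (\<gamma> s powr r))"
    by (intro integrable_indicator_times \<gamma>_powr) auto
  have hi: "integrable lebesgue (\<lambda>s. ?i s * h s v)"
    by (intro integrable_indicator_times h_int v) auto
  have "\<bar>prim (\<lambda>s. h s v) t - prim (\<lambda>s. h s v) (t - \<tau>)\<bar> \<le> (LINT s|lebesgue. \<bar>?i s * h s v\<bar>)"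
    unfolding prim_diff[OF h_int[OF v] le] by (rule integral_abs_bound)
  also have "\<dots> \<le> (LINT s|lebesgue. ?i s * ?c + d powr r * (?i s * (\<gamma> s powr r)))"
  proof (intro integral_mono integrable_abs hi Bochner_Integration.integrable_add ci integrable_mult_right gi)
    show "\<bar>?i s * h s v\<bar> \<le> ?i s * ?c + d powr r * (?i s * (\<gamma> s powr r))" for s
      using h_young[OF v d, of s] by (auto split: split_indicator)
  qed
  also have "\<dots> = \<tau> * ?c + d powr r * (prim (\<lambda>s. \<gamma> s powr r) t - prim (\<lambda>s. \<gamma> s powr r) (t - \<tau>))"
    unfolding prim_diff[OF \<gamma>_powr le]
    by (subst Bochner_Integration.integral_add[OF ci integrable_mult_right[OF gi]]) (use \<tau> in simp)
  finally have "\<bar>prim (\<lambda>s. h s v) t - prim (\<lambda>s. h s v) (t - \<tau>)\<bar> / \<tau>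
      \<le> (\<tau> * ?c + d powr r * (prim (\<lambda>s. \<gamma> s powr r) t - prim (\<lambda>s. \<gamma> s powr r) (t - \<tau>))) / \<tau>"
    using \<tau> by (intro divide_right_mono) auto
  then show ?thesis
    using \<tau> by (simp add: quot_def \<gamma>_quot_def add_divide_distrib)
qed

lemma \<gamma>_quot_integral: "0 < \<tau> \<Longrightarrow> integral\<^sup>L (time T) (\<gamma>_quot \<tau>) \<le> (LINT s|lebesgue. \<gamma> s powr r)"
  using prim_shift_bound[OF \<gamma>_powr, of \<tau> T] T by (simp add: \<gamma>_quot_def[abs_def] field_simps)

lemma h_eval_measurable:
  assumes "strongly_measurable T V n w"
  shows "(\<lambda>t. h t (w t)) \<in> borel_measurable (time T)"
proof (rule strongly_measurable_eval[OF assms])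
  show "AE t in time T. \<exists>K. \<forall>x\<in>V. \<forall>y\<in>V. \<bar>h t x - h t y\<bar> \<le> K * n (x - y)"
  proof (intro AE_I2 exI ballI)
    fix t x y assume "x \<in> V" "y \<in> V"
    then show "\<bar>h t x - h t y\<bar> \<le> \<gamma> t * n (x - y)"
      using h_le[OF normed_on_diff[OF V], of x y t] by (simp add: h_diff)
  qed
qed (auto intro: measurable_restrict_space1 h_meas)

lemma prim_h_eval_measurable:
  assumes "strongly_measurable T V n w"
  shows "(\<lambda>t. prim (\<lambda>s. h s (w t)) (t - \<tau>)) \<in> borel_measurable (time T)"
proof (rule strongly_measurable_eval[OF assms])
  show "(\<lambda>t. prim (\<lambda>s. h s v) (t - \<tau>)) \<in> borel_measurable (time T)" if "v \<in> V" for v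
    using prim_shift_integrable[OF h_int[OF that], of T \<tau>] by (rule borel_measurable_integrable)
  show "AE t in time T. \<exists>K. \<forall>x\<in>V. \<forall>y\<in>V.
      \<bar>prim (\<lambda>s. h s x) (t - \<tau>) - prim (\<lambda>s. h s y) (t - \<tau>)\<bar> \<le> K * n (x - y)"
  proof (intro AE_I2 exI ballI)
    fix t x y assume "x \<in> V" "y \<in> V"
    then show "\<bar>prim (\<lambda>s. h s x) (t - \<tau>) - prim (\<lambda>s. h s y) (t - \<tau>)\<bar> \<le> integral\<^sup>L lebesgue \<gamma> * n (x - y)"
      using prim_h_le[OF normed_on_diff[OF V], of x y "t - \<tau>"] by (simp add: prim_h_diff)
  qed
qed

lemma quot_eval_measurable:
  assumes "strongly_measurable T V n w"
  shows "(\<lambda>t. quot \<tau> t (w t)) \<in> borel_measurable (time T)"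
  unfolding quot_def
  using prim_h_eval_measurable[OF assms, of 0] prim_h_eval_measurable[OF assms, of \<tau>] by simp

lemma eval_integrable:
  assumes w: "w \<in> Lspace p T V n"
  shows h_eval_integrable: "integrable (time T) (\<lambda>t. h t (w t))"
    and quot_eval_integrable: "0 < \<tau> \<Longrightarrow> integrable (time T) (\<lambda>t. quot \<tau> t (w t))"
proof -
  have sm: "strongly_measurable T V n w" and wV: "AE t in time T. w t \<in> V"
    and wi: "integrable (time T) (\<lambda>t. n (w t) powr p)"
    using w by (auto simp: Lspace_def strongly_measurable_def)
  show "integrable (time T) (\<lambda>t. h t (w t))"
  proof (rule Bochner_Integration.integrable_bound)
    show "integrable (time T) (\<lambda>t. n (w t) powr p + \<gamma> t powr r)"
      by (intro Bochner_Integration.integrable_add wi integrable_time_lebesgue \<gamma>_powr)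
    show "AE t in time T. norm (h t (w t)) \<le> norm (n (w t) powr p + \<gamma> t powr r)"
      using wV
    proof eventually_elim
      case (elim t)
      show ?case using h_young[OF elim, of 1 t] by simp
    qed
  qed (rule h_eval_measurable[OF sm])
  show "integrable (time T) (\<lambda>t. quot \<tau> t (w t))" if "0 < \<tau>"
  proof (rule Bochner_Integration.integrable_bound)
    show "integrable (time T) (\<lambda>t. n (w t) powr p + \<gamma>_quot \<tau> t)"
      by (intro Bochner_Integration.integrable_add wi \<gamma>_quot_integrable)
    show "AE t in time T. norm (quot \<tau> t (w t)) \<le> norm (n (w t) powr p + \<gamma>_quot \<tau> t)"
      using wV
    proof eventually_elim
      case (elim t)
      show ?case using quot_young[OF elim _ that, of 1 t] by simp
    qed
  qed (rule quot_eval_measurable[OF sm])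
qed

lemma quot_integral_tendsto:
  assumes w: "w \<in> Lspace p T V n"
  shows "((\<lambda>\<tau>. LINT t|time T. quot \<tau> t (w t)) \<longlongrightarrow> (LINT t|time T. h t (w t))) (at_right 0)"
proof (rule tendstoI)
  fix e :: real assume "0 < e"
  \<comment> \<open>Replacing \<open>w\<close> by a simple function costs \<open>2 * e'\<close> in
    the quotient and \<open>2 * e'\<close> in the limit, and the convergence for that simple
    function costs \<open>e'\<close>: five sixths of \<open>e\<close>.\<close>
  define e' where "e' = e / 6"
  have e': "0 < e'" using \<open>0 < e\<close> by (simp add: e'_def)
  let ?I = "LINT s|lebesgue. \<gamma> s powr r"
  have I: "0 \<le> ?I" by (intro Bochner_Integration.integral_nonneg) simp
  \<comment> \<open>Chosen so that \<open>d powr r\<close> times the integral of the powers of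
    \<gamma> is at most \<open>e'\<close>; adding 1 avoids dividing by 0. It precedes the choice of
    the simple function, whose error is divided by \<open>d powr p\<close>.\<close>
  define d where "d = (e' / (?I + 1)) powr (1 / r)"
  have d: "0 < d" and dr: "d powr r = e' / (?I + 1)"
    using e' add_nonneg_pos[OF I zero_less_one] r by (auto simp: d_def powr_powr)
  have "d powr r * ?I = e' * (?I / (?I + 1))" by (simp add: dr)
  also have "\<dots> \<le> e'" using e' add_nonneg_pos[OF I zero_less_one] by (intro mult_left_le) (simp_all add: divide_le_eq_1)
  finally have dI: "d powr r * ?I \<le> e'" .
  have wV: "AE t in time T. w t \<in> V" using w by (simp add: Lspace_def strongly_measurable_def)
  obtain y :: "nat \<Rightarrow> real \<Rightarrow> 'a" where y: "\<And>i. simple_function (time T) (y i)" "\<And>i t. y i t \<in> V"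
    and yi: "\<And>i. integrable (time T) (\<lambda>t. n (w t - y i t) powr p)"
    and lim: "(\<lambda>i. LINT t|time T. n (w t - y i t) powr p) \<longlonglongrightarrow> 0"
    using Lspace_simple_approx[OF V less_imp_le[OF p] w] by blast
  have "\<forall>\<^sub>F i in sequentially. (LINT t|time T. n (w t - y i t) powr p) < e' * d powr p"
    using e' d by (intro order_tendstoD(2)[OF lim]) auto
  then obtain i where "(LINT t|time T. n (w t - y i t) powr p) < e' * d powr p"
    by (auto simp: eventually_sequentially)
  then have i: "(LINT t|time T. n (w t - y i t) powr p) / d powr p \<le> e'"
    using d by (simp add: divide_le_eq)
  have hyi: "integrable (time T) (\<lambda>t. h t (y i t))"
    by (rule simple_function_integrable[OF y]) (intro integrable_time_lebesgue h_int)
  have hw: "integrable (time T) (\<lambda>t. h t (w t))" by (rule h_eval_integrable[OF w])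
  have "\<bar>(LINT t|time T. h t (w t)) - (LINT t|time T. h t (y i t))\<bar>
      = \<bar>LINT t|time T. h t (w t) - h t (y i t)\<bar>"
    using hyi hw by simp
  also have "\<dots> \<le> (LINT t|time T. \<bar>h t (w t) - h t (y i t)\<bar>)" by (rule integral_abs_bound)
  also have "\<dots> \<le> (LINT t|time T. n (w t - y i t) powr p / d powr p + d powr r * \<gamma> t powr r)"
  proof (intro integral_mono_AE integrable_abs Bochner_Integration.integrable_diff hyi hw
      Bochner_Integration.integrable_add integrable_divide yi integrable_mult_right integrable_time_lebesgue \<gamma>_powr)
    show "AE t in time T. \<bar>h t (w t) - h t (y i t)\<bar> \<le> n (w t - y i t) powr p / d powr p + d powr r * \<gamma> t powr r"
      using wV
    proof eventually_elim
      case (elim t)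
      show ?case using h_young[where v = "w t - y i t" and t = t, OF normed_on_diff[OF V elim y(2)] d] by (simp add: h_diff elim y)
    qed
  qed
  also have "\<dots> = (LINT t|time T. n (w t - y i t) powr p) / d powr p + d powr r * (LINT t|time T. \<gamma> t powr r)"
    by (subst Bochner_Integration.integral_add)
       (simp_all add: yi integrable_time_lebesgue \<gamma>_powr)
  also have "\<dots> \<le> e' + d powr r * ?I"
    using integral_time_le[OF \<gamma>_powr] d by (intro add_mono i mult_left_mono) auto
  finally have 1: "\<bar>(LINT t|time T. h t (w t)) - (LINT t|time T. h t (y i t))\<bar> \<le> 2 * e'"
    using dI by simp
  have 2: "\<bar>(LINT t|time T. quot \<tau> t (w t)) - (LINT t|time T. quot \<tau> t (y i t))\<bar> \<le> 2 * e'"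
    if \<tau>: "0 < \<tau>" for \<tau>
  proof -
    have qyi: "integrable (time T) (\<lambda>t. quot \<tau> t (y i t))"
      by (rule simple_function_integrable[OF y quot_integrable])
    have qw: "integrable (time T) (\<lambda>t. quot \<tau> t (w t))" by (rule quot_eval_integrable[OF w \<tau>])
    have "\<bar>(LINT t|time T. quot \<tau> t (w t)) - (LINT t|time T. quot \<tau> t (y i t))\<bar>
        = \<bar>LINT t|time T. quot \<tau> t (w t) - quot \<tau> t (y i t)\<bar>"
      using qyi qw by simp
    also have "\<dots> \<le> (LINT t|time T. \<bar>quot \<tau> t (w t) - quot \<tau> t (y i t)\<bar>)" by (rule integral_abs_bound)
    also have "\<dots> \<le> (LINT t|time T. n (w t - y i t) powr p / d powr p + d powr r * \<gamma>_quot \<tau> t)"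
    proof (intro integral_mono_AE integrable_abs Bochner_Integration.integrable_diff qyi qw
        Bochner_Integration.integrable_add integrable_divide yi integrable_mult_right \<gamma>_quot_integrable)
      show "AE t in time T. \<bar>quot \<tau> t (w t) - quot \<tau> t (y i t)\<bar>
          \<le> n (w t - y i t) powr p / d powr p + d powr r * \<gamma>_quot \<tau> t"
        using wV
      proof eventually_elim
        case (elim t)
        show ?case using quot_young[where v = "w t - y i t" and t = t, OF normed_on_diff[OF V elim y(2)] d \<tau>]
          by (simp add: quot_diff elim y)
      qed
    qed
    also have "\<dots> = (LINT t|time T. n (w t - y i t) powr p) / d powr p + d powr r * (integral\<^sup>L (time T) (\<gamma>_quot \<tau>))"
      by (subst Bochner_Integration.integral_add)
         (simp_all add: yi \<gamma>_quot_integrable)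
    also have "\<dots> \<le> e' + d powr r * ?I"
      using \<gamma>_quot_integral[OF \<tau>] d by (intro add_mono i mult_left_mono) auto
    finally show ?thesis using dI by simp
  qed
  have "((\<lambda>\<tau>. LINT t|time T. quot \<tau> t (y i t)) \<longlongrightarrow> (LINT t|time T. h t (y i t))) (at_right 0)"
    by (rule simple_function_integral_tendsto[OF y quot_integrable])
       (use steklov_L1[OF h_int T] in \<open>auto simp: quot_def intro: integrable_time_lebesgue h_int\<close>)
  from tendstoD[OF this e']
  show "\<forall>\<^sub>F \<tau> in at_right 0. dist (LINT t|time T. quot \<tau> t (w t)) (LINT t|time T. h t (w t)) < e"
    using eventually_at_right_less[of 0]
  proof eventually_elim
    case (elim \<tau>)
    then show ?case using 1 2[OF elim(2)] e' unfolding dist_real_def e'_def by linarith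
  qed
qed

end

subsection \<open>Positivity of the time derivative\<close>

lemma dual_onD:
  assumes "g \<in> dual_on X n"
  shows dual_on_add: "x \<in> X \<Longrightarrow> y \<in> X \<Longrightarrow> g (x + y) = g x + g y"
    and dual_on_scale: "x \<in> X \<Longrightarrow> g (a *\<^sub>R x) = a * g x"
    and dual_on_bound: "\<exists>K. \<forall>x\<in>X. \<bar>g x\<bar> \<le> K * n x"
    and dual_on_outside: "x \<notin> X \<Longrightarrow> g x = 0"
  using assms by (simp_all add: dual_on_def bounded_linear_on_def)

lemma dual_on_diff:
  assumes "normed_on X n" "g \<in> dual_on X n" "x \<in> X" "y \<in> X"
  shows "g (x - y) = g x - g y"
  using dual_on_add[OF assms(2) normed_on_diff[OF assms(1,3,4)] assms(4)] by simp

lemma dual_norm_props: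
  assumes X: "normed_on X n" and g: "g \<in> dual_on X n"
  shows dual_norm_nonneg: "0 \<le> dual_norm X n g"
    and dual_norm_bound: "v \<in> X \<Longrightarrow> \<bar>g v\<bar> \<le> dual_norm X n g * n v"
proof -
  let ?S = "{\<bar>g x\<bar> | x. x \<in> X \<and> n x \<le> 1}"
  obtain K where K: "\<And>x. x \<in> X \<Longrightarrow> \<bar>g x\<bar> \<le> K * n x"
    using dual_on_bound[OF g] by blast
  have bdd: "bdd_above ?S"
  proof (rule bdd_aboveI)
    fix y assume "y \<in> ?S"
    then obtain x where x: "x \<in> X" "n x \<le> 1" "y = \<bar>g x\<bar>" by blast
    have "y \<le> \<bar>K\<bar> * n x"
      using K[OF x(1)] normed_on_nonneg[OF X x(1)] x(3) by (smt (verit) mult_right_mono)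
    also have "\<dots> \<le> \<bar>K\<bar>" using x normed_on_nonneg[OF X x(1)] by (intro mult_left_le) auto
    finally show "y \<le> \<bar>K\<bar>" .
  qed
  have n0: "n 0 = 0" using normed_on_eq_0[OF X normed_on_0[OF X]] by simp
  have "\<bar>g 0\<bar> \<le> dual_norm X n g"
    unfolding dual_norm_def using normed_on_0[OF X] n0 by (intro cSup_upper bdd) force
  then show "0 \<le> dual_norm X n g" by linarith
  show "\<bar>g v\<bar> \<le> dual_norm X n g * n v" if v: "v \<in> X"
  proof (cases "n v = 0")
    case True
    then show ?thesis using K[OF v] by simp
  next
    case False
    then have nv: "0 < n v" using normed_on_nonneg[OF X v] by simp
    let ?x = "(1 / n v) *\<^sub>R v"
    have "\<bar>g ?x\<bar> \<le> dual_norm X n g"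
      unfolding dual_norm_def using normed_on_scale[OF X v] normed_on_abs[OF X v] nv
      by (intro cSup_upper bdd) force
    then show ?thesis using nv dual_on_scale[OF g v] by (simp add: abs_mult field_simps)
  qed
qed

lemma dual_on_minus:
  assumes "normed_on X n" "f \<in> dual_on X n" "g \<in> dual_on X n"
  shows "f - g \<in> dual_on X n"
proof -
  from dual_on_bound[OF assms(2)] dual_on_bound[OF assms(3)] obtain K L
    where K: "\<And>x. x \<in> X \<Longrightarrow> \<bar>f x\<bar> \<le> K * n x" and L: "\<And>x. x \<in> X \<Longrightarrow> \<bar>g x\<bar> \<le> L * n x" by blast
  have "\<bar>f x - g x\<bar> \<le> (K + L) * n x" if "x \<in> X" for x
    using K[OF that] L[OF that] by (simp add: distrib_right)
  then show ?thesis
    using assms dual_onD[OF assms(2)] dual_onD[OF assms(3)]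
    by (auto simp: dual_on_def bounded_linear_on_def right_diff_distrib)
qed

lemma integrable_zero_extend:
  fixes f :: "real \<Rightarrow> real"
  assumes "integrable (time T) f"
  shows "integrable lebesgue (\<lambda>t. if t \<in> {0<..<T} then f t else 0)"
  using assms by (subst Lebesgue_Measure.integrable_restrict_UNIV) auto

text \<open>The bound \<open>\<gamma>\<close> replaces the dual norm of \<open>g\<close>, so that a difference of densities is again one
  without discussing the measurability of its dual norm.\<close>

definition bounded_density ::
    "real \<Rightarrow> 'a::real_vector set \<Rightarrow> ('a \<Rightarrow> real) \<Rightarrow> real \<Rightarrow> (real \<Rightarrow> 'a \<Rightarrow> real) \<Rightarrow> (real \<Rightarrow> real) \<Rightarrow> bool" where
  "bounded_density T V n r g \<gamma> \<longleftrightarrow>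
     (AE t in time T. g t \<in> dual_on V n \<and> (\<forall>v\<in>V. \<bar>g t v\<bar> \<le> \<gamma> t * n v)) \<and>
     (\<forall>v\<in>V. (\<lambda>t. g t v) \<in> borel_measurable (time T)) \<and>
     (\<forall>t. 0 \<le> \<gamma> t) \<and> integrable (time T) (\<lambda>t. \<gamma> t powr r)"

lemma bounded_density_Lspace:
  assumes V: "normed_on V n" and r: "r > 0" and g: "g \<in> Lspace r T (dual_on V n) (dual_norm V n)"
  shows "\<exists>\<gamma>. bounded_density T V n r g \<gamma>"
proof -
  from g obtain s where gV: "AE t in time T. g t \<in> dual_on V n"
    and s: "\<And>i. simple_function (time T) (s i)" "\<And>i t. s i t \<in> dual_on V n"
    and lim: "AE t in time T. (\<lambda>i. dual_norm V n (s i t - g t)) \<longlonglongrightarrow> 0"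
    and int: "integrable (time T) (\<lambda>t. dual_norm V n (g t) powr r)"
    unfolding strongly_measurable_def Lspace_def by auto
  have meas: "(\<lambda>t. g t v) \<in> borel_measurable (time T)" if v: "v \<in> V" for v
  proof (rule borel_measurable_time_AE_lim)
    show "(\<lambda>t. s i t v) \<in> borel_measurable (time T)" for i
      by (rule borel_measurable_simple_function) (rule simple_function_compose1[where g = "\<lambda>f. f v", OF s(1)])
    show "AE t in time T. (\<lambda>i. s i t v) \<longlonglongrightarrow> g t v"
      using gV lim
    proof eventually_elim
      case (elim t)
      have "(\<lambda>i. dual_norm V n (s i t - g t) * n v) \<longlonglongrightarrow> 0"
        using tendsto_mult_right[OF elim(2), of "n v"] by simp
      moreover have "norm (s i t v - g t v) \<le> dual_norm V n (s i t - g t) * n v" for i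
        using dual_norm_bound[OF V dual_on_minus[OF V s(2) elim(1)] v] by simp
      ultimately have "(\<lambda>i. s i t v - g t v) \<longlonglongrightarrow> 0"
        by - (rule Lim_null_comparison[OF always_eventually], simp_all)
      then show ?case by (simp add: LIM_zero_iff)
    qed
  qed
  \<comment> \<open>The absolute value matters only on the exceptional null set, where
    \<open>g t\<close> may lie outside the dual and the supremum has no known sign.\<close>
  define \<gamma> where "\<gamma> t = \<bar>dual_norm V n (g t)\<bar>" for t
  have "AE t in time T. g t \<in> dual_on V n \<and> (\<forall>v\<in>V. \<bar>g t v\<bar> \<le> \<gamma> t * n v)"
    using gV
  proof eventually_elim
    case (elim t)
    then show ?case using dual_norm_bound[OF V elim] dual_norm_nonneg[OF V elim] by (simp add: \<gamma>_def)
  qed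
  moreover have "integrable (time T) (\<lambda>t. \<gamma> t powr r)"
  proof -
    have "AE t in time T. dual_norm V n (g t) powr r = \<gamma> t powr r"
      using gV by eventually_elim (simp add: \<gamma>_def dual_norm_nonneg[OF V])
    then show ?thesis
      using integrable_cong_AE_imp[OF int borel_measurable_time_AE_cong[OF borel_measurable_integrable[OF int]]]
      by auto
  qed
  moreover have "\<forall>t. 0 \<le> \<gamma> t" by (simp add: \<gamma>_def)
  ultimately show ?thesis using meas unfolding bounded_density_def by blast
qed

lemma bounded_density_minus:
  assumes V: "normed_on V n" and r: "r > 0"
    and f: "bounded_density T V n r f \<alpha>" and g: "bounded_density T V n r g \<beta>"
  shows "bounded_density T V n r (f - g) (\<lambda>t. \<alpha> t + \<beta> t)"
proof -
  \<comment> \<open>Integrability is given for the power only; taking the root of a nonnegative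
    function recovers measurability of the bound itself.\<close>
  have m: "\<gamma> \<in> borel_measurable (time T)" if "\<And>t. 0 \<le> \<gamma> t" "integrable (time T) (\<lambda>t. \<gamma> t powr r)" for \<gamma> :: "real \<Rightarrow> real"
  proof -
    have "(\<lambda>t. (\<gamma> t powr r) powr (1 / r)) \<in> borel_measurable (time T)"
      using borel_measurable_integrable[OF that(2)] by measurable
    then show ?thesis using that(1) r by (simp add: powr_powr)
  qed
  have [measurable]: "\<alpha> \<in> borel_measurable (time T)" "\<beta> \<in> borel_measurable (time T)"
    using f g by (auto simp: bounded_density_def intro!: m)
  have "AE t in time T. (f - g) t \<in> dual_on V n \<and> (\<forall>v\<in>V. \<bar>(f - g) t v\<bar> \<le> (\<alpha> t + \<beta> t) * n v)"
    using f[unfolded bounded_density_def, THEN conjunct1] g[unfolded bounded_density_def, THEN conjunct1]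
  proof eventually_elim
    case (elim t)
    then have "f t - g t \<in> dual_on V n" by (intro dual_on_minus[OF V]) auto
    moreover have "\<bar>f t v - g t v\<bar> \<le> (\<alpha> t + \<beta> t) * n v" if "v \<in> V" for v
    proof -
      have "\<bar>f t v\<bar> \<le> \<alpha> t * n v" "\<bar>g t v\<bar> \<le> \<beta> t * n v" using elim that by auto
      then show ?thesis by (simp add: distrib_right)
    qed
    ultimately show ?case by simp
  qed
  moreover have "integrable (time T) (\<lambda>t. (\<alpha> t + \<beta> t) powr r)"
  proof (rule Bochner_Integration.integrable_bound)
    show "integrable (time T) (\<lambda>t. 2 powr r * (\<alpha> t powr r + \<beta> t powr r))"
      using f g by (auto simp: bounded_density_def)
    show "AE t in time T. norm ((\<alpha> t + \<beta> t) powr r) \<le> norm (2 powr r * (\<alpha> t powr r + \<beta> t powr r))"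
      using f g r by (intro AE_I2) (auto simp: bounded_density_def intro!: powr_add_le)
  qed measurable
  moreover have "(\<lambda>t. (f - g) t v) \<in> borel_measurable (time T)" if "v \<in> V" for v
    using f g that by (auto simp: bounded_density_def intro: borel_measurable_diff)
  moreover have "0 \<le> \<alpha> t + \<beta> t" for t using f g by (simp add: bounded_density_def)
  ultimately show ?thesis unfolding bounded_density_def by (intro conjI ballI allI)
qed

text \<open>Setting \<open>g t\<close> to 0 at every bad time turns almost-everywhere properties
  into pointwise ones. The set of bad times does not depend on \<open>v\<close>, so the agreement
  with \<open>g\<close> holds off one null set for all \<open>v\<close>. As \<open>(0,T)\<close> has
  finite measure, \<open>\<gamma> \<le> 1 + \<gamma> powr r\<close> makes the bound integrable as
  well.\<close>

lemma bounded_density_dual_density: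
  assumes T: "0 < T" and p: "1 < p" and r: "1 < r" and pr: "1 / p + 1 / r = 1"
    and V: "normed_on V n" and g: "bounded_density T V n r g \<gamma>"
  shows "\<exists>h \<gamma>'. dual_density T p r V n h \<gamma>' \<and> (AE t in time T. \<forall>v\<in>V. g t v = h t v) \<and>
    (\<forall>t v. t \<notin> {0<..<T} \<longrightarrow> h t v = 0)"
proof -
  define good where "good t \<longleftrightarrow> t \<in> {0<..<T} \<and> g t \<in> dual_on V n \<and> (\<forall>v\<in>V. \<bar>g t v\<bar> \<le> \<gamma> t * n v)" for t
  define h where "h t v = (if good t then g t v else 0)" for t v
  define \<gamma>' where "\<gamma>' t = (if t \<in> {0<..<T} then \<gamma> t else 0)" for t
  have "AE t in time T. t \<in> {0<..<T}" by (intro AE_I2) simp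
  moreover have "AE t in time T. g t \<in> dual_on V n \<and> (\<forall>v\<in>V. \<bar>g t v\<bar> \<le> \<gamma> t * n v)"
    using g by (simp add: bounded_density_def)
  ultimately have good: "AE t in time T. good t"
    by eventually_elim (auto simp: good_def)
  then have gh: "AE t in time T. \<forall>v\<in>V. g t v = h t v"
    by eventually_elim (simp add: h_def)
  have \<gamma>0: "0 \<le> \<gamma> t" for t using g by (simp add: bounded_density_def)
  have \<gamma>r: "integrable (time T) (\<lambda>t. \<gamma> t powr r)" using g by (simp add: bounded_density_def)
  have "(\<lambda>t. (\<gamma> t powr r) powr (1 / r)) \<in> borel_measurable (time T)"
    using borel_measurable_integrable[OF \<gamma>r] by measurable
  then have \<gamma>m: "\<gamma> \<in> borel_measurable (time T)" using \<gamma>0 r by (simp add: powr_powr)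
  have "integrable (time T) \<gamma>"
  proof (rule Bochner_Integration.integrable_bound)
    show "integrable (time T) (\<lambda>t. 1 + \<gamma> t powr r)"
      by (intro Bochner_Integration.integrable_add \<gamma>r finite_measure.integrable_const[OF finite_measure_time])
    have "\<gamma> t \<le> 1 + \<gamma> t powr r" for t
    proof (cases "\<gamma> t \<le> 1")
      case False
      then have "\<gamma> t powr 1 \<le> \<gamma> t powr r" using r by (intro powr_mono) auto
      then show ?thesis using False by simp
    qed (simp add: add_increasing2)
    then show "AE t in time T. norm (\<gamma> t) \<le> norm (1 + \<gamma> t powr r)"
      using \<gamma>0 by (intro AE_I2) simp
  qed (rule \<gamma>m)
  then have 1: "integrable lebesgue \<gamma>'"
    unfolding \<gamma>'_def by (rule integrable_zero_extend)
  have "integrable lebesgue (\<lambda>t. if t \<in> {0<..<T} then \<gamma> t powr r else 0)"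
    by (rule integrable_zero_extend[OF \<gamma>r])
  also have "(\<lambda>t. if t \<in> {0<..<T} then \<gamma> t powr r else 0) = (\<lambda>t. \<gamma>' t powr r)"
    by (auto simp: \<gamma>'_def)
  finally have 2: "integrable lebesgue (\<lambda>t. \<gamma>' t powr r)" .
  have 3: "(\<lambda>t. h t v) \<in> borel_measurable lebesgue" if v: "v \<in> V" for v
  proof -
    have "(\<lambda>t. g t v) \<in> borel_measurable (time T)" using g v by (simp add: bounded_density_def)
    moreover have "AE t in time T. g t v = h t v" using gh by eventually_elim (simp add: v)
    ultimately have "(\<lambda>t. h t v) \<in> borel_measurable (time T)" by (rule borel_measurable_time_AE_cong)
    then have "(\<lambda>t. if t \<in> {0<..<T} then h t v else 0) \<in> borel_measurable lebesgue"
      by (subst borel_measurable_if) auto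
    also have "(\<lambda>t. if t \<in> {0<..<T} then h t v else 0) = (\<lambda>t. h t v)"
      by (auto simp: h_def good_def)
    finally show ?thesis .
  qed
  have "dual_density T p r V n h \<gamma>'"
  proof
    show "h t (x - y) = h t x - h t y" if "x \<in> V" "y \<in> V" for t x y
      using that dual_on_diff[OF V, of "g t"] by (simp add: h_def good_def)
    show "\<bar>h t v\<bar> \<le> \<gamma>' t * n v" if "v \<in> V" for t v
      using that \<gamma>0[of t] normed_on_nonneg[OF V that] by (auto simp: h_def good_def \<gamma>'_def)
    show "0 \<le> \<gamma>' t" for t using \<gamma>0 by (simp add: \<gamma>'_def)
  qed (fact T p r pr V 1 2 3)+
  moreover have "\<forall>t v. t \<notin> {0<..<T} \<longrightarrow> h t v = 0" by (auto simp: h_def good_def)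
  ultimately show ?thesis using gh by blast
qed

text \<open>Representatives are arbitrary outside \<open>(0,T)\<close>, whereas \<open>prim\<close>
  integrates over a half-line; cutting off makes the primitive start at time 0.\<close>

definition primT :: "real \<Rightarrow> (real \<Rightarrow> 'a \<Rightarrow> real) \<Rightarrow> real \<Rightarrow> 'a \<Rightarrow> real" where
  "primT T g t v = prim (\<lambda>s. if s \<in> {0<..<T} then g s v else 0) t"

lemma primT_cong_AE:
  assumes "AE t in time T. \<forall>v\<in>V. g t v = h t v" "\<And>t v. t \<notin> {0<..<T} \<Longrightarrow> h t v = 0" "v \<in> V"
    and g: "(\<lambda>t. g t v) \<in> borel_measurable (time T)" and h: "(\<lambda>t. h t v) \<in> borel_measurable lebesgue"
  shows "primT T g t v = prim (\<lambda>s. h s v) t"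
  unfolding primT_def prim_def
proof (rule integral_cong_AE)
  have "(\<lambda>s. if s \<in> {0<..<T} then g s v else 0) \<in> borel_measurable lebesgue"
    using g by (subst borel_measurable_if) auto
  then show "(\<lambda>s. indicator {..t} s * (if s \<in> {0<..<T} then g s v else 0)) \<in> borel_measurable lebesgue"
    by (intro borel_measurable_times borel_measurable_indicator) auto
  show "(\<lambda>s. indicator {..t} s * h s v) \<in> borel_measurable lebesgue"
    using h by (intro borel_measurable_times borel_measurable_indicator) auto
  have "AE s in lebesgue. s \<in> {0<..<T} \<longrightarrow> (\<forall>v\<in>V. g s v = h s v)"
    using assms(1) by (subst (asm) AE_restrict_space_iff) auto
  then show "AE s in lebesgue. indicator {..t} s * (if s \<in> {0<..<T} then g s v else 0) = indicator {..t} s * h s v"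
  proof eventually_elim
    case (elim s)
    then show ?case using assms(2)[of s v] assms(3) by (cases "s \<in> {0<..<T}") auto
  qed
qed

lemma bounded_density_integrable:
  assumes T: "0 < T" and r: "1 < r" and V: "normed_on V n" and g: "bounded_density T V n r g \<gamma>"
    and v: "v \<in> V"
  shows "integrable lebesgue (\<lambda>s. if s \<in> {0<..<T} then g s v else 0)"
proof -
  \<comment> \<open>The conclusion does not involve \<open>p\<close>; the exponent conjugate to
    \<open>r\<close> serves to enter the locale.\<close>
  have p: "1 < r / (r - 1)" using r by simp
  have pr: "1 / (r / (r - 1)) + 1 / r = 1" using r by (simp add: diff_divide_distrib)
  obtain h \<gamma>' where h: "dual_density T (r / (r - 1)) r V n h \<gamma>'" and gh: "AE t in time T. \<forall>v\<in>V. g t v = h t v"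
    using bounded_density_dual_density[OF T p r pr V g] by blast
  have hi: "integrable (time T) (\<lambda>t. h t v)"
    by (intro integrable_time_lebesgue dual_density.h_int[OF h] v)
  have ae: "AE t in time T. h t v = g t v"
    using gh by eventually_elim (simp add: v)
  have "(\<lambda>t. g t v) \<in> borel_measurable (time T)"
    using g v by (simp add: bounded_density_def)
  then have "integrable (time T) (\<lambda>t. g t v)"
    using hi ae by (auto intro: integrable_cong_AE_imp)
  then show ?thesis by (rule integrable_zero_extend)
qed

lemma primT_minus:
  assumes T: "0 < T" and r: "1 < r" and V: "normed_on V n" and v: "v \<in> V"
    and f: "bounded_density T V n r f \<alpha>" and g: "bounded_density T V n r g \<beta>"
  shows "primT T (f - g) t v = primT T f t v - primT T g t v"
proof -
  have "(\<lambda>s. if s \<in> {0<..<T} then (f - g) s v else 0)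
      = (\<lambda>s. (if s \<in> {0<..<T} then f s v else 0) - (if s \<in> {0<..<T} then g s v else 0))"
    by auto
  then show ?thesis
    unfolding primT_def
    by (simp only: prim_minus[OF bounded_density_integrable[OF T r V f v] bounded_density_integrable[OF T r V g v]])
qed

text \<open>The initial condition provides a representative continuous in the dual norm, whose
  evaluation at each \<open>v\<close> falls under \<open>du_bois_reymond\<close>. For it the
  identity holds at every time and every \<open>v\<close>, so passing back to \<open>m\<close> costs
  a single null set independent of \<open>v\<close>.\<close>

lemma weak_derivative_primT:
  assumes T: "0 < T" and r: "1 < r" and V: "normed_on V n" and g: "bounded_density T V n r g \<gamma>"
    and weak: "weak_derivative T V m g" and zero: "zero_initial T V n m"
  shows "AE t in time T. \<forall>v\<in>V. m t v = primT T g t v"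
proof -
  from zero obtain w where mw: "AE t in time T. m t = w t"
    and w: "\<And>t. t \<in> {0..T} \<Longrightarrow> w t \<in> dual_on V n"
    and wlim: "\<And>t. t \<in> {0..T} \<Longrightarrow> ((\<lambda>s. dual_norm V n (w s - w t)) \<longlongrightarrow> 0) (at t within {0..T})"
    and w0: "w 0 = (\<lambda>v. 0)"
    unfolding zero_initial_def eq_ae_def by auto
  have "w t v = primT T g t v" if v: "v \<in> V" and t: "t \<in> {0..T}" for t v
    unfolding primT_def
  proof (rule du_bois_reymond[OF T])
    show wc: "continuous_on {0..T} (\<lambda>t. w t v)"
      unfolding continuous_on_def
    proof
      fix t assume t: "t \<in> {0..T}"
      have "((\<lambda>s. w s v - w t v) \<longlongrightarrow> 0) (at t within {0..T})"
      proof (rule Lim_null_comparison)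
        show "\<forall>\<^sub>F s in at t within {0..T}. norm (w s v - w t v) \<le> dual_norm V n (w s - w t) * n v"
          unfolding eventually_at_filter
        proof (intro always_eventually allI impI)
          fix s assume "s \<in> {0..T}"
          then show "norm (w s v - w t v) \<le> dual_norm V n (w s - w t) * n v"
            using dual_norm_bound[OF V dual_on_minus[OF V w w] v, of s t] t by simp
        qed
        show "((\<lambda>s. dual_norm V n (w s - w t) * n v) \<longlongrightarrow> 0) (at t within {0..T})"
          using tendsto_mult_right[OF wlim[OF t], of "n v"] by simp
      qed
      then show "((\<lambda>t. w t v) \<longlongrightarrow> w t v) (at t within {0..T})" by (simp add: LIM_zero_iff)
    qed
    show "w 0 v = 0" by (simp add: w0)
    show "integrable lebesgue (\<lambda>s. if s \<in> {0<..<T} then g s v else 0)"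
      by (rule bounded_density_integrable[OF T r V g v])
    have wm: "(\<lambda>t. w t v) \<in> borel_measurable (time T)"
      using continuous_on_subset[OF wc greaterThanLessThan_subseteq_atLeastAtMost_iff[THEN iffD2]]
      by (intro continuous_imp_measurable_on_sets_lebesgue) auto
    have mm: "(\<lambda>t. m t v) \<in> borel_measurable (time T)"
      by (rule borel_measurable_time_AE_cong[OF wm]) (use mw in \<open>eventually_elim, simp\<close>)
    fix \<psi> assume \<psi>: "test_function T \<psi>"
    have dm: "deriv \<psi> \<in> borel_measurable (time T)"
    proof -
      from \<psi> obtain D where D: "\<And>x. (\<psi> has_vector_derivative D x) (at x)" "continuous_on UNIV D"
        unfolding test_function_def C1_differentiable_on_def by auto
      have "deriv \<psi> = D"
        using D(1) by (intro ext DERIV_imp_deriv) (simp add: has_real_derivative_iff_has_vector_derivative)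
      then show ?thesis using D(2) by (intro borel_measurable_time borel_measurable_continuous_onI) simp
    qed
    have "(LINT t|time T. deriv \<psi> t * w t v) = (LINT t|time T. deriv \<psi> t * m t v)"
      by (intro integral_cong_AE borel_measurable_times dm wm mm) (use mw in \<open>eventually_elim, simp\<close>)
    also have "\<dots> = - (LINT t|time T. \<psi> t * g t v)"
      using weak \<psi> v by (simp add: weak_derivative_def)
    also have "(LINT t|time T. \<psi> t * g t v) = (LINT t|time T. \<psi> t * (if t \<in> {0<..<T} then g t v else 0))"
      by (intro Bochner_Integration.integral_cong) auto
    finally show "(LINT t|time T. deriv \<psi> t * w t v)
        = - (LINT t|time T. \<psi> t * (if t \<in> {0<..<T} then g t v else 0))" .
  qed (use t in auto)
  then have "\<forall>v\<in>V. w t v = primT T g t v" if "t \<in> {0<..<T}" for t using that by simp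
  then have "AE t in time T. \<forall>v\<in>V. w t v = primT T g t v" by (intro AE_I2) simp
  with mw show ?thesis by eventually_elim simp
qed

lemma bounded_density_pairing_integrable:
  assumes T: "0 < T" and p: "1 < p" and r: "1 < r" and pr: "1 / p + 1 / r = 1"
    and V: "normed_on V n" and g: "bounded_density T V n r g \<gamma>" and w: "w \<in> Lspace p T V n"
  shows "integrable (time T) (\<lambda>t. g t (w t))"
proof -
  obtain h \<gamma>' where h: "dual_density T p r V n h \<gamma>'" and gh: "AE t in time T. \<forall>v\<in>V. g t v = h t v"
    using bounded_density_dual_density[OF T p r pr V g] by blast
  have hi: "integrable (time T) (\<lambda>t. h t (w t))"
    by (rule dual_density.h_eval_integrable[OF h w])
  have wV: "AE t in time T. w t \<in> V" using w by (simp add: Lspace_def strongly_measurable_def)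
  have "AE t in time T. h t (w t) = g t (w t)" using wV gh by eventually_elim simp
  then show ?thesis
    using integrable_cong_AE_imp[OF hi borel_measurable_time_AE_cong[OF borel_measurable_integrable[OF hi]]] by auto
qed

section \<open>The energy inequality for the time derivative\<close>

lemma AE_shift:
  fixes \<tau> :: real
  assumes "AE t in lebesgue. P t"
  shows "AE t in lebesgue. P (t - \<tau>)"
proof -
  have "negligible {t. \<not> P t}"
    using assms by (simp add: negligible_iff_null_sets completion.AE_iff_null_sets)
  then have "negligible ((+) \<tau> ` {t. \<not> P t})" by (rule negligible_translation)
  moreover have "(+) \<tau> ` {t. \<not> P t} = {t. \<not> P (t - \<tau>)}"
    by (auto intro!: image_eqI[of _ _ "_ - \<tau>"])
  ultimately show ?thesis by (simp add: negligible_iff_null_sets completion.AE_iff_null_sets)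
qed

text \<open>With \<open>m = M w \<bullet> w\<close>, \<open>M_cauchy\<close> gives \<open>2 * (M (w
  t) - M (w (t - \<tau>))) \<bullet> w t \<ge> m t - m (t - \<tau>)\<close>, the discrete
  counterpart of the chain rule. The right-hand side has a nonnegative integral over
  \<open>(0,T)\<close>, and \<tau> tends to 0.\<close>

lemma monotone_time_derivative_nonneg:
  fixes M :: "'a::real_inner \<Rightarrow> 'a"
  assumes T: "0 < T" and p: "1 < p" and r: "1 < r" and pr: "1 / p + 1 / r = 1"
    and V: "normed_on V n" and g: "bounded_density T V n r g \<gamma>" and w: "w \<in> Lspace p T V n"
    and M_nonneg: "\<And>x. x \<in> V \<Longrightarrow> 0 \<le> M x \<bullet> x"
    and M_cauchy: "\<And>x y. x \<in> V \<Longrightarrow> y \<in> V \<Longrightarrow> 2 * (M x \<bullet> y) \<le> M x \<bullet> x + M y \<bullet> y"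
    and Mw: "AE t in time T. \<forall>v\<in>V. M (w t) \<bullet> v = primT T g t v"
  shows "0 \<le> (LINT t|time T. g t (w t))"
proof -
  obtain h \<gamma>' where h: "dual_density T p r V n h \<gamma>'" and gh: "AE t in time T. \<forall>v\<in>V. g t v = h t v"
    and h0: "\<And>t v. t \<notin> {0<..<T} \<Longrightarrow> h t v = 0"
    using bounded_density_dual_density[OF T p r pr V g] by blast
  interpret dual_density T p r V n h \<gamma>' by (rule h)
  have wsm: "strongly_measurable T V n w" and wV: "AE t in time T. w t \<in> V"
    and wi: "integrable (time T) (\<lambda>t. n (w t) powr p)"
    using w by (simp_all add: Lspace_def strongly_measurable_def)
  \<comment> \<open>The quantifier over \<open>v\<close> is essential: the identity at time
    \<open>t - \<tau>\<close> is tested with \<open>w t\<close>, the value of \<open>w\<close> at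
    another time.\<close>
  define good where "good t \<longleftrightarrow> w t \<in> V \<and> (\<forall>v\<in>V. M (w t) \<bullet> v = prim (\<lambda>s. h s v) t)" for t
  have good: "AE t in time T. good t"
    using wV Mw
  proof eventually_elim
    case (elim t)
    moreover have "primT T g t v = prim (\<lambda>s. h s v) t" if "v \<in> V" for v
      using g that by (intro primT_cong_AE[OF gh h0 that _ h_meas[OF that]]) (auto simp: bounded_density_def)
    ultimately show ?case by (simp add: good_def)
  qed
  then have good': "AE t in lebesgue. t \<in> {0<..<T} \<longrightarrow> good t"
    by (subst (asm) AE_restrict_space_iff) auto
  define m where "m t = (if t \<in> {0<..<T} then M (w t) \<bullet> w t else 0)" for t
  have m_int: "integrable lebesgue m"
  proof -
    have "integrable (time T) (\<lambda>t. prim (\<lambda>s. h s (w t)) (t - 0))"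
    proof (rule Bochner_Integration.integrable_bound)
      show "integrable (time T) (\<lambda>t. integral\<^sup>L lebesgue \<gamma>' * (1 + n (w t) powr p))"
        by (intro integrable_mult_right Bochner_Integration.integrable_add wi
            finite_measure.integrable_const[OF finite_measure_time])
      show "AE t in time T. norm (prim (\<lambda>s. h s (w t)) (t - 0)) \<le> norm (integral\<^sup>L lebesgue \<gamma>' * (1 + n (w t) powr p))"
        using wV
      proof eventually_elim
        case (elim t)
        have "n (w t) \<le> 1 + n (w t) powr p"
        proof (cases "n (w t) \<le> 1")
          case False
          then have "n (w t) powr 1 \<le> n (w t) powr p" using p by (intro powr_mono) auto
          then show ?thesis using False by simp
        qed (simp add: add_increasing2)
        moreover have "0 \<le> integral\<^sup>L lebesgue \<gamma>'"
          using \<gamma>_nonneg by (intro Bochner_Integration.integral_nonneg)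
        ultimately have "integral\<^sup>L lebesgue \<gamma>' * n (w t) \<le> integral\<^sup>L lebesgue \<gamma>' * (1 + n (w t) powr p)"
          by (rule mult_left_mono)
        then show ?case using prim_h_le[OF elim, of t] by simp
      qed
    qed (rule prim_h_eval_measurable[OF wsm])
    then have i: "integrable (time T) (\<lambda>t. prim (\<lambda>s. h s (w t)) t)" by simp
    have ae: "AE t in time T. prim (\<lambda>s. h s (w t)) t = M (w t) \<bullet> w t"
      using good by eventually_elim (simp add: good_def)
    have "integrable (time T) (\<lambda>t. M (w t) \<bullet> w t)"
      using integrable_cong_AE_imp[OF i borel_measurable_time_AE_cong[OF borel_measurable_integrable[OF i] ae]] ae
      by auto
    then show ?thesis unfolding m_def by (rule integrable_zero_extend)
  qed
  have m_nonneg: "AE t in lebesgue. 0 \<le> m t"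
    using good'
  proof eventually_elim
    case (elim t)
    then have "t \<in> {0<..<T} \<Longrightarrow> w t \<in> V" by (simp add: good_def)
    then show ?case using M_nonneg[of "w t"] by (simp add: m_def)
  qed
  have "0 \<le> (LINT t|time T. quot \<tau> t (w t))" if \<tau>: "0 < \<tau>" for \<tau>
  proof -
    have m_sh: "integrable lebesgue (\<lambda>t. m (t - \<tau>))"
      using lebesgue_integrable_real_affine[OF m_int, of 1 "-\<tau>"] by simp
    \<comment> \<open>Shifting to the right moves mass of the nonnegative \<open>m\<close> out of
      \<open>(0,T)\<close> and brings in only zeros.\<close>
    have "(LINT t|time T. m (t - \<tau>)) \<le> (LINT t|lebesgue. m t)"
      unfolding integral_time_shift
    proof (intro integral_mono_AE integrable_indicator_times m_int)
      show "AE t in lebesgue. indicator {-\<tau><..<T-\<tau>} t * m t \<le> m t"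
        using m_nonneg by eventually_elim (auto split: split_indicator)
    qed simp
    also have "\<dots> = (LINT t|time T. m t)"
      unfolding time_restrict_indicator
      by (intro Bochner_Integration.integral_cong) (auto simp: m_def split: split_indicator)
    finally have "0 \<le> ((LINT t|time T. m t) - (LINT t|time T. m (t - \<tau>))) / (2 * \<tau>)"
      using \<tau> by simp
    also have "\<dots> = (LINT t|time T. (m t - m (t - \<tau>)) / (2 * \<tau>))"
      using integrable_time_lebesgue[OF m_int, of T] integrable_time_lebesgue[OF m_sh, of T] by simp
    also have "\<dots> \<le> (LINT t|time T. quot \<tau> t (w t))"
    proof (rule integral_mono_AE[OF _ quot_eval_integrable[OF w \<tau>]])
      show "integrable (time T) (\<lambda>t. (m t - m (t - \<tau>)) / (2 * \<tau>))"
        by (intro integrable_divide Bochner_Integration.integrable_diff integrable_time_lebesgue m_int m_sh)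
      have "AE t in lebesgue. t - \<tau> \<in> {0<..<T} \<longrightarrow> good (t - \<tau>)" by (rule AE_shift[OF good'])
      then have "AE t in time T. t - \<tau> \<in> {0<..<T} \<longrightarrow> good (t - \<tau>)"
        by (subst AE_restrict_space_iff) (auto intro: AE_I2 eventually_mono)
      moreover have "AE t in time T. t \<in> {0<..<T}" by (intro AE_I2) simp
      ultimately show "AE t in time T. (m t - m (t - \<tau>)) / (2 * \<tau>) \<le> quot \<tau> t (w t)"
        using good
      proof eventually_elim
        case (elim t)
        have wt: "w t \<in> V" and mt: "prim (\<lambda>s. h s (w t)) t = m t"
          using elim by (auto simp: good_def m_def)
        have m0: "0 \<le> m t" using M_nonneg[OF wt] by (simp add: m_def)
        have "2 * prim (\<lambda>s. h s (w t)) (t - \<tau>) \<le> m (t - \<tau>) + m t"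
        proof (cases "t - \<tau> \<in> {0<..<T}")
          case True
          then have "good (t - \<tau>)" using elim by simp
          then show ?thesis using M_cauchy[of "w (t - \<tau>)" "w t"] wt True elim(2) by (simp add: good_def m_def)
        next
          \<comment> \<open>Here the zero initial value enters: before time 0 the primitive and
            \<open>m\<close> are both 0, so the inequality reduces to
            \<open>0 \<le> m t\<close>.\<close>
          case False
          then have "t - \<tau> \<le> 0" using elim(2) \<tau> by auto
          then have "(\<lambda>s. indicator {..t - \<tau>} s * h s (w t)) = (\<lambda>s. 0)"
            using h0 by (intro ext) (auto split: split_indicator)
          then have "prim (\<lambda>s. h s (w t)) (t - \<tau>) = 0"
            unfolding prim_def by (simp only: Bochner_Integration.integral_zero)
          then show ?thesis using m0 False by (auto simp: m_def)
        qed
        then have "(m t - m (t - \<tau>)) / (2 * \<tau>)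
            \<le> 2 * (prim (\<lambda>s. h s (w t)) t - prim (\<lambda>s. h s (w t)) (t - \<tau>)) / (2 * \<tau>)"
          using mt \<tau> by (intro divide_right_mono) auto
        then show ?case unfolding quot_def by (simp only: mult_divide_mult_cancel_left_if) simp
      qed
    qed
    finally show ?thesis .
  qed
  then have "\<forall>\<^sub>F \<tau> in at_right 0. 0 \<le> (LINT t|time T. quot \<tau> t (w t))"
    by (intro eventually_mono[OF eventually_at_right_less[of 0]]) auto
  from tendsto_lowerbound[OF quot_integral_tendsto[OF w] this]
  have "0 \<le> (LINT t|time T. h t (w t))" by simp
  also have "(LINT t|time T. h t (w t)) = (LINT t|time T. g t (w t))"
  proof (rule integral_cong_AE)
    show "(\<lambda>t. h t (w t)) \<in> borel_measurable (time T)" by (rule h_eval_measurable[OF wsm])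
    show "(\<lambda>t. g t (w t)) \<in> borel_measurable (time T)"
      using bounded_density_pairing_integrable[OF T p r pr V g w] by (rule borel_measurable_integrable)
    show "AE t in time T. h t (w t) = g t (w t)" using wV gh by eventually_elim simp
  qed
  finally show ?thesis .
qed

subsection \<open>Monotonicity of the partial problems\<close>

lemma properD:
  assumes "proper p T P"
  shows proper_normed_V: "normed_on (VV P) (nV P)" and proper_normed_H: "normed_on (HH P) norm"
    and proper_V_le_H: "VV P \<subseteq> HH P" and proper_dense: "HH P \<subseteq> closure (VV P)"
  using assms by (auto simp: proper_def banach_on_def densely_embedded_def intro!: normed_on_norm)

text \<open>The last inequality is \<open>M (x - y) \<bullet> (x - y) \<ge> 0\<close> multiplied
  out, with the mixed terms merged by symmetry. It replaces the Cauchy-Schwarz inequality without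
  square roots.\<close>

lemma proper_M:
  assumes "proper p T P"
  shows proper_M_diff: "x \<in> HH P \<Longrightarrow> y \<in> HH P \<Longrightarrow> MM P (x - y) = MM P x - MM P y"
    and proper_M_nonneg: "x \<in> HH P \<Longrightarrow> 0 \<le> MM P x \<bullet> x"
    and proper_M_cauchy: "x \<in> HH P \<Longrightarrow> y \<in> HH P \<Longrightarrow> 2 * (MM P x \<bullet> y) \<le> MM P x \<bullet> x + MM P y \<bullet> y"
proof -
  note H = proper_normed_H[OF assms]
  have lin: "bounded_linear_on (HH P) norm (HH P) norm (MM P)"
    and mono: "\<And>x y. x \<in> HH P \<Longrightarrow> y \<in> HH P \<Longrightarrow> 0 \<le> (MM P x - MM P y) \<bullet> (x - y)"
    and sym: "\<And>x y. x \<in> HH P \<Longrightarrow> y \<in> HH P \<Longrightarrow> MM P x \<bullet> y = MM P y \<bullet> x"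
    using assms by (auto simp: proper_def)
  have add: "\<And>x y. x \<in> HH P \<Longrightarrow> y \<in> HH P \<Longrightarrow> MM P (x + y) = MM P x + MM P y"
    using lin by (simp add: bounded_linear_on_def)
  show diff: "MM P (x - y) = MM P x - MM P y" if "x \<in> HH P" "y \<in> HH P" for x y
    using add[OF normed_on_diff[OF H that] that(2)] by simp
  have "MM P 0 = 0" using diff[OF normed_on_0[OF H] normed_on_0[OF H]] by simp
  then show "0 \<le> MM P x \<bullet> x" if "x \<in> HH P" for x
    using mono[OF that normed_on_0[OF H]] by simp
  show "2 * (MM P x \<bullet> y) \<le> MM P x \<bullet> x + MM P y \<bullet> y" if "x \<in> HH P" "y \<in> HH P" for x y
    using mono[OF that] sym[OF that] by (simp add: inner_diff_left inner_diff_right)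
qed

lemma ddt_props:
  assumes "u \<in> dom_ddt p T V n"
  shows "ddt p T V n u \<in> Lspace (conj_exp p) T (dual_on V n) (dual_norm V n)"
    and "weak_derivative T V u (ddt p T V n u)" and "zero_initial T V n u"
proof -
  have "\<exists>g. g \<in> Lspace (conj_exp p) T (dual_on V n) (dual_norm V n) \<and> weak_derivative T V u g"
    using assms by (auto simp: dom_ddt_def W1_dual_def)
  from someI_ex[OF this]
  show "ddt p T V n u \<in> Lspace (conj_exp p) T (dual_on V n) (dual_norm V n)"
    "weak_derivative T V u (ddt p T V n u)"
    by (auto simp: ddt_def)
  show "zero_initial T V n u" using assms by (simp add: dom_ddt_def)
qed

text \<open>The inhomogeneity cancels, the operators contribute \<open>k\<close>, and the time
  derivatives contribute something nonnegative. Because \<open>ddt\<close> is a choice of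
  representative, the derivative of the difference is never formed: \<open>g1 - g2\<close> itself
  has \<open>M (w1 - w2)\<close> as its primitive, which is all that the energy inequality asks for.
  The representatives \<open>h1\<close>, \<open>h2\<close> turn the duality pairing into an inner
  product.\<close>

lemma calF_difference:
  assumes T: "0 < T" and p: "2 \<le> p" and P: "proper p T P" and k: "k_monotone p T P k"
    and w1: "w1 \<in> calW p T P" and w2: "w2 \<in> calW p T P"
    and h1: "represents T P (calF p T P w1) h1" and h2: "represents T P (calF p T P w2) h2"
  shows "integrable (time T) (\<lambda>t. (h1 t - h2 t) \<bullet> (w1 t - w2 t))"
    and "k (\<lambda>t. w1 t - w2 t) \<le> (LINT t|time T. (h1 t - h2 t) \<bullet> (w1 t - w2 t))"
proof -
  let ?V = "VV P" and ?n = "nV P" and ?r = "conj_exp p" and ?e = "\<lambda>t. w1 t - w2 t"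
  note V = proper_normed_V[OF P]
  have p1: "1 < p" and r: "1 < ?r" and pr: "1 / p + 1 / ?r = 1"
    using p by (auto simp: conj_exp_def diff_divide_distrib)
  have r0: "0 < ?r" using r by simp
  have V1: "w1 \<in> calV p T P" and V2: "w2 \<in> calV p T P"
    and D1: "calM P w1 \<in> dom_ddt p T ?V ?n" and D2: "calM P w2 \<in> dom_ddt p T ?V ?n"
    using w1 w2 by (auto simp: calW_def)
  have e: "?e \<in> Lspace p T ?V ?n"
    using V1 V2 p by (intro Lspace_diff[OF V]) (auto simp: calV_def)
  have wV: "AE t in time T. w1 t \<in> ?V \<and> w2 t \<in> ?V"
    using V1 V2 by (simp add: calV_def Lspace_def strongly_measurable_def)
  define g1 g2 where "g1 = ddt p T ?V ?n (calM P w1)" and "g2 = ddt p T ?V ?n (calM P w2)"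
  obtain \<gamma>1 where \<gamma>1: "bounded_density T ?V ?n ?r g1 \<gamma>1"
    using bounded_density_Lspace[OF V r0 ddt_props(1)[OF D1]] unfolding g1_def by blast
  obtain \<gamma>2 where \<gamma>2: "bounded_density T ?V ?n ?r g2 \<gamma>2"
    using bounded_density_Lspace[OF V r0 ddt_props(1)[OF D2]] unfolding g2_def by blast
  note g = bounded_density_minus[OF V r0 \<gamma>1 \<gamma>2]
  have A1: "AA P w1 \<in> Lspace ?r T (dual_on ?V ?n) (dual_norm ?V ?n)"
    and A2: "AA P w2 \<in> Lspace ?r T (dual_on ?V ?n) (dual_norm ?V ?n)"
    using P V1 V2 by (auto simp: proper_def maps_V_dual_def calV_dual_def)
  obtain \<alpha>1 \<alpha>2 where \<alpha>: "bounded_density T ?V ?n ?r (AA P w1) \<alpha>1" "bounded_density T ?V ?n ?r (AA P w2) \<alpha>2"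
    using bounded_density_Lspace[OF V r0 A1] bounded_density_Lspace[OF V r0 A2] by blast
  note a = bounded_density_minus[OF V r0 \<alpha>]
  have gi: "integrable (time T) (\<lambda>t. (g1 - g2) t (?e t))"
    by (rule bounded_density_pairing_integrable[OF T p1 r pr V g e])
  have ai: "integrable (time T) (\<lambda>t. (AA P w1 - AA P w2) t (?e t))"
    by (rule bounded_density_pairing_integrable[OF T p1 r pr V a e])
  have prim1: "AE t in time T. \<forall>v\<in>?V. calM P w1 t v = primT T g1 t v"
    by (rule weak_derivative_primT[OF T r V \<gamma>1]) (use ddt_props[OF D1] in \<open>auto simp: g1_def\<close>)
  have prim2: "AE t in time T. \<forall>v\<in>?V. calM P w2 t v = primT T g2 t v"
    by (rule weak_derivative_primT[OF T r V \<gamma>2]) (use ddt_props[OF D2] in \<open>auto simp: g2_def\<close>)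
  have "0 \<le> (LINT t|time T. (g1 - g2) t (?e t))"
  proof (rule monotone_time_derivative_nonneg[OF T p1 r pr V g e, where M = "MM P"])
    show "AE t in time T. \<forall>v\<in>?V. MM P (?e t) \<bullet> v = primT T (g1 - g2) t v"
      using prim1 prim2 wV
    proof eventually_elim
      case (elim t)
      have "w1 t \<in> HH P" "w2 t \<in> HH P" using elim proper_V_le_H[OF P] by auto
      then show ?case
        using elim by (auto simp: proper_M_diff[OF P] inner_diff_left calM_def embed_def
            primT_minus[OF T r V _ \<gamma>1 \<gamma>2])
    qed
    show "0 \<le> MM P x \<bullet> x" if "x \<in> ?V" for x
      using that proper_V_le_H[OF P] by (intro proper_M_nonneg[OF P]) auto
    show "2 * (MM P x \<bullet> y) \<le> MM P x \<bullet> x + MM P y \<bullet> y" if "x \<in> ?V" "y \<in> ?V" for x y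
      using that proper_V_le_H[OF P] by (intro proper_M_cauchy[OF P]) auto
  qed
  moreover have "k ?e \<le> (LINT t|time T. (AA P w1 - AA P w2) t (?e t))"
    using k V1 V2 unfolding k_monotone_def pairing_def by blast
  moreover have eq: "AE t in time T. (g1 - g2) t (?e t) + (AA P w1 - AA P w2) t (?e t) = (h1 t - h2 t) \<bullet> ?e t"
  proof -
    have "AE t in time T. calF p T P w1 t = embed ?V (h1 t)" "AE t in time T. calF p T P w2 t = embed ?V (h2 t)"
      using h1 h2 by (auto simp: represents_def eq_ae_def)
    then show ?thesis using wV
    proof eventually_elim
      case (elim t)
      have eV: "?e t \<in> ?V" using elim by (intro normed_on_diff[OF V]) auto
      have "g1 t (?e t) + AA P w1 t (?e t) + ff P t (?e t) = h1 t \<bullet> ?e t"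
        using fun_cong[OF elim(1), of "?e t"] eV by (simp add: calF_def embed_def g1_def)
      moreover have "g2 t (?e t) + AA P w2 t (?e t) + ff P t (?e t) = h2 t \<bullet> ?e t"
        using fun_cong[OF elim(2), of "?e t"] eV by (simp add: calF_def embed_def g2_def)
      ultimately show ?case by (simp add: inner_diff_left)
    qed
  qed
  ultimately have kle: "k ?e \<le> (LINT t|time T. (g1 - g2) t (?e t) + (AA P w1 - AA P w2) t (?e t))"
    by (subst Bochner_Integration.integral_add[OF gi ai]) simp
  note i = Bochner_Integration.integrable_add[OF gi ai]
  note m = borel_measurable_time_AE_cong[OF borel_measurable_integrable[OF i] eq]
  show "integrable (time T) (\<lambda>t. (h1 t - h2 t) \<bullet> ?e t)"
    by (rule integrable_cong_AE_imp[OF i m]) (use eq in \<open>eventually_elim, simp\<close>)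
  show "k ?e \<le> (LINT t|time T. (h1 t - h2 t) \<bullet> ?e t)"
    using kle integral_cong_AE[OF borel_measurable_integrable[OF i] m eq] by simp
qed

section \<open>Norms and partial operators on \<open>calH\<close>\<close>

lemma normH_sq: "(normH T v)\<^sup>2 = (LINT t|time T. (norm (v t))\<^sup>2)"
proof -
  have "0 \<le> (LINT t|time T. (norm (v t))\<^sup>2)"
    by (intro Bochner_Integration.integral_nonneg) simp
  then show ?thesis
    by (simp add: normH_def Lnorm_def powr_half_sqrt)
qed

lemma calH_diff: "proper p T P \<Longrightarrow> u \<in> calH T P \<Longrightarrow> v \<in> calH T P \<Longrightarrow> (\<lambda>t. u t - v t) \<in> calH T P"
  unfolding calH_def by (rule Lspace_diff[OF proper_normed_H]) auto

lemma calH_integrable: "v \<in> calH T P \<Longrightarrow> integrable (time T) (\<lambda>t. (norm (v t))\<^sup>2)"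
  by (simp add: calH_def Lspace_def)

lemma calH_AE: "v \<in> calH T P \<Longrightarrow> AE t in time T. v t \<in> HH P"
  by (simp add: calH_def Lspace_def strongly_measurable_def)

text \<open>The adjoint relation moves \<open>E\<close> onto the error as \<open>R\<close>, which
  reduces the claim to the pairing in the space of \<open>Q\<close>. \<open>R\<close> is linear on
  \<open>HH P\<close> only, so \<open>R u1 - R u2\<close> and \<open>R (u1 - u2)\<close> agree
  merely almost everywhere; \<open>k\<close> does not distinguish them because it respects
  \<open>eq_ae\<close>.\<close>

lemma calFl_difference:
  assumes T: "0 < T" and p: "2 \<le> p" and P: "proper p T P" and Q: "proper p T Q"
    and k: "k_monotone p T Q k"
    and R: "bounded_linear_on (HH P) norm (HH Q) norm R"
    and adj: "\<And>x v. x \<in> HH Q \<Longrightarrow> v \<in> HH P \<Longrightarrow> E x \<bullet> v = x \<bullet> R v"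
    and u1: "u1 \<in> dom_Fl p T P Q R" and u2: "u2 \<in> dom_Fl p T P Q R"
    and c: "\<And>v. v \<in> calH T P \<Longrightarrow> (\<lambda>t. R (v t)) \<in> calV p T Q \<Longrightarrow> c * (normH T v)\<^sup>2 \<le> k (\<lambda>t. R (v t))"
  shows "integrable (time T) (\<lambda>t. (calFl p T Q E R u1 t - calFl p T Q E R u2 t) \<bullet> (u1 t - u2 t))"
    and "c * (normH T (\<lambda>t. u1 t - u2 t))\<^sup>2
      \<le> (LINT t|time T. (calFl p T Q E R u1 t - calFl p T Q E R u2 t) \<bullet> (u1 t - u2 t))"
proof -
  define h where "h u = (SOME h. represents T Q (calF p T Q (\<lambda>t. R (u t))) h)" for u
  have h: "represents T Q (calF p T Q (\<lambda>t. R (u t))) (h u)" if "u \<in> dom_Fl p T P Q R" for u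
    using that someI_ex[of "represents T Q (calF p T Q (\<lambda>t. R (u t)))"] by (auto simp: h_def dom_Fl_def)
  have Fl: "calFl p T Q E R u = (\<lambda>t. E (h u t))" for u by (simp add: calFl_def h_def)
  have H1: "u1 \<in> calH T P" and H2: "u2 \<in> calH T P"
    and W1: "(\<lambda>t. R (u1 t)) \<in> calW p T Q" and W2: "(\<lambda>t. R (u2 t)) \<in> calW p T Q"
    using u1 u2 by (auto simp: dom_Fl_def)
  have Rdiff: "R (x - y) = R x - R y" if "x \<in> HH P" "y \<in> HH P" for x y
  proof -
    have "\<forall>x\<in>HH P. \<forall>y\<in>HH P. R (x + y) = R x + R y" using R by (simp add: bounded_linear_on_def)
    then have "R (x - y + y) = R (x - y) + R y"
      using normed_on_diff[OF proper_normed_H[OF P] that] that(2) by blast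
    then show ?thesis by simp
  qed
  have uH: "AE t in time T. u1 t \<in> HH P \<and> u2 t \<in> HH P"
    using calH_AE[OF H1] calH_AE[OF H2] by eventually_elim simp
  have hH: "AE t in time T. h u1 t \<in> HH Q \<and> h u2 t \<in> HH Q"
    using h[OF u1] h[OF u2] calH_AE[of "h u1" T Q] calH_AE[of "h u2" T Q] by (simp add: represents_def)
  let ?w = "\<lambda>t. R (u1 t) - R (u2 t)" and ?v = "\<lambda>t. u1 t - u2 t"
  have Rw: "AE t in time T. ?w t = R (?v t)"
    using uH by eventually_elim (simp add: Rdiff)
  have eq: "AE t in time T. (h u1 t - h u2 t) \<bullet> ?w t
      = (calFl p T Q E R u1 t - calFl p T Q E R u2 t) \<bullet> ?v t"
    using uH hH
  proof eventually_elim
    case (elim t)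
    then have "?v t \<in> HH P" by (intro normed_on_diff[OF proper_normed_H[OF P]]) auto
    then show ?case using elim by (simp add: Fl inner_diff_left adj Rdiff)
  qed
  note i = calF_difference(1)[OF T p Q k W1 W2 h[OF u1] h[OF u2]]
  note m = borel_measurable_time_AE_cong[OF borel_measurable_integrable[OF i] eq]
  show "integrable (time T) (\<lambda>t. (calFl p T Q E R u1 t - calFl p T Q E R u2 t) \<bullet> ?v t)"
    by (rule integrable_cong_AE_imp[OF i m]) (use eq in \<open>eventually_elim, simp\<close>)
  have wV: "?w \<in> calV p T Q"
    using W1 W2 p unfolding calV_def calW_def by (intro Lspace_diff[OF proper_normed_V[OF Q]]) auto
  then have "(\<lambda>t. nV Q (?w t)) \<in> borel_measurable (time T)"
    by (intro strongly_measurable_norm[OF proper_normed_V[OF Q]]) (simp add: calV_def Lspace_def)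
  then have vV: "(\<lambda>t. R (?v t)) \<in> calV p T Q"
    using Lspace_AE_cong[OF wV[unfolded calV_def] Rw] by (simp add: calV_def)
  have "c * (normH T ?v)\<^sup>2 \<le> k (\<lambda>t. R (?v t))"
    by (rule c[OF calH_diff[OF P H1 H2] vV])
  also have "\<dots> = k ?w"
  proof -
    have "eq_ae T (\<lambda>t. R (?v t)) ?w"
      unfolding eq_ae_def using Rw by eventually_elim (rule sym)
    then show ?thesis using k vV wV unfolding k_monotone_def by blast
  qed
  also have "\<dots> \<le> (LINT t|time T. (h u1 t - h u2 t) \<bullet> ?w t)"
    by (rule calF_difference(2)[OF T p Q k W1 W2 h[OF u1] h[OF u2]])
  also have "\<dots> = (LINT t|time T. (calFl p T Q E R u1 t - calFl p T Q E R u2 t) \<bullet> ?v t)"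
    by (rule integral_cong_AE[OF borel_measurable_integrable[OF i] m eq])
  finally show "c * (normH T ?v)\<^sup>2
      \<le> (LINT t|time T. (calFl p T Q E R u1 t - calFl p T Q E R u2 t) \<bullet> ?v t)" .
qed

lemma calFl_calH:
  assumes P: "proper p T P" and Q: "proper p T Q"
    and E: "bounded_linear_on (HH Q) norm (HH P) norm E" and u: "u \<in> dom_Fl p T P Q R"
  shows "calFl p T Q E R u \<in> calH T P"
proof -
  have "represents T Q (calF p T Q (\<lambda>t. R (u t))) (SOME h. represents T Q (calF p T Q (\<lambda>t. R (u t))) h)"
    using u someI_ex[of "represents T Q (calF p T Q (\<lambda>t. R (u t)))"] by (auto simp: dom_Fl_def)
  then show ?thesis
    unfolding calFl_def calH_def represents_def
    by (intro Lspace_image[OF E proper_normed_H[OF Q] proper_normed_H[OF P]]) auto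
qed

subsection \<open>The splitting scheme\<close>

lemma dense_orthogonal_eq_0:
  fixes x :: "'a::real_inner"
  assumes "x \<in> closure V" "\<And>v. v \<in> V \<Longrightarrow> x \<bullet> v = 0"
  shows "x = 0"
proof -
  have "closure V \<subseteq> {y. x \<bullet> y = 0}"
    by (rule closure_minimal) (use assms(2) in \<open>auto intro!: closed_Collect_eq continuous_intros\<close>)
  then show ?thesis using assms(1) by auto
qed

text \<open>Since the \<open>a l\<close> sum to zero, they may be tested with \<open>x l - y\<close> instead of \<open>x l\<close>, and the
  dissipation term \<open>s/2 (norm (x l - y))\<^sup>2\<close> absorbs the result.\<close>

lemma splitting_energy:
  fixes x d a :: "'i \<Rightarrow> 'a::real_inner"
  assumes s: "0 < s" and step: "\<And>l. l \<in> I \<Longrightarrow> s *\<^sub>R (x l - y) = - d l - a l" and a: "(\<Sum>l\<in>I. a l) = 0"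
  shows "(\<Sum>l\<in>I. s / 2 * ((norm (x l))\<^sup>2 - (norm y)\<^sup>2) + d l \<bullet> x l) \<le> (\<Sum>l\<in>I. (norm (a l))\<^sup>2 / (2 * s))"
proof -
  have "s / 2 * ((norm (x l))\<^sup>2 - (norm y)\<^sup>2) + d l \<bullet> x l \<le> (norm (a l))\<^sup>2 / (2 * s) - a l \<bullet> y" if l: "l \<in> I" for l
  proof -
    let ?z = "x l - y"
    \<comment> \<open>This identity holds the dissipation of an implicit step: the increment of the
      squared norm falls short of \<open>2 * (?z \<bullet> x l)\<close> by the square of the
      increment.\<close>
    have e1: "(norm (x l))\<^sup>2 - (norm y)\<^sup>2 = 2 * (?z \<bullet> x l) - (norm ?z)\<^sup>2"
      by (simp add: power2_norm_eq_inner inner_diff_left inner_diff_right inner_commute)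
    have e2: "s * (?z \<bullet> x l) = - (d l \<bullet> x l) - a l \<bullet> x l"
      using arg_cong[OF step[OF l], of "\<lambda>z. z \<bullet> x l"] by (simp add: inner_diff_left)
    have 1: "s / 2 * ((norm (x l))\<^sup>2 - (norm y)\<^sup>2) + d l \<bullet> x l = - (a l \<bullet> x l) - s / 2 * (norm ?z)\<^sup>2"
    proof -
      have "s / 2 * ((norm (x l))\<^sup>2 - (norm y)\<^sup>2) = s * (?z \<bullet> x l) - s / 2 * (norm ?z)\<^sup>2"
        unfolding e1 by (simp add: right_diff_distrib)
      then show ?thesis using e2 by linarith
    qed
    \<comment> \<open>Completing the square with weight \<open>s\<close> matches the coefficient
      \<open>s / 2\<close> of the dissipation exactly, leaving \<open>1 / (2 * s)\<close> in front
      of the norm of \<open>a l\<close> squared.\<close>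
    have "0 \<le> (norm (a l + s *\<^sub>R ?z))\<^sup>2 / (2 * s)" using s by simp
    also have "(norm (a l + s *\<^sub>R ?z))\<^sup>2 = (norm (a l))\<^sup>2 + 2 * s * (a l \<bullet> ?z) + s * s * (norm ?z)\<^sup>2"
    proof -
      have "(norm (b + s *\<^sub>R z))\<^sup>2 = (norm b)\<^sup>2 + 2 * s * (b \<bullet> z) + s * s * (norm z)\<^sup>2" for b z :: 'a
        by (simp add: power2_norm_eq_inner inner_add_left inner_add_right inner_commute)
      then show ?thesis .
    qed
    also have "\<dots> / (2 * s) = (norm (a l))\<^sup>2 / (2 * s) + a l \<bullet> ?z + s / 2 * (norm ?z)\<^sup>2"
      using s by (simp add: add_divide_distrib)
    finally have "- (a l \<bullet> ?z) - s / 2 * (norm ?z)\<^sup>2 \<le> (norm (a l))\<^sup>2 / (2 * s)" by simp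
    then show ?thesis unfolding 1 by (simp add: inner_diff_right)
  qed
  then have "(\<Sum>l\<in>I. s / 2 * ((norm (x l))\<^sup>2 - (norm y)\<^sup>2) + d l \<bullet> x l)
      \<le> (\<Sum>l\<in>I. (norm (a l))\<^sup>2 / (2 * s) - a l \<bullet> y)"
    by (rule sum_mono)
  also have "\<dots> = (\<Sum>l\<in>I. (norm (a l))\<^sup>2 / (2 * s))"
    using a by (simp add: sum_subtractf flip: inner_sum_left)
  finally show ?thesis .
qed

text \<open>Convexity of the squared norm, from the Cauchy-Schwarz inequality against the constant
  1.\<close>

lemma norm_average_le:
  fixes x :: "'i \<Rightarrow> 'a::real_inner"
  assumes "finite I" "I \<noteq> {}"
  shows "real (card I) * (norm ((1 / real (card I)) *\<^sub>R (\<Sum>l\<in>I. x l)))\<^sup>2 \<le> (\<Sum>l\<in>I. (norm (x l))\<^sup>2)"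
proof -
  have c: "0 < real (card I)" using assms by (simp add: card_gt_0_iff)
  have "(norm (\<Sum>l\<in>I. x l))\<^sup>2 \<le> (\<Sum>l\<in>I. norm (x l))\<^sup>2"
    by (intro power_mono norm_sum) simp
  also have "\<dots> \<le> (\<Sum>l\<in>I. (norm (x l))\<^sup>2) * real (card I)"
    using Cauchy_Schwarz_ineq_sum[of "\<lambda>l. norm (x l)" "\<lambda>_. 1" I] by simp
  finally show ?thesis
    using c by (simp add: power_divide field_simps power2_eq_square)
qed

text \<open>The constant \<open>B / (2 * c * s)\<close> is the fixed point of the recursion taken
  with equality; subtracting it leaves a pure geometric decay. It is of order \<open>1/s\<close>:
  local errors of order \<open>1/s^2\<close> accumulate over about \<open>s\<close> effective
  steps.\<close>

lemma splitting_recursion: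
  fixes x :: "nat \<Rightarrow> real"
  assumes s: "0 < s" and c: "0 < c" and x0: "0 \<le> x 0" and B: "0 \<le> B"
    and step: "\<And>n. n < N \<Longrightarrow> (1 + 2 * c / s) * x (Suc n) \<le> x n + B / s\<^sup>2"
  shows "n \<le> N \<Longrightarrow> x n \<le> x 0 / (1 + 2 * c / s) ^ n + B / (2 * c * s)"
proof (induction n)
  case 0
  then show ?case using s c B by simp
next
  case (Suc n)
  let ?q = "1 + 2 * c / s"
  have q: "0 < ?q" using s c by (simp add: add_pos_pos)
  have "?q * x (Suc n) \<le> x 0 / ?q ^ n + (B / (2 * c * s) + B / s\<^sup>2)"
    using step[of n] Suc by simp
  also have "B / (2 * c * s) + B / s\<^sup>2 = ?q * (B / (2 * c * s))"
    using s c by (simp add: field_simps power2_eq_square)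
  finally have "?q * x (Suc n) \<le> ?q * (x 0 / ?q ^ Suc n + B / (2 * c * s))"
    using q by (simp add: distrib_left)
  then show ?case using q by (simp only: mult_le_cancel_left_pos)
qed

text \<open>The equation for \<open>u\<close> holds in the dual of \<open>V\<close>, but the energy
  estimate needs the sum to vanish in \<open>H\<close>. Assumption (III) makes the sum an element of
  \<open>H\<close> orthogonal to \<open>V\<close>, and \<open>V\<close> is dense.\<close>

lemma calFl_sum_eq_0:
  assumes P: "proper p T P" and III: "assumption_III p T q P Q E R"
    and u: "\<And>l. l \<in> {1..q} \<Longrightarrow> u \<in> dom_Fl p T P (Q l) (R l)"
    and zero: "eq_ae T (calF p T P u) (\<lambda>t v. 0)"
  shows "AE t in time T. (\<Sum>l=1..q. calFl p T (Q l) (E l) (R l) u t) = 0"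
proof -
  let ?S = "\<lambda>t. \<Sum>l=1..q. calFl p T (Q l) (E l) (R l) u t"
  have "represents T P (calF p T P u) ?S"
    using III u by (simp add: assumption_III_def)
  then have "AE t in time T. calF p T P u t = embed (VV P) (?S t)" "AE t in time T. ?S t \<in> HH P"
    using calH_AE[of ?S T P] by (auto simp: represents_def eq_ae_def)
  with zero[unfolded eq_ae_def] show ?thesis
  proof eventually_elim
    case (elim t)
    have "?S t \<bullet> v = 0" if "v \<in> VV P" for v
      using fun_cong[OF trans[OF elim(2)[symmetric] elim(1)], of v] that by (simp add: embed_def)
    then show ?case
      using elim(3) proper_dense[OF P] by (intro dense_orthogonal_eq_0[of _ "VV P"]) auto
  qed
qed

text \<open>Here \<open>w\<close> and \<open>w'\<close> are consecutive iterates, \<open>x l\<close>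
  the intermediate approximations, \<open>f l\<close> and \<open>a l\<close> the values of the
  partial operator at \<open>x l\<close> and at \<open>u\<close>. The pointwise energy inequality is
  integrated in time, coercivity bounds the pairing from below, and averaging passes from the
  \<open>x l\<close> to \<open>w'\<close>.\<close>

lemma splitting_step:
  fixes a :: "nat \<Rightarrow> real \<Rightarrow> 'a::{real_inner,banach}"
  assumes q: "q \<ge> 1" and s: "0 < s" and c: "0 \<le> c" and P: "proper p T P"
    and u: "u \<in> calH T P" and w: "w \<in> calH T P" and w': "w' \<in> calH T P"
    and x: "\<And>l. l \<in> {1..q} \<Longrightarrow> x l \<in> calH T P"
    and a: "\<And>l. l \<in> {1..q} \<Longrightarrow> a l \<in> calH T P"
    and sum: "AE t in time T. (\<Sum>l=1..q. a l t) = 0"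
    and step: "\<And>l. l \<in> {1..q} \<Longrightarrow> AE t in time T. s *\<^sub>R x l t + f l t = s *\<^sub>R w t"
    and avg: "AE t in time T. w' t = (1 / real q) *\<^sub>R (\<Sum>l=1..q. x l t)"
    and int: "\<And>l. l \<in> {1..q} \<Longrightarrow> integrable (time T) (\<lambda>t. (f l t - a l t) \<bullet> (x l t - u t))"
    and coer: "\<And>l. l \<in> {1..q} \<Longrightarrow> c * (normH T (\<lambda>t. x l t - u t))\<^sup>2
      \<le> (LINT t|time T. (f l t - a l t) \<bullet> (x l t - u t))"
  shows "(1 + 2 * c / s) * (normH T (\<lambda>t. w' t - u t))\<^sup>2
    \<le> (normH T (\<lambda>t. w t - u t))\<^sup>2 + ((\<Sum>l=1..q. (normH T (a l))\<^sup>2) / real q) / s\<^sup>2"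
proof -
  let ?N = "\<lambda>v. (normH T (\<lambda>t. v t - u t))\<^sup>2"
  let ?A = "\<Sum>l=1..q. (normH T (a l))\<^sup>2" and ?X = "\<Sum>l=1..q. ?N (x l)"
  have di: "integrable (time T) (\<lambda>t. (norm (v t - u t))\<^sup>2)" if "v \<in> calH T P" for v
    by (rule calH_integrable[OF calH_diff[OF P that u]])
  have qpos: "0 < real q" using q by simp
  have steps: "AE t in time T. \<forall>l\<in>{1..q}. s *\<^sub>R x l t + f l t = s *\<^sub>R w t"
    by (subst AE_ball_countable) (use step in \<open>auto intro: countable_finite\<close>)
  let ?L = "\<lambda>l t. s / 2 * ((norm (x l t - u t))\<^sup>2 - (norm (w t - u t))\<^sup>2) + (f l t - a l t) \<bullet> (x l t - u t)"
  have Li: "integrable (time T) (?L l)" if "l \<in> {1..q}" for l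
    by (intro Bochner_Integration.integrable_add integrable_mult_right Bochner_Integration.integrable_diff
        di x w int that)
  have Ai: "integrable (time T) (\<lambda>t. (norm (a l t))\<^sup>2 / (2 * s))" if "l \<in> {1..q}" for l
    by (intro integrable_divide calH_integrable[OF a[OF that]])
  have "(\<Sum>l=1..q. s / 2 * (?N (x l) - ?N w) + c * ?N (x l)) \<le> (\<Sum>l=1..q. (LINT t|time T. ?L l t))"
  proof (rule sum_mono)
    fix l assume l: "l \<in> {1..q}"
    have "(LINT t|time T. ?L l t) = s / 2 * (?N (x l) - ?N w) + (LINT t|time T. (f l t - a l t) \<bullet> (x l t - u t))"
      unfolding normH_sq using di[OF x[OF l]] di[OF w] int[OF l] by simp
    then show "s / 2 * (?N (x l) - ?N w) + c * ?N (x l) \<le> (LINT t|time T. ?L l t)"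
      using coer[OF l] by simp
  qed
  also have "\<dots> = (LINT t|time T. (\<Sum>l=1..q. ?L l t))"
    by (rule Bochner_Integration.integral_sum[symmetric]) (rule Li)
  also have "\<dots> \<le> (LINT t|time T. (\<Sum>l=1..q. (norm (a l t))\<^sup>2 / (2 * s)))"
  proof (rule integral_mono_AE)
    show "AE t in time T. (\<Sum>l=1..q. ?L l t) \<le> (\<Sum>l=1..q. (norm (a l t))\<^sup>2 / (2 * s))"
      using steps sum
    proof eventually_elim
      case (elim t)
      show ?case
      proof (rule splitting_energy[OF s _ elim(2)])
        fix l assume "l \<in> {1..q}"
        then have "s *\<^sub>R x l t + f l t = s *\<^sub>R w t" using elim(1) by blast
        then have "s *\<^sub>R x l t = s *\<^sub>R w t - f l t" by (metis add_diff_cancel_right')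
        then show "s *\<^sub>R (x l t - u t - (w t - u t)) = - (f l t - a l t) - a l t"
          by (simp add: scaleR_diff_right)
      qed
    qed
  qed (intro Bochner_Integration.integrable_sum Li Ai; assumption)+
  also have "\<dots> = (\<Sum>l=1..q. (LINT t|time T. (norm (a l t))\<^sup>2 / (2 * s)))"
    by (rule Bochner_Integration.integral_sum) (rule Ai)
  also have "\<dots> = ?A / (2 * s)"
    by (simp add: normH_sq sum_divide_distrib)
  also have "(\<Sum>l=1..q. s / 2 * (?N (x l) - ?N w) + c * ?N (x l)) = s / 2 * (?X - real q * ?N w) + c * ?X"
    unfolding sum.distrib sum_distrib_left[symmetric] sum_subtractf by simp
  finally have 1: "s / 2 * (?X - real q * ?N w) + c * ?X \<le> ?A / (2 * s)" .
  have "real q * ?N w' = (LINT t|time T. real q * (norm (w' t - u t))\<^sup>2)"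
    unfolding normH_sq by simp
  also have "\<dots> \<le> (LINT t|time T. (\<Sum>l=1..q. (norm (x l t - u t))\<^sup>2))"
  proof (rule integral_mono_AE)
    show "AE t in time T. real q * (norm (w' t - u t))\<^sup>2 \<le> (\<Sum>l=1..q. (norm (x l t - u t))\<^sup>2)"
      using avg
    proof eventually_elim
      case (elim t)
      have "w' t - u t = (1 / real q) *\<^sub>R (\<Sum>l=1..q. x l t - u t)"
        using elim qpos by (simp add: sum_subtractf scaleR_diff_right sum_constant_scaleR)
      then show ?case using norm_average_le[of "{1..q}" "\<lambda>l. x l t - u t"] q by simp
    qed
  qed (auto intro!: Bochner_Integration.integrable_sum integrable_mult_right di x w')
  also have "\<dots> = ?X"
    unfolding normH_sq by (rule Bochner_Integration.integral_sum) (rule di[OF x])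
  finally have 2: "real q * ?N w' \<le> ?X" .
  have "(s / 2 + c) * (real q * ?N w') \<le> (s / 2 + c) * ?X"
    using s c by (intro mult_left_mono 2) auto
  also have "\<dots> \<le> s / 2 * real q * ?N w + ?A / (2 * s)" using 1 by (simp add: algebra_simps)
  \<comment> \<open>The factor \<open>2 / (s * real q)\<close> normalises the coefficient of the old
    error to 1, which turns \<open>?A / (2 * s)\<close> into \<open>1/s^2\<close> times the average
    over \<open>l\<close>.\<close>
  finally have "(s / 2 + c) * (real q * ?N w') * (2 / (s * real q))
      \<le> (s / 2 * real q * ?N w + ?A / (2 * s)) * (2 / (s * real q))"
    using s qpos by (intro mult_right_mono) auto
  also have "(s / 2 + c) * (real q * ?N w') * (2 / (s * real q)) = (1 + 2 * c / s) * ?N w'"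
    using s qpos by (simp add: field_simps)
  also have "(s / 2 * real q * ?N w + ?A / (2 * s)) * (2 / (s * real q)) = ?N w + (?A / real q) / s\<^sup>2"
    using s qpos by (simp add: field_simps power2_eq_square)
  finally show ?thesis .
qed

theorem theorem2:
  fixes p T c C :: real and q :: nat
    and P :: "'a::{real_inner,banach} problem"
    and Q :: "nat \<Rightarrow> 'b::{real_inner,banach} problem"
    and E :: "nat \<Rightarrow> 'b \<Rightarrow> 'a" and R :: "nat \<Rightarrow> 'a \<Rightarrow> 'b"
    and k :: "nat \<Rightarrow> (real \<Rightarrow> 'b) \<Rightarrow> real"
    and u u0 :: "real \<Rightarrow> 'a"
    and U :: "nat \<Rightarrow> nat \<Rightarrow> real \<Rightarrow> 'a"
    and UL :: "nat \<Rightarrow> nat \<Rightarrow> nat \<Rightarrow> real \<Rightarrow> 'a"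
  assumes "q \<ge> 2"
    and "decomposition_data p T q P Q E R"
    and "assumption_I p T q P Q E R"
    and "assumption_II p q P Q R"
    and "assumption_III p T q P Q E R"
    and "\<forall>l\<in>{1..q}. k_monotone p T (Q l) (k l)"
    and "u \<in> calW p T P"
    and "eq_ae T (calF p T P u) (\<lambda>t v. 0)"
    and "\<forall>l\<in>{1..q}. u \<in> dom_Fl p T P (Q l) (R l)"
    and "c > 0"
    and "\<forall>l\<in>{1..q}. \<forall>v\<in>calH T P. (\<lambda>t. R l (v t)) \<in> calV p T (Q l) \<longrightarrow>
           k l (\<lambda>t. R l (v t)) \<ge> c * (normH T v)\<^sup>2"
    and "C > 0"
    and "u0 \<in> calH T P"
    and "\<forall>N\<ge>1. additive_splitting p T q P Q E R (C * sqrt (real N)) N u0 (U N) (UL N)"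
  shows "(\<lambda>N. normH T (\<lambda>t. U N N t - u t)) \<longlonglongrightarrow> 0"
proof -
  have T: "0 < T" and p: "2 \<le> p" and q: "1 \<le> q"
    and E: "\<And>l. l \<in> {1..q} \<Longrightarrow> bounded_linear_on (HH (Q l)) norm (HH P) norm (E l)"
    and R: "\<And>l. l \<in> {1..q} \<Longrightarrow> bounded_linear_on (HH P) norm (HH (Q l)) norm (R l)"
    using assms(1,2) by (auto simp: decomposition_data_def)
  have P: "proper p T P" and Q: "\<And>l. l \<in> {1..q} \<Longrightarrow> proper p T (Q l)"
    and adj: "\<And>l x v. l \<in> {1..q} \<Longrightarrow> x \<in> HH (Q l) \<Longrightarrow> v \<in> HH P \<Longrightarrow> E l x \<bullet> v = x \<bullet> R l v"
    using assms(3) by (auto simp: assumption_I_def)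
  have dom: "u \<in> dom_Fl p T P (Q l) (R l)" if "l \<in> {1..q}" for l using assms(9) that by blast
  have kmon: "k_monotone p T (Q l) (k l)" if "l \<in> {1..q}" for l using assms(6) that by blast
  have coer: "c * (normH T v)\<^sup>2 \<le> k l (\<lambda>t. R l (v t))"
    if "l \<in> {1..q}" "v \<in> calH T P" "(\<lambda>t. R l (v t)) \<in> calV p T (Q l)" for l v
    using assms(11) that by blast
  have uH: "u \<in> calH T P" using dom[of 1] q by (simp add: dom_Fl_def)
  define F where "F l v = calFl p T (Q l) (E l) (R l) v" for l v
  have FH: "F l u \<in> calH T P" if "l \<in> {1..q}" for l
    unfolding F_def by (rule calFl_calH[OF P Q[OF that] E[OF that] dom[OF that]])
  have sum0: "AE t in time T. (\<Sum>l=1..q. F l u t) = 0"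
    unfolding F_def by (rule calFl_sum_eq_0[OF P assms(5) dom assms(8)])
  define B where "B = (\<Sum>l=1..q. (normH T (F l u))\<^sup>2) / real q"
  have B: "0 \<le> B" by (auto simp: B_def intro!: divide_nonneg_nonneg sum_nonneg)
  define X0 where "X0 = (normH T (\<lambda>t. u0 t - u t))\<^sup>2"
  \<comment> \<open>The first summand comes from bounding \<open>(1 + 2 * c / s) ^ N\<close> below
    by Bernoulli's inequality, the second from \<open>B / (2 * c * s)\<close> with \<open>s\<close>
    inserted.\<close>
  define K where "K = X0 * C / (2 * c) + B / (2 * c * C)"
  have bound: "(normH T (\<lambda>t. U N N t - u t))\<^sup>2 \<le> K / sqrt (real N)" if N: "1 \<le> N" for N
  proof -
    define s where "s = C * sqrt (real N)"
    have s: "0 < s" using assms(12) N by (simp add: s_def)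
    define x where "x n = (normH T (\<lambda>t. U N n t - u t))\<^sup>2" for n
    have spl: "additive_splitting p T q P Q E R s N u0 (U N) (UL N)"
      using assms(14) N by (simp add: s_def)
    have UH: "U N n \<in> calH T P" if "n \<le> N" for n
      using spl that by (simp add: additive_splitting_def)
    have step: "(1 + 2 * c / s) * x (Suc n) \<le> x n + B / s\<^sup>2" if n: "n < N" for n
      unfolding x_def B_def
    proof (rule splitting_step[OF q s less_imp_le[OF assms(10)] P uH, where x = "UL N (Suc n)" and f = "\<lambda>l. F l (UL N (Suc n) l)"])
      have UL: "UL N (Suc n) l \<in> dom_Fl p T P (Q l) (R l)" if "l \<in> {1..q}" for l
        using spl n that by (simp add: additive_splitting_def)
      show "U N n \<in> calH T P" "U N (Suc n) \<in> calH T P" using UH n by auto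
      show "UL N (Suc n) l \<in> calH T P" if "l \<in> {1..q}" for l
        using UL[OF that] by (simp add: dom_Fl_def)
      show "F l u \<in> calH T P" if "l \<in> {1..q}" for l by (rule FH[OF that])
      show "AE t in time T. (\<Sum>l=1..q. F l u t) = 0" by (rule sum0)
      show "AE t in time T. s *\<^sub>R UL N (Suc n) l t + F l (UL N (Suc n) l) t = s *\<^sub>R U N n t" if "l \<in> {1..q}" for l
        using spl n that by (simp add: additive_splitting_def eq_ae_def F_def)
      show "AE t in time T. U N (Suc n) t = (1 / real q) *\<^sub>R (\<Sum>l=1..q. UL N (Suc n) l t)"
        using spl n by (simp add: additive_splitting_def eq_ae_def)
      fix l assume l: "l \<in> {1..q}"
      note d = calFl_difference[OF T p P Q[OF l] kmon[OF l] R[OF l] adj[OF l] UL[OF l] dom[OF l] coer[OF l]]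
      show "integrable (time T) (\<lambda>t. (F l (UL N (Suc n) l) t - F l u t) \<bullet> (UL N (Suc n) l t - u t))"
        unfolding F_def by (rule d(1))
      show "c * (normH T (\<lambda>t. UL N (Suc n) l t - u t))\<^sup>2
          \<le> (LINT t|time T. (F l (UL N (Suc n) l) t - F l u t) \<bullet> (UL N (Suc n) l t - u t))"
        unfolding F_def by (rule d(2))
    qed
    \<comment> \<open>The scheme fixes the starting iterate only up to a null set, separately for
      each \<open>N\<close>; its error is nevertheless the same number for all
      \<open>N\<close>.\<close>
    have x0: "x 0 = X0"
      unfolding x_def X0_def normH_sq
    proof (rule integral_cong_AE)
      show "AE t in time T. (norm (U N 0 t - u t))\<^sup>2 = (norm (u0 t - u t))\<^sup>2"
        using spl[unfolded additive_splitting_def eq_ae_def, THEN conjunct1] by eventually_elim simp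
      show "(\<lambda>t. (norm (U N 0 t - u t))\<^sup>2) \<in> borel_measurable (time T)"
        "(\<lambda>t. (norm (u0 t - u t))\<^sup>2) \<in> borel_measurable (time T)"
        by (intro borel_measurable_integrable calH_integrable[where P = P] calH_diff[OF P] UH uH assms(13); simp)+
    qed
    have "x N \<le> X0 / (1 + 2 * c / s) ^ N + B / (2 * c * s)"
      using splitting_recursion[where x = x, OF s assms(10) _ B step] by (simp add: x0 X0_def)
    also have "X0 / (1 + 2 * c / s) ^ N \<le> X0 * C / (2 * c) / sqrt (real N)"
    proof -
      \<comment> \<open>\<open>N / s\<close> equals \<open>sqrt (real N) / C\<close>, so the linear
        term of Bernoulli's inequality already yields decay of the order of the other error
        term.\<close>
      have "2 * c / C * sqrt (real N) = real N * (2 * c / s)"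
        using N assms(12) by (simp add: s_def field_simps)
      also have "\<dots> \<le> (1 + 2 * c / s) ^ N"
      proof -
        have "0 \<le> 2 * c / s" using s assms(10) by simp
        then show ?thesis using Bernoulli_inequality[of "2 * c / s" N] by linarith
      qed
      finally have le: "2 * c / C * sqrt (real N) \<le> (1 + 2 * c / s) ^ N" .
      have "X0 / (1 + 2 * c / s) ^ N \<le> X0 / (2 * c / C * sqrt (real N))"
      proof (rule divide_left_mono[OF le])
        have "0 < 2 * c / C * sqrt (real N)" using N assms(10,12) by simp
        with le show "0 < (1 + 2 * c / s) ^ N * (2 * c / C * sqrt (real N))"
          by (meson less_le_trans mult_pos_pos)
      qed (simp add: X0_def)
      then show ?thesis using assms(10,12) by (simp add: field_simps)
    qed
    also have "B / (2 * c * s) = B / (2 * c * C) / sqrt (real N)" by (simp add: s_def)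
    finally show ?thesis by (simp add: x_def K_def add_divide_distrib)
  qed
  have "(\<lambda>N. K / sqrt (real N)) \<longlonglongrightarrow> 0"
    by (intro tendsto_divide_0[OF tendsto_const] filterlim_at_top_imp_at_infinity
        filterlim_compose[OF sqrt_at_top filterlim_real_sequentially])
  then have "(\<lambda>N. (normH T (\<lambda>t. U N N t - u t))\<^sup>2) \<longlonglongrightarrow> 0"
    by (rule tendsto_sandwich[OF _ _ tendsto_const, rotated 2])
       (use bound in \<open>auto simp: eventually_sequentially\<close>)
  from tendsto_real_sqrt[OF this] show ?thesis
    by (auto simp: tendsto_rabs_zero_iff)
qed

end
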